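(* Let $\mathbb{K}$ be a field and assume that $\mathcal{C}$ is a $\mathbb{K}$-linear, Ext-finite, Krull–Schmidt, extriangulated category with Auslander–Reiten–Serre duality. Assume that $T$ is a projective object of $\mathcal{C}$ such that any $X\in\mathcal{C}$ admits a conflation $T_1^X\rightarrowtail T_0^X\twoheadrightarrow X$ with $T_0^X,T_1^X\in\mathrm{add}(T)$, and the morphism $T\to0$ is an inflation. Fix a conflation $T\rightarrowtail0\twoheadrightarrow\Sigma T$. Then $\mathcal{C}$ has only finitely many isomorphism classes of indecomposable objects if and only if the set \[ L:=\{\ell_X\mid X\in\mathrm{ind}(\mathcal{C})\smallsetminus\mathrm{add}(\Sigma T)\} \] generates the kernel of the canonical projection $\mathbf{g}:K_0^{\mathrm{sp}}(\mathcal{C})\to K_0(\mathcal{C})$. In this case, the set $L$ is a basis of the kernel of $\mathbf{g}$, and for any $x\in\ker(\mathbf{g})$, \[ x=\sum_{A\in\mathrm{ind}(\mathcal{C})\smallsetminus\mathrm{add}(\Sigma T)}\frac{\langle x,A\rangle}{\langle\ell_A,A\rangle}\,\ell_A. \]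
   Context: An extriangulated category (Nakaoka–Palu) is a triple $(\mathcal{C},\mathbb{E},\mathfrak{s})$ where $\mathcal{C}$ is an additive category and: (ET1) $\mathbb{E}:\mathcal{C}^{op}\times\mathcal{C}\to\mathrm{Ab}$ is an additive bifunctor. Elements $\delta\in\mathbb{E}(Z,X)$ are called extensions; for $f:X\to X'$, $h:Z'\to Z$ write $f_*\delta=\mathbb{E}(Z,f)(\delta)$, $h^*\delta=\mathbb{E}(h,X)(\delta)$. A morphism $\delta\to\delta'$ from $\delta\in\mathbb{E}(Z,X)$ to $\delta'\in\mathbb{E}(Z',X')$ is a pair $(f:X\to X',h:Z\to Z')$ with $f_*\delta=h^*\delta'$. (ET2) $\mathfrak{s}$ is an additive realization: it assigns to each $\delta\in\mathbb{E}(Z,X)$ a class $\mathfrak{s}(\delta)=[X\xrightarrow{x}Y\xrightarrow{y}Z]$ of sequences up to isomorphism of the middle term compatible with identities on $X,Z$; for any morphism $(f,h):\delta\to\delta'$ with $\mathfrak{s}(\delta')=[X'\xrightarrow{x'}Y'\xrightarrow{y'}Z']$ there is $g:Y\to Y'$ with $gx=x'f$, $hy=y'g$; $\mathfrak{s}(0)=[X\to X\oplus Z\to Z]$; and $\mathfrak{s}(\delta\oplus\delta')=\mathfrak{s}(\delta)\oplus\mathfrak{s}(\delta')$. (ET3) If $\delta,\delta'$ are realized by $X\xrightarrow{x}Y\xrightarrow{y}Z$, $X'\xrightarrow{x'}Y'\xrightarrow{y'}Z'$ and $gx=x'f$, there is $h:Z\to Z'$ with $(f,h):\delta\to\delta'$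 a morphism and $hy=y'g$; and the dual (ET3)$^{op}$. (ET4) If $\delta\in\mathbb{E}(Z',X)$, $\delta'\in\mathbb{E}(X',Y)$ are realized by $X\xrightarrow{f}Y\xrightarrow{f'}Z'$ and $Y\xrightarrow{g}Z\xrightarrow{g'}X'$, there are an object $Y'$, morphisms $h=gf:X\to Z$, $h':Z\to Y'$, $d:Z'\to Y'$, $e:Y'\to X'$ with $h'g=df'$, $eh'=g'$, and $\delta''\in\mathbb{E}(Y',X)$ realized by $X\xrightarrow{h}Z\xrightarrow{h'}Y'$, such that $Z'\xrightarrow{d}Y'\xrightarrow{e}X'$ realizes $f'_*\delta'$, $d^*\delta''=\delta$ and $f_*\delta''=e^*\delta'$; and the dual (ET4)$^{op}$. A sequence $X\to Y\to Z$ realizing some extension is a conflation, written $X\rightarrowtail Y\twoheadrightarrow Z$; then $X\to Y$ is an inflation and $Y\to Z$ a deflation. $P$ is projective if $\mathbb{E}(P,-)=0$; $I$ is injective if $\mathbb{E}(-,I)=0$. Ext-finite: $\mathbb{E}(X,Y)$ is finite-dimensional over $\mathbb{K}$ for all $X,Y$. Krull–Schmidt: every object is a finite direct sum of objects with local endomorphism rings. Auslander–Reiten–Serre duality: an equivalence $\tau:\underline{\mathcal{C}}\to\overline{\mathcal{C}}$ together with binatural isomorphisms $\underline{\mathcal{C}}(X,Y)\cong D\,\mathbb{E}(Y,\tau X)$, $D=\mathrm{Hom}_{\mathbb{K}}(-,\mathbb{K})$, where $\underline{\mathcal{C}}$ (resp. $\overline{\mathcal{C}}$) is the quotient of $\mathcal{C}$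 by the ideal of morphisms $f$ with $\mathbb{E}(f,-)=0$ (resp. $\mathbb{E}(-,f)=0$). $\mathrm{ind}(\mathcal{C})$: a set of representatives of isomorphism classes of indecomposable objects. $K_0^{\mathrm{sp}}(\mathcal{C})$: split Grothendieck group (free abelian on $\mathrm{ind}(\mathcal{C})$). $K_0(\mathcal{C})$: its quotient by $[X]-[Y]+[Z]$ for all conflations $X\rightarrowtail Y\twoheadrightarrow Z$. With $F=\mathcal{C}(T,-):\mathcal{C}\to\mathrm{mod}\,\mathrm{End}_{\mathcal{C}}(T)$, the bilinear form on $K_0^{\mathrm{sp}}(\mathcal{C})$ is determined by $\langle X,Y\rangle:=\dim_{\mathbb{K}}\mathrm{Hom}_{\mathrm{End}_{\mathcal{C}}(T)}(FX,FY)$ (finite under these assumptions). A non-split extension $\delta\in\mathbb{E}(Z,X)$ is almost split if $f_*\delta=0$ for every non-section $f:X\to X'$ and $g^*\delta=0$ for every non-retraction $g:Z'\to Z$. For indecomposable $X\notin\mathrm{add}(\Sigma T)$ there is a conflation $X\rightarrowtail E\twoheadrightarrow Y$ realizing an almost split extension, unique up to isomorphism, and $\ell_X:=[X]+[Y]-[E]\in K_0^{\mathrm{sp}}(\mathcal{C})$. *)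

theory Defs
  imports Complex_Main "Jordan_Normal_Form.Missing_VectorSpace" "HOL-Algebra.AbelCoset"
    "HOL-Algebra.Free_Abelian_Groups"
begin

text \<open>
  A \<open>K\<close>-linear category is given by a set of objects, a \<open>K\<close>-module of morphisms for each pair of
  objects, composition \<open>g \<cdot> f\<close> (first \<open>f\<close>, then \<open>g\<close>) and identities.  Composition carries no object
  arguments, since the morphism sets are required to be pairwise disjoint below.
\<close>

record ('k, 'o, 'm) lincat =
  Ob :: "'o set"
  Hom :: "'o \<Rightarrow> 'o \<Rightarrow> ('k, 'm) module"
  cmp :: "'m \<Rightarrow> 'm \<Rightarrow> 'm"  (infixl \<open>\<cdot>\<index>\<close> 70)
  ident :: "'o \<Rightarrow> 'm"

locale linear_category =
  fixes K :: "'k ring" and C :: "('k, 'o, 'm, 'x) lincat_scheme" (structure)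
  assumes base_field: "field K"
    and Hom_vectorspace: "\<lbrakk>X \<in> Ob C; Y \<in> Ob C\<rbrakk> \<Longrightarrow> vectorspace K (Hom C X Y)"
    and Hom_disjoint:
      "\<lbrakk>X \<in> Ob C; Y \<in> Ob C; X' \<in> Ob C; Y' \<in> Ob C;
        f \<in> carrier (Hom C X Y); f \<in> carrier (Hom C X' Y')\<rbrakk> \<Longrightarrow> X = X' \<and> Y = Y'"
    and ident_closed: "X \<in> Ob C \<Longrightarrow> ident C X \<in> carrier (Hom C X X)"
    and cmp_linear_left:
      "\<lbrakk>X \<in> Ob C; Y \<in> Ob C; Z \<in> Ob C; f \<in> carrier (Hom C X Y)\<rbrakk>
        \<Longrightarrow> (\<lambda>g. g \<cdot> f) \<in> LinearCombinations.module_hom K (Hom C Y Z) (Hom C X Z)"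
    and cmp_linear_right:
      "\<lbrakk>X \<in> Ob C; Y \<in> Ob C; Z \<in> Ob C; g \<in> carrier (Hom C Y Z)\<rbrakk>
        \<Longrightarrow> (\<lambda>f. g \<cdot> f) \<in> LinearCombinations.module_hom K (Hom C X Y) (Hom C X Z)"
    and cmp_assoc:
      "\<lbrakk>W \<in> Ob C; X \<in> Ob C; Y \<in> Ob C; Z \<in> Ob C; f \<in> carrier (Hom C W X);
        g \<in> carrier (Hom C X Y); h \<in> carrier (Hom C Y Z)\<rbrakk> \<Longrightarrow> (h \<cdot> g) \<cdot> f = h \<cdot> (g \<cdot> f)"
    and ident_left:
      "\<lbrakk>X \<in> Ob C; Y \<in> Ob C; f \<in> carrier (Hom C X Y)\<rbrakk> \<Longrightarrow> ident C Y \<cdot> f = f"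
    and ident_right:
      "\<lbrakk>X \<in> Ob C; Y \<in> Ob C; f \<in> carrier (Hom C X Y)\<rbrakk> \<Longrightarrow> f \<cdot> ident C X = f"

context fixes C :: "('k, 'o, 'm, 'x) lincat_scheme" (structure) begin

definition is_zero_object :: "'o \<Rightarrow> bool" where
  "is_zero_object Z \<longleftrightarrow> Z \<in> Ob C \<and>
     (\<forall>X \<in> Ob C. carrier (Hom C X Z) = {\<zero>\<^bsub>Hom C X Z\<^esub>} \<and> carrier (Hom C Z X) = {\<zero>\<^bsub>Hom C Z X\<^esub>})"

definition iso_mor :: "'o \<Rightarrow> 'o \<Rightarrow> 'm \<Rightarrow> bool" where
  "iso_mor X Y f \<longleftrightarrow> f \<in> carrier (Hom C X Y) \<and>
     (\<exists>g \<in> carrier (Hom C Y X). g \<cdot> f = ident C X \<and> f \<cdot> g = ident C Y)"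

definition isomorphic :: "'o \<Rightarrow> 'o \<Rightarrow> bool" where
  "isomorphic X Y \<longleftrightarrow> X \<in> Ob C \<and> Y \<in> Ob C \<and> (\<exists>f. iso_mor X Y f)"

definition section_mor :: "'o \<Rightarrow> 'o \<Rightarrow> 'm \<Rightarrow> bool" where
  "section_mor X Y f \<longleftrightarrow> f \<in> carrier (Hom C X Y) \<and> (\<exists>r \<in> carrier (Hom C Y X). r \<cdot> f = ident C X)"

definition retraction_mor :: "'o \<Rightarrow> 'o \<Rightarrow> 'm \<Rightarrow> bool" where
  "retraction_mor X Y f \<longleftrightarrow> f \<in> carrier (Hom C X Y) \<and> (\<exists>s \<in> carrier (Hom C Y X). f \<cdot> s = ident C Y)"

definition biproduct :: "'o \<Rightarrow> 'o \<Rightarrow> 'o \<Rightarrow> 'm \<Rightarrow> 'm \<Rightarrow> 'm \<Rightarrow> 'm \<Rightarrow> bool" where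
  "biproduct X Y B i j p q \<longleftrightarrow>
     X \<in> Ob C \<and> Y \<in> Ob C \<and> B \<in> Ob C \<and>
     i \<in> carrier (Hom C X B) \<and> j \<in> carrier (Hom C Y B) \<and>
     p \<in> carrier (Hom C B X) \<and> q \<in> carrier (Hom C B Y) \<and>
     p \<cdot> i = ident C X \<and> q \<cdot> j = ident C Y \<and>
     p \<cdot> j = \<zero>\<^bsub>Hom C Y X\<^esub> \<and> q \<cdot> i = \<zero>\<^bsub>Hom C X Y\<^esub> \<and>
     i \<cdot> p \<oplus>\<^bsub>Hom C B B\<^esub> j \<cdot> q = ident C B"

definition direct_sum :: "'o list \<Rightarrow> 'o \<Rightarrow> bool" where
  "direct_sum As X \<longleftrightarrow> set As \<subseteq> Ob C \<and> X \<in> Ob C \<and>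
     (\<exists>i p.
        (\<forall>k < length As. i k \<in> carrier (Hom C (As ! k) X) \<and> p k \<in> carrier (Hom C X (As ! k))) \<and>
        (\<forall>k < length As. \<forall>l < length As.
           p k \<cdot> i l = (if k = l then ident C (As ! k) else \<zero>\<^bsub>Hom C (As ! l) (As ! k)\<^esub>)) \<and>
        (\<Oplus>\<^bsub>Hom C X X\<^esub> k \<in> {..<length As}. i k \<cdot> p k) = ident C X)"

definition add_closure :: "'o \<Rightarrow> 'o set" where
  "add_closure T = {X. \<exists>Y S n. direct_sum [X, Y] S \<and> direct_sum (replicate n T) S}"

definition indecomposable :: "'o \<Rightarrow> bool" where
  "indecomposable X \<longleftrightarrow> X \<in> Ob C \<and> \<not> is_zero_object X \<and>
     (\<forall>A B. direct_sum [A, B] X \<longrightarrow> is_zero_object A \<or> is_zero_object B)"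

definition indec_iso_classes :: "'o set set" where
  "indec_iso_classes = {X. indecomposable X} // {(X, Y). isomorphic X Y}"

text \<open>\<open>I\<close> is a choice of \<open>ind(C)\<close>.\<close>

definition ind_representatives :: "'o set \<Rightarrow> bool" where
  "ind_representatives I \<longleftrightarrow> I \<subseteq> {X. indecomposable X} \<and>
     (\<forall>X. indecomposable X \<longrightarrow> (\<exists>!A. A \<in> I \<and> isomorphic X A))"

definition End_ring :: "'o \<Rightarrow> 'm ring" where
  "End_ring X = \<lparr>carrier = carrier (Hom C X X), mult = (\<lambda>g f. g \<cdot> f), one = ident C X,
     ring.zero = \<zero>\<^bsub>Hom C X X\<^esub>, add = (\<lambda>f g. f \<oplus>\<^bsub>Hom C X X\<^esub> g)\<rparr>"

end

locale additive_category = linear_category +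
  assumes ex_zero_object: "\<exists>Z. is_zero_object C Z"
    and ex_biproduct: "\<lbrakk>X \<in> Ob C; Y \<in> Ob C\<rbrakk> \<Longrightarrow> \<exists>B i j p q. biproduct C X Y B i j p q"

text \<open>Local rings in the noncommutative sense: nonzero rings whose non-units are closed under addition.\<close>

definition local_ring :: "('a, 'b) ring_scheme \<Rightarrow> bool" where
  "local_ring R \<longleftrightarrow> ring R \<and> \<one>\<^bsub>R\<^esub> \<noteq> \<zero>\<^bsub>R\<^esub> \<and>
     (\<forall>a \<in> carrier R - Units R. \<forall>b \<in> carrier R - Units R. a \<oplus>\<^bsub>R\<^esub> b \<notin> Units R)"

definition krull_schmidt :: "('k, 'o, 'm, 'x) lincat_scheme \<Rightarrow> bool" where
  "krull_schmidt C \<longleftrightarrow>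
     (\<forall>X \<in> Ob C. \<exists>As. direct_sum C As X \<and> (\<forall>A \<in> set As. local_ring (End_ring C A)))"

text \<open>
  \<open>Ext C Z X\<close> is the space \<open>E(Z, X)\<close>, \<open>push C f \<delta>\<close> is \<open>f\<^sub>* \<delta>\<close> and \<open>pull C h \<delta>\<close> is \<open>h\<^sup>* \<delta>\<close>.
  \<open>realiz C Z X \<delta>\<close> is the class \<open>s(\<delta>)\<close>, a set of triples \<open>(x, Y, y)\<close>
  standing for the sequences with maps \<open>x : X \<rightarrow> Y\<close> and \<open>y : Y \<rightarrow> Z\<close>.
\<close>

record ('k, 'o, 'm, 'e) extricat = "('k, 'o, 'm) lincat" +
  Ext :: "'o \<Rightarrow> 'o \<Rightarrow> ('k, 'e) module"
  push :: "'m \<Rightarrow> 'e \<Rightarrow> 'e"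
  pull :: "'m \<Rightarrow> 'e \<Rightarrow> 'e"
  realiz :: "'o \<Rightarrow> 'o \<Rightarrow> 'e \<Rightarrow> ('m \<times> 'o \<times> 'm) set"

definition opposite :: "('k, 'o, 'm, 'e) extricat \<Rightarrow> ('k, 'o, 'm, 'e) extricat" where
  "opposite C = \<lparr>Ob = Ob C, Hom = (\<lambda>X Y. Hom C Y X), cmp = (\<lambda>g f. f \<cdot>\<^bsub>C\<^esub> g), ident = ident C,
     Ext = (\<lambda>Z X. Ext C X Z), push = pull C, pull = push C,
     realiz = (\<lambda>Z X \<delta>. {(x, Y, y). (y, Y, x) \<in> realiz C X Z \<delta>})\<rparr>"

context fixes C :: "('k, 'o, 'm, 'e) extricat" (structure) begin

definition sequences :: "'o \<Rightarrow> 'o \<Rightarrow> ('m \<times> 'o \<times> 'm) set" where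
  "sequences X Z = {(x, Y, y). Y \<in> Ob C \<and> x \<in> carrier (Hom C X Y) \<and> y \<in> carrier (Hom C Y Z)}"

definition seq_equiv :: "'o \<Rightarrow> 'o \<Rightarrow> (('m \<times> 'o \<times> 'm) \<times> ('m \<times> 'o \<times> 'm)) set" where
  "seq_equiv X Z = {((x, Y, y), (x', Y', y')). (x, Y, y) \<in> sequences X Z \<and> (x', Y', y') \<in> sequences X Z \<and>
     (\<exists>b. iso_mor C Y Y' b \<and> b \<cdot> x = x' \<and> y' \<cdot> b = y)}"

definition realized_by :: "'e \<Rightarrow> 'o \<Rightarrow> 'm \<Rightarrow> 'o \<Rightarrow> 'm \<Rightarrow> 'o \<Rightarrow> bool" where
  "realized_by \<delta> X x Y y Z \<longleftrightarrow> X \<in> Ob C \<and> Z \<in> Ob C \<and> \<delta> \<in> carrier (Ext C Z X) \<and>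
     (x, Y, y) \<in> realiz C Z X \<delta>"

definition conflation :: "'o \<Rightarrow> 'm \<Rightarrow> 'o \<Rightarrow> 'm \<Rightarrow> 'o \<Rightarrow> bool" where
  "conflation X x Y y Z \<longleftrightarrow> (\<exists>\<delta>. realized_by \<delta> X x Y y Z)"

definition inflation :: "'o \<Rightarrow> 'o \<Rightarrow> 'm \<Rightarrow> bool" where
  "inflation X Y x \<longleftrightarrow> (\<exists>y Z. conflation X x Y y Z)"

definition projective :: "'o \<Rightarrow> bool" where
  "projective P \<longleftrightarrow> P \<in> Ob C \<and> (\<forall>X \<in> Ob C. carrier (Ext C P X) = {\<zero>\<^bsub>Ext C P X\<^esub>})"

definition ET3 :: bool where
  "ET3 \<longleftrightarrow> (\<forall>\<delta> X x Y y Z \<delta>' X' x' Y' y' Z' f g.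
     realized_by \<delta> X x Y y Z \<and> realized_by \<delta>' X' x' Y' y' Z' \<and>
     f \<in> carrier (Hom C X X') \<and> g \<in> carrier (Hom C Y Y') \<and> g \<cdot> x = x' \<cdot> f \<longrightarrow>
     (\<exists>h \<in> carrier (Hom C Z Z'). push C f \<delta> = pull C h \<delta>' \<and> h \<cdot> y = y' \<cdot> g))"

definition ET4 :: bool where
  "ET4 \<longleftrightarrow> (\<forall>\<delta> X f Y f' Z' \<delta>' g Z g' X'.
     realized_by \<delta> X f Y f' Z' \<and> realized_by \<delta>' Y g Z g' X' \<longrightarrow>
     (\<exists>Y' \<in> Ob C. \<exists>h' \<in> carrier (Hom C Z Y'). \<exists>d \<in> carrier (Hom C Z' Y'). \<exists>e \<in> carrier (Hom C Y' X').
      \<exists>\<delta>'' \<in> carrier (Ext C Y' X).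
        h' \<cdot> g = d \<cdot> f' \<and> e \<cdot> h' = g' \<and>
        realized_by \<delta>'' X (g \<cdot> f) Z h' Y' \<and>
        realized_by (push C f' \<delta>') Z' d Y' e X' \<and>
        pull C d \<delta>'' = \<delta> \<and> push C f \<delta>'' = pull C e \<delta>'))"

end

locale extriangulated_category = additive_category K C
  for K :: "'k ring" and C :: "('k, 'o, 'm, 'e) extricat" (structure) +
  assumes Ext_vectorspace: "\<lbrakk>Z \<in> Ob C; X \<in> Ob C\<rbrakk> \<Longrightarrow> vectorspace K (Ext C Z X)"
    and push_linear:
      "\<lbrakk>Z \<in> Ob C; X \<in> Ob C; X' \<in> Ob C; f \<in> carrier (Hom C X X')\<rbrakk>
        \<Longrightarrow> push C f \<in> LinearCombinations.module_hom K (Ext C Z X) (Ext C Z X')"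
    and push_linear_mor:
      "\<lbrakk>Z \<in> Ob C; X \<in> Ob C; X' \<in> Ob C; \<delta> \<in> carrier (Ext C Z X)\<rbrakk>
        \<Longrightarrow> (\<lambda>f. push C f \<delta>) \<in> LinearCombinations.module_hom K (Hom C X X') (Ext C Z X')"
    and pull_linear:
      "\<lbrakk>Z \<in> Ob C; Z' \<in> Ob C; X \<in> Ob C; h \<in> carrier (Hom C Z' Z)\<rbrakk>
        \<Longrightarrow> pull C h \<in> LinearCombinations.module_hom K (Ext C Z X) (Ext C Z' X)"
    and pull_linear_mor:
      "\<lbrakk>Z \<in> Ob C; Z' \<in> Ob C; X \<in> Ob C; \<delta> \<in> carrier (Ext C Z X)\<rbrakk>
        \<Longrightarrow> (\<lambda>h. pull C h \<delta>) \<in> LinearCombinations.module_hom K (Hom C Z' Z) (Ext C Z' X)"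
    and push_ident:
      "\<lbrakk>Z \<in> Ob C; X \<in> Ob C; \<delta> \<in> carrier (Ext C Z X)\<rbrakk> \<Longrightarrow> push C (ident C X) \<delta> = \<delta>"
    and push_cmp:
      "\<lbrakk>Z \<in> Ob C; X \<in> Ob C; X' \<in> Ob C; X'' \<in> Ob C; \<delta> \<in> carrier (Ext C Z X);
        f \<in> carrier (Hom C X X'); f' \<in> carrier (Hom C X' X'')\<rbrakk>
        \<Longrightarrow> push C (f' \<cdot> f) \<delta> = push C f' (push C f \<delta>)"
    and pull_ident:
      "\<lbrakk>Z \<in> Ob C; X \<in> Ob C; \<delta> \<in> carrier (Ext C Z X)\<rbrakk> \<Longrightarrow> pull C (ident C Z) \<delta> = \<delta>"
    and pull_cmp:
      "\<lbrakk>Z \<in> Ob C; Z' \<in> Ob C; Z'' \<in> Ob C; X \<in> Ob C; \<delta> \<in> carrier (Ext C Z X);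
        h \<in> carrier (Hom C Z' Z); h' \<in> carrier (Hom C Z'' Z')\<rbrakk>
        \<Longrightarrow> pull C (h \<cdot> h') \<delta> = pull C h' (pull C h \<delta>)"
    and push_pull:
      "\<lbrakk>Z \<in> Ob C; Z' \<in> Ob C; X \<in> Ob C; X' \<in> Ob C; \<delta> \<in> carrier (Ext C Z X);
        f \<in> carrier (Hom C X X'); h \<in> carrier (Hom C Z' Z)\<rbrakk>
        \<Longrightarrow> push C f (pull C h \<delta>) = pull C h (push C f \<delta>)"
    and realiz_class:
      "\<lbrakk>Z \<in> Ob C; X \<in> Ob C; \<delta> \<in> carrier (Ext C Z X)\<rbrakk>
        \<Longrightarrow> realiz C Z X \<delta> \<in> sequences C X Z // seq_equiv C X Z"
    and realiz_morphism:
      "\<lbrakk>realized_by C \<delta> X x Y y Z; realized_by C \<delta>' X' x' Y' y' Z';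
        f \<in> carrier (Hom C X X'); h \<in> carrier (Hom C Z Z'); push C f \<delta> = pull C h \<delta>'\<rbrakk>
        \<Longrightarrow> \<exists>g \<in> carrier (Hom C Y Y'). g \<cdot> x = x' \<cdot> f \<and> h \<cdot> y = y' \<cdot> g"
    and realiz_zero:
      "biproduct C X Z B i j p q \<Longrightarrow> realized_by C \<zero>\<^bsub>Ext C Z X\<^esub> X i B q Z"
    and realiz_sum:
      "\<lbrakk>realized_by C \<delta> X x Y y Z; realized_by C \<delta>' X' x' Y' y' Z';
        biproduct C X X' A i\<^sub>A j\<^sub>A p\<^sub>A q\<^sub>A; biproduct C Y Y' B i\<^sub>B j\<^sub>B p\<^sub>B q\<^sub>B;
        biproduct C Z Z' D i\<^sub>D j\<^sub>D p\<^sub>D q\<^sub>D\<rbrakk>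
        \<Longrightarrow> realized_by C
              (push C i\<^sub>A (pull C p\<^sub>D \<delta>) \<oplus>\<^bsub>Ext C D A\<^esub> push C j\<^sub>A (pull C q\<^sub>D \<delta>'))
              A (i\<^sub>B \<cdot> x \<cdot> p\<^sub>A \<oplus>\<^bsub>Hom C A B\<^esub> j\<^sub>B \<cdot> x' \<cdot> q\<^sub>A)
              B (i\<^sub>D \<cdot> y \<cdot> p\<^sub>B \<oplus>\<^bsub>Hom C B D\<^esub> j\<^sub>D \<cdot> y' \<cdot> q\<^sub>B) D"
    and ET3: "ET3 C"
    and ET3_op: "ET3 (opposite C)"
    and ET4: "ET4 C"
    and ET4_op: "ET4 (opposite C)"

definition ext_finite :: "'k ring \<Rightarrow> ('k, 'o, 'm, 'e) extricat \<Rightarrow> bool" where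
  "ext_finite K C \<longleftrightarrow> (\<forall>X \<in> Ob C. \<forall>Y \<in> Ob C. vectorspace.fin_dim K (Ext C X Y))"

definition quotient_space :: "('k, 'v) module \<Rightarrow> 'v set \<Rightarrow> ('k, 'v set) module" where
  "quotient_space V N = \<lparr>carrier = a_rcosets\<^bsub>V\<^esub> N, mult = undefined, one = undefined, ring.zero = N,
     add = (\<lambda>F G. F <+>\<^bsub>V\<^esub> G), smult = (\<lambda>r F. \<Union>f \<in> F. N +>\<^bsub>V\<^esub> (r \<odot>\<^bsub>V\<^esub> f))\<rparr>"

text \<open>
  The quotient by an ideal \<open>N\<close> of morphisms; its morphisms are the cosets \<open>N X Y +> f\<close>.
  By disjointness of the morphism sets, the union defining the composite runs over the
  representatives of the two cosets only, and all of them contribute the same coset.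
\<close>

definition quotient_category ::
    "('k, 'o, 'm, 'x) lincat_scheme \<Rightarrow> ('o \<Rightarrow> 'o \<Rightarrow> 'm set) \<Rightarrow> ('k, 'o, 'm set) lincat" where
  "quotient_category C N = \<lparr>Ob = Ob C, Hom = (\<lambda>X Y. quotient_space (Hom C X Y) (N X Y)),
     cmp = (\<lambda>G F. \<Union>{N X Z +>\<^bsub>Hom C X Z\<^esub> (g \<cdot>\<^bsub>C\<^esub> f) | X Y Z f g.
              X \<in> Ob C \<and> Y \<in> Ob C \<and> Z \<in> Ob C \<and>
              f \<in> F \<inter> carrier (Hom C X Y) \<and> g \<in> G \<inter> carrier (Hom C Y Z)}),
     ident = (\<lambda>X. N X X +>\<^bsub>Hom C X X\<^esub> ident C X)\<rparr>"

definition lower_ideal :: "('k, 'o, 'm, 'e) extricat \<Rightarrow> 'o \<Rightarrow> 'o \<Rightarrow> 'm set" where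
  "lower_ideal C X Y = {f \<in> carrier (Hom C X Y).
     \<forall>W \<in> Ob C. \<forall>\<delta> \<in> carrier (Ext C Y W). pull C f \<delta> = \<zero>\<^bsub>Ext C X W\<^esub>}"

definition upper_ideal :: "('k, 'o, 'm, 'e) extricat \<Rightarrow> 'o \<Rightarrow> 'o \<Rightarrow> 'm set" where
  "upper_ideal C X Y = {f \<in> carrier (Hom C X Y).
     \<forall>W \<in> Ob C. \<forall>\<delta> \<in> carrier (Ext C W X). push C f \<delta> = \<zero>\<^bsub>Ext C W Y\<^esub>}"

text \<open>The quotients written with \<open>C\<close> underlined and overlined, respectively.\<close>

definition lower_quotient :: "('k, 'o, 'm, 'e) extricat \<Rightarrow> ('k, 'o, 'm set) lincat" where
  "lower_quotient C = quotient_category C (lower_ideal C)"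

definition upper_quotient :: "('k, 'o, 'm, 'e) extricat \<Rightarrow> ('k, 'o, 'm set) lincat" where
  "upper_quotient C = quotient_category C (upper_ideal C)"

definition is_functor ::
    "('k, 'o, 'm, 'x) lincat_scheme \<Rightarrow> ('k, 'p, 'n, 'y) lincat_scheme \<Rightarrow> ('o \<Rightarrow> 'p) \<Rightarrow> ('m \<Rightarrow> 'n) \<Rightarrow> bool" where
  "is_functor A B Fo Fm \<longleftrightarrow>
     (\<forall>X \<in> Ob A. Fo X \<in> Ob B \<and> Fm (ident A X) = ident B (Fo X)) \<and>
     (\<forall>X \<in> Ob A. \<forall>Y \<in> Ob A. \<forall>f \<in> carrier (Hom A X Y). Fm f \<in> carrier (Hom B (Fo X) (Fo Y))) \<and>
     (\<forall>X \<in> Ob A. \<forall>Y \<in> Ob A. \<forall>Z \<in> Ob A. \<forall>f \<in> carrier (Hom A X Y). \<forall>g \<in> carrier (Hom A Y Z).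
        Fm (g \<cdot>\<^bsub>A\<^esub> f) = Fm g \<cdot>\<^bsub>B\<^esub> Fm f)"

definition naturally_isomorphic ::
    "('k, 'o, 'm, 'x) lincat_scheme \<Rightarrow> ('k, 'p, 'n, 'y) lincat_scheme \<Rightarrow>
      ('o \<Rightarrow> 'p) \<Rightarrow> ('m \<Rightarrow> 'n) \<Rightarrow> ('o \<Rightarrow> 'p) \<Rightarrow> ('m \<Rightarrow> 'n) \<Rightarrow> bool" where
  "naturally_isomorphic A B Fo Fm Go Gm \<longleftrightarrow>
     (\<exists>\<theta>. (\<forall>X \<in> Ob A. iso_mor B (Fo X) (Go X) (\<theta> X)) \<and>
          (\<forall>X \<in> Ob A. \<forall>Y \<in> Ob A. \<forall>f \<in> carrier (Hom A X Y). Gm f \<cdot>\<^bsub>B\<^esub> \<theta> X = \<theta> Y \<cdot>\<^bsub>B\<^esub> Fm f))"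

definition is_equivalence ::
    "('k, 'o, 'm, 'x) lincat_scheme \<Rightarrow> ('k, 'p, 'n, 'y) lincat_scheme \<Rightarrow> ('o \<Rightarrow> 'p) \<Rightarrow> ('m \<Rightarrow> 'n) \<Rightarrow> bool" where
  "is_equivalence A B Fo Fm \<longleftrightarrow> is_functor A B Fo Fm \<and>
     (\<exists>Go Gm. is_functor B A Go Gm \<and>
        naturally_isomorphic A A (Go \<circ> Fo) (Gm \<circ> Fm) id id \<and>
        naturally_isomorphic B B (Fo \<circ> Go) (Fm \<circ> Gm) id id)"

definition scalar_space :: "'k ring \<Rightarrow> ('k, 'k) module" where
  "scalar_space K = \<lparr>carrier = carrier K, mult = mult K, one = \<one>\<^bsub>K\<^esub>, ring.zero = \<zero>\<^bsub>K\<^esub>, add = add K,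
     smult = mult K\<rparr>"

definition dual_space :: "'k ring \<Rightarrow> ('k, 'v) module \<Rightarrow> ('k, 'v \<Rightarrow> 'k) module" where
  "dual_space K V = \<lparr>
     carrier = LinearCombinations.module_hom K V (scalar_space K) \<inter> extensional (carrier V),
     mult = undefined, one = undefined,
     ring.zero = (\<lambda>v \<in> carrier V. \<zero>\<^bsub>K\<^esub>),
     add = (\<lambda>\<phi> \<psi>. \<lambda>v \<in> carrier V. \<phi> v \<oplus>\<^bsub>K\<^esub> \<psi> v),
     smult = (\<lambda>r \<phi>. \<lambda>v \<in> carrier V. r \<otimes>\<^bsub>K\<^esub> \<phi> v)\<rparr>"

text \<open>
  \<open>\<eta> X Y\<close> is the isomorphism from the morphisms \<open>X \<rightarrow> Y\<close> of the lower quotient onto \<open>D E(Y, \<tau> X)\<close>.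
  Functoriality of \<open>E\<close> on the quotient categories is expressed through arbitrary representatives
  of the residue classes of morphisms; the last two conditions are naturality in \<open>Y\<close> and in \<open>X\<close>.
\<close>

definition ARS_duality :: "'k ring \<Rightarrow> ('k, 'o, 'm, 'e) extricat \<Rightarrow> bool" where
  "ARS_duality K C \<longleftrightarrow>
    (\<exists>\<tau>o \<tau>m \<eta>.
       is_equivalence (lower_quotient C) (upper_quotient C) \<tau>o \<tau>m \<and>
       (\<forall>X \<in> Ob C. \<forall>Y \<in> Ob C.
          \<eta> X Y \<in> LinearCombinations.module_hom K (Hom (lower_quotient C) X Y)
                     (dual_space K (Ext C Y (\<tau>o X))) \<and>
          bij_betw (\<eta> X Y) (carrier (Hom (lower_quotient C) X Y))
                     (carrier (dual_space K (Ext C Y (\<tau>o X))))) \<and>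
       (\<forall>X \<in> Ob C. \<forall>Y \<in> Ob C. \<forall>Y' \<in> Ob C. \<forall>u \<in> carrier (Hom (lower_quotient C) X Y).
          \<forall>G \<in> carrier (Hom (lower_quotient C) Y Y'). \<forall>g \<in> G. \<forall>\<delta> \<in> carrier (Ext C Y' (\<tau>o X)).
            \<eta> X Y' (G \<cdot>\<^bsub>lower_quotient C\<^esub> u) \<delta> = \<eta> X Y u (pull C g \<delta>)) \<and>
       (\<forall>X \<in> Ob C. \<forall>X' \<in> Ob C. \<forall>Y \<in> Ob C. \<forall>u \<in> carrier (Hom (lower_quotient C) X Y).
          \<forall>F \<in> carrier (Hom (lower_quotient C) X' X). \<forall>t \<in> \<tau>m F. \<forall>\<delta> \<in> carrier (Ext C Y (\<tau>o X')).
            \<eta> X' Y (u \<cdot>\<^bsub>lower_quotient C\<^esub> F) \<delta> = \<eta> X Y u (push C t \<delta>)))"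

definition K0_split :: "'o set \<Rightarrow> ('o \<Rightarrow>\<^sub>0 int) monoid" where
  "K0_split I = free_Abelian_group I"

text \<open>The class \<open>[X]\<close> of an object, well defined in the Krull--Schmidt case.\<close>

definition obj_class :: "('k, 'o, 'm, 'x) lincat_scheme \<Rightarrow> 'o set \<Rightarrow> 'o \<Rightarrow> ('o \<Rightarrow>\<^sub>0 int)" where
  "obj_class C I X =
     (THE c. \<exists>As. set As \<subseteq> I \<and> direct_sum C As X \<and> c = sum_list (map frag_of As))"

definition conflation_relations :: "('k, 'o, 'm, 'e) extricat \<Rightarrow> 'o set \<Rightarrow> ('o \<Rightarrow>\<^sub>0 int) set" where
  "conflation_relations C I = generate (K0_split I)
     {obj_class C I X - obj_class C I Y + obj_class C I Z | X Y Z. \<exists>x y. conflation C X x Y y Z}"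

definition K0 :: "('k, 'o, 'm, 'e) extricat \<Rightarrow> 'o set \<Rightarrow> ('o \<Rightarrow>\<^sub>0 int) set monoid" where
  "K0 C I = K0_split I Mod conflation_relations C I"

definition K0_proj :: "('k, 'o, 'm, 'e) extricat \<Rightarrow> 'o set \<Rightarrow> ('o \<Rightarrow>\<^sub>0 int) \<Rightarrow> ('o \<Rightarrow>\<^sub>0 int) set" where
  "K0_proj C I x = conflation_relations C I #>\<^bsub>K0_split I\<^esub> x"

text \<open>
  The \<open>K\<close>-space of \<open>End(T)\<close>-linear maps from \<open>F X\<close> to \<open>F Y\<close>, where \<open>F X = Hom(T, X)\<close> is a right
  \<open>End(T)\<close>-module under precomposition.  Such maps are automatically \<open>K\<close>-linear.
\<close>

definition F_hom_space :: "('k, 'o, 'm, 'x) lincat_scheme \<Rightarrow> 'o \<Rightarrow> 'o \<Rightarrow> 'o \<Rightarrow> ('k, 'm \<Rightarrow> 'm) module" where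
  "F_hom_space C T X Y = \<lparr>
     carrier = {\<phi> \<in> carrier (Hom C T X) \<rightarrow>\<^sub>E carrier (Hom C T Y).
        (\<forall>u \<in> carrier (Hom C T X). \<forall>v \<in> carrier (Hom C T X).
           \<phi> (u \<oplus>\<^bsub>Hom C T X\<^esub> v) = \<phi> u \<oplus>\<^bsub>Hom C T Y\<^esub> \<phi> v) \<and>
        (\<forall>u \<in> carrier (Hom C T X). \<forall>a \<in> carrier (End_ring C T). \<phi> (u \<cdot>\<^bsub>C\<^esub> a) = \<phi> u \<cdot>\<^bsub>C\<^esub> a)},
     mult = undefined, one = undefined,
     ring.zero = (\<lambda>u \<in> carrier (Hom C T X). \<zero>\<^bsub>Hom C T Y\<^esub>),
     add = (\<lambda>\<phi> \<psi>. \<lambda>u \<in> carrier (Hom C T X). \<phi> u \<oplus>\<^bsub>Hom C T Y\<^esub> \<psi> u),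
     smult = (\<lambda>r \<phi>. \<lambda>u \<in> carrier (Hom C T X). r \<odot>\<^bsub>Hom C T Y\<^esub> \<phi> u)\<rparr>"

definition K0_form ::
    "'k ring \<Rightarrow> ('k, 'o, 'm, 'x) lincat_scheme \<Rightarrow> 'o \<Rightarrow> ('o \<Rightarrow>\<^sub>0 int) \<Rightarrow> ('o \<Rightarrow>\<^sub>0 int) \<Rightarrow> int" where
  "K0_form K C T x y = (\<Sum>A \<in> Poly_Mapping.keys x. \<Sum>B \<in> Poly_Mapping.keys y.
     Poly_Mapping.lookup x A * Poly_Mapping.lookup y B * int (vectorspace.dim K (F_hom_space C T A B)))"

definition almost_split :: "('k, 'o, 'm, 'e) extricat \<Rightarrow> 'o \<Rightarrow> 'o \<Rightarrow> 'e \<Rightarrow> bool" where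
  "almost_split C Z X \<delta> \<longleftrightarrow> \<delta> \<in> carrier (Ext C Z X) \<and> \<delta> \<noteq> \<zero>\<^bsub>Ext C Z X\<^esub> \<and>
     (\<forall>X' \<in> Ob C. \<forall>f \<in> carrier (Hom C X X').
        \<not> section_mor C X X' f \<longrightarrow> push C f \<delta> = \<zero>\<^bsub>Ext C Z X'\<^esub>) \<and>
     (\<forall>Z' \<in> Ob C. \<forall>g \<in> carrier (Hom C Z' Z).
        \<not> retraction_mor C Z' Z g \<longrightarrow> pull C g \<delta> = \<zero>\<^bsub>Ext C Z' X\<^esub>)"

text \<open>
  \<open>\<ell>\<^sub>X = [X] + [Y] - [E]\<close> for an almost split conflation from \<open>X\<close> through \<open>E\<close> to \<open>Y\<close>;
  such a conflation exists and is unique up to isomorphism for the objects \<open>X\<close> of interest.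
\<close>

definition ell :: "('k, 'o, 'm, 'e) extricat \<Rightarrow> 'o set \<Rightarrow> 'o \<Rightarrow> ('o \<Rightarrow>\<^sub>0 int)" where
  "ell C I X = (THE c. \<exists>\<delta> x E y Y. almost_split C Y X \<delta> \<and> realized_by C \<delta> X x E y Y \<and>
     c = obj_class C I X + obj_class C I Y - obj_class C I E)"

end

theory Submission
  imports Defs
begin

text \<open>
  Let \<open>A \<rightarrow> M \<rightarrow> Y\<close> realize an almost split extension.  Since \<open>F\<close> is full, a morphism \<open>FA \<rightarrow> FB\<close> factors
  through \<open>FM\<close> unless it comes from an isomorphism, so \<open>\<langle>\<ell>\<^sub>A, B\<rangle>\<close> vanishes for \<open>B \<noteq> A\<close> and is positive
  for \<open>B = A\<close>; this gives independence and the coefficients of the expansion.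

  If there are finitely many indecomposables, let \<open>Q\<close> be their sum.  For a nonzero \<open>\<delta> \<in> E(Y, X)\<close> choose
  \<open>f: X \<rightarrow> A\<close> with \<open>A\<close> indecomposable such that \<open>f\<^sub>* \<delta>\<close> is nonzero and is killed by all nonsections.
  The relations of \<open>\<delta>\<close> and of its restriction along the deflation of \<open>f\<^sub>* \<delta>\<close> differ by \<open>\<ell>\<^sub>A\<close>, and the
  restriction has a smaller orbit under the morphisms \<open>X \<rightarrow> Q\<close>, so induction applies.

  Conversely, the relation \<open>[T] + [\<Sigma>T]\<close> pairs nontrivially with every indecomposable outside
  \<open>add(\<Sigma>T)\<close>, while a combination of the \<open>\<ell>\<^sub>A\<close> pairs nontrivially with only finitely many.
\<close>

section \<open>Linear algebra\<close>

text \<open>The functor F is full but not faithful: it kills exactly \<open>add(\<Sigma>T)\<close>,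
  and these objects are also exactly the injectives. So the exclusion of
  \<open>add(\<Sigma>T)\<close> serves twice: outside it an object has a nonzero extension, so that
  an almost split one exists, and its identity is seen by F, so that the form is positive. Both
  facts come from a copresentation of X by objects of \<open>add(\<Sigma>T)\<close>, obtained by
  (ET4) from a presentation by \<open>add(T)\<close> and the inflation
  \<open>T \<rightarrow> 0\<close>. Morphism spaces are not assumed finite-dimensional; the same
  inflation embeds Hom(T, X) in E(\<Sigma>T, X), and this makes the form finite. Length arguments in
  E(Y, -) are replaced by a dimension: an extension is measured by its images under all morphisms to
  a fixed object Q, which is informative once Q sees every nonzero extension. For restrictions of
  extensions of one fixed A, duality supplies such a test object, and this yields almost split
  extensions. Restrictions and pushforwards are exchanged by passing to the opposite
  category.\<close>

lemma linear_mapI: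
  "vectorspace K V \<Longrightarrow> vectorspace K W \<Longrightarrow> f \<in> LinearCombinations.module_hom K V W \<Longrightarrow> linear_map K V W f"
  unfolding linear_map_def mod_hom_def mod_hom_axioms_def vectorspace_def by blast

lemma (in linear_map) inj_image_lin_indpt:
  assumes inj: "inj_on T (carrier V)" and A: "A \<subseteq> carrier V" and li: "V.module.lin_indpt A"
  shows "W.module.lin_indpt (T ` A)"
proof
  assume "W.module.lin_dep (T ` A)"
  then obtain B a v where B: "finite B" "B \<subseteq> T ` A" "a \<in> B \<rightarrow> carrier K"
      "W.module.lincomb a B = \<zero>\<^bsub>W\<^esub>" "v \<in> B" "a v \<noteq> \<zero>\<^bsub>K\<^esub>"
    unfolding W.module.lin_dep_def by blast
  obtain A' where A': "A' \<subseteq> A" "finite A'" "B = T ` A'"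
    using finite_subset_image[OF B(1,2)] by blast
  have A'V: "A' \<subseteq> carrier V" using A' A by blast
  have aT: "a \<circ> T \<in> A' \<rightarrow> carrier K" using B(3) A'(3) by auto
  have "T (V.module.lincomb (a \<circ> T) A') = T \<zero>\<^bsub>V\<^esub>"
    using lincomb_linear_image[OF inj A'V _ A'(2)] B(3,4) A'(3) by simp
  then have lc: "V.module.lincomb (a \<circ> T) A' = \<zero>\<^bsub>V\<^esub>"
    using inj_onD[OF inj] V.module.lincomb_closed[OF A'V aT] by blast
  obtain w where "w \<in> A'" "v = T w" using B(5) A'(3) by blast
  then have "V.module.lin_dep A"
    using V.module.lin_dep_crit[OF A'(2,1) aT _ _ lc, of w] B(6) by simp
  then show False using li by simp
qed

text \<open>Finite dimension means having a finite generating set, a property that does not simply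
  restrict to subspaces. Independent subsets of V are bounded in size by their images in W, and a
  maximal one generates V.\<close>

lemma (in linear_map) inj_fin_dim:
  assumes inj: "inj_on T (carrier V)" and fd: "W.fin_dim"
  shows "V.fin_dim"
proof -
  have *: "finite A \<and> card A \<le> W.dim" if A: "A \<subseteq> carrier V \<and> V.module.lin_indpt A" for A
  proof -
    have "W.module.lin_indpt (T ` A)" using inj_image_lin_indpt[OF inj] A by blast
    moreover have "T ` A \<subseteq> carrier W" using A by auto
    ultimately have "finite (T ` A)" "card (T ` A) \<le> W.dim"
      using W.li_le_dim[OF fd] by blast+
    moreover have "inj_on T A" using inj A inj_on_subset by blast
    ultimately show ?thesis by (simp add: card_image finite_image_iff)
  qed
  have "{} \<subseteq> carrier V \<and> V.module.lin_indpt {}"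
    by (simp add: V.module.lin_dep_def)
  from maximal_exists[of "\<lambda>A. A \<subseteq> carrier V \<and> V.module.lin_indpt A", OF * this]
  obtain A where "finite A" and m: "maximal A (\<lambda>A. A \<subseteq> carrier V \<and> V.module.lin_indpt A)" by blast
  moreover have "A \<subseteq> carrier V" using m unfolding maximal_def by blast
  ultimately show ?thesis
    using V.max_li_is_gen[OF m] unfolding V.fin_dim_def by blast
qed

lemma (in linear_map) inj_dim_im:
  assumes inj: "inj_on T (carrier V)" and fd: "V.fin_dim"
  shows "vectorspace.dim K (W.vs imT) = V.dim"
  using rank_nullity[OF fd] inj_imp_dim_ker0[OF inj] by simp

context vectorspace
begin

lemma subspace_inclusion: "VectorSpace.subspace K N V \<Longrightarrow> linear_map K (vs N) V (\<lambda>x. x)"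
  using submodule.subset[OF is_module]
  by (intro linear_mapI subspace_is_vs vectorspace_axioms) (auto simp: module_hom_def)

lemma subspaceI:
  assumes "N \<subseteq> carrier V" "\<zero>\<^bsub>V\<^esub> \<in> N" "\<And>v w. v \<in> N \<Longrightarrow> w \<in> N \<Longrightarrow> v \<oplus>\<^bsub>V\<^esub> w \<in> N"
    "\<And>c v. c \<in> carrier K \<Longrightarrow> v \<in> N \<Longrightarrow> c \<odot>\<^bsub>V\<^esub> v \<in> N"
  shows "VectorSpace.subspace K N V"
  unfolding subspace_def submodule_def using assms vectorspace_axioms module_axioms by blast

lemma subspace_fin_dim:
  assumes "fin_dim" "VectorSpace.subspace K N V"
  shows "vectorspace.fin_dim K (vs N)"
  using linear_map.inj_fin_dim[OF subspace_inclusion[OF assms(2)] _ assms(1)] by simp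

text \<open>A basis of N stays independent in V, and if it has as many elements as
  \<open>dim\<close>, it is a basis of V.\<close>

lemma subspace_dim:
  assumes fd: "fin_dim" and N: "VectorSpace.subspace K N V"
  shows "vectorspace.dim K (vs N) \<le> dim" "N \<noteq> carrier V \<Longrightarrow> vectorspace.dim K (vs N) < dim"
proof -
  interpret N: vectorspace K "vs N" by (rule subspace_is_vs[OF N])
  obtain B where B: "finite B" "N.basis B"
    using N.finite_basis_exists[OF subspace_fin_dim[OF fd N]] by blast
  have BN: "B \<subseteq> N" using B(2) by (simp add: N.basis_def)
  have NV: "N \<subseteq> carrier V" using submodule.subset[OF is_module[OF N]] .
  have li: "lin_indpt B" and sp: "span B = N"
    using B(2) span_li_not_depend[OF BN is_module[OF N]] by (simp_all add: N.basis_def)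
  have d: "vectorspace.dim K (vs N) = card B" using N.dim_basis[OF B] .
  show "vectorspace.dim K (vs N) \<le> dim" using li_le_dim(2)[OF fd _ li] BN NV d by auto
  show "vectorspace.dim K (vs N) < dim" if ne: "N \<noteq> carrier V"
  proof (rule ccontr)
    assume "\<not> ?thesis"
    then have "basis B" using dim_li_is_basis[OF fd B(1) _ li] BN NV d by auto
    then show False using sp ne by (simp add: basis_def)
  qed
qed

end

text \<open>The functional is a coordinate with respect to a finite basis, chosen to be nonzero at
  \<open>v\<close>.\<close>

lemma functional_nonzero:
  fixes K :: "'k ring"
  assumes V: "vectorspace K V" and fd: "vectorspace.fin_dim K V" and v: "v \<in> carrier V" "v \<noteq> \<zero>\<^bsub>V\<^esub>"
  shows "\<exists>\<psi> \<in> LinearCombinations.module_hom K V (scalar_space K). \<psi> v \<noteq> \<zero>\<^bsub>K\<^esub>"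
proof -
  interpret vectorspace K V by (rule V)
  obtain B where B: "finite B" "basis B" using finite_basis_exists[OF fd] by blast
  have BV: "B \<subseteq> carrier V" using B(2) by (simp add: basis_def)
  have ex: "\<exists>!a. a \<in> B \<rightarrow>\<^sub>E carrier K \<and> lincomb a B = w" if "w \<in> carrier V" for w
    using basis_criterion[OF B(1) BV] B(2) that by blast
  define co where "co w = (THE a. a \<in> B \<rightarrow>\<^sub>E carrier K \<and> lincomb a B = w)" for w
  have co: "co w \<in> B \<rightarrow>\<^sub>E carrier K" "lincomb (co w) B = w" if "w \<in> carrier V" for w
    using theI'[OF ex[OF that]] unfolding co_def by blast+
  have eq: "co w b = a b"
    if "a \<in> B \<rightarrow> carrier K" "lincomb a B = w" "b \<in> B" for w a b
  proof -
    have r: "restrict a B \<in> B \<rightarrow>\<^sub>E carrier K" using that(1) by auto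
    have "lincomb (restrict a B) B = lincomb a B"
      by (rule lincomb_cong) (use that(1) BV in auto)
    moreover have "w \<in> carrier V" using that(2) lincomb_closed[OF BV that(1)] by simp
    ultimately have "restrict a B = co w"
      unfolding co_def using the1_equality[OF ex, of w "restrict a B"] r that(2) by simp
    then show ?thesis using that(3) by (metis restrict_apply')
  qed
  have "\<exists>b \<in> B. co v b \<noteq> \<zero>\<^bsub>K\<^esub>"
  proof (rule ccontr)
    assume "\<not> ?thesis"
    then have "lincomb (co v) B = lincomb (\<lambda>_. \<zero>\<^bsub>K\<^esub>) B"
      using BV by (intro lincomb_cong) auto
    moreover have "lincomb (\<lambda>_. \<zero>\<^bsub>K\<^esub>) B = \<zero>\<^bsub>V\<^esub>" by (rule lincomb_zero) (use BV B in auto)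
    ultimately show False using co(2)[OF v(1)] v(2) by simp
  qed
  then obtain b where b: "b \<in> B" "co v b \<noteq> \<zero>\<^bsub>K\<^esub>" by blast
  have coP: "co w \<in> B \<rightarrow> carrier K" if "w \<in> carrier V" for w using co(1)[OF that] by auto
  have "(\<lambda>w. co w b) \<in> LinearCombinations.module_hom K V (scalar_space K)"
    unfolding module_hom_def scalar_space_def
  proof (simp, intro conjI allI impI funcsetI)
    show "co w b \<in> carrier K" if "w \<in> carrier V" for w using coP[OF that] b(1) by auto
    show "co (m1 \<oplus>\<^bsub>V\<^esub> m2) b = co m1 b \<oplus>\<^bsub>K\<^esub> co m2 b" if m: "m1 \<in> carrier V \<and> m2 \<in> carrier V" for m1 m2
    proof (rule eq[OF _ _ b(1)])
      show "(\<lambda>b. co m1 b \<oplus>\<^bsub>K\<^esub> co m2 b) \<in> B \<rightarrow> carrier K" using coP m by fast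
      show "lincomb (\<lambda>b. co m1 b \<oplus>\<^bsub>K\<^esub> co m2 b) B = m1 \<oplus>\<^bsub>V\<^esub> m2"
        using lincomb_sum[OF B(1) BV] coP co(2) m by auto
    qed
    show "co (r \<odot>\<^bsub>V\<^esub> m) b = r \<otimes>\<^bsub>K\<^esub> co m b" if m: "r \<in> carrier K \<and> m \<in> carrier V" for r m
    proof (rule eq[OF _ _ b(1)])
      show "(\<lambda>b. r \<otimes>\<^bsub>K\<^esub> co m b) \<in> B \<rightarrow> carrier K" using coP m by fast
      show "lincomb (\<lambda>b. r \<otimes>\<^bsub>K\<^esub> co m b) B = r \<odot>\<^bsub>V\<^esub> m"
        using lincomb_smult[OF BV] coP co(2) m by auto
    qed
  qed
  then show ?thesis using b(2) by (intro bexI[of _ "\<lambda>w. co w b"])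
qed

lemma (in linear_map) subset_vimage_span:
  assumes S: "S \<subseteq> carrier W" and A: "A \<subseteq> carrier V" "T ` A \<subseteq> W.module.span S"
  shows "T ` V.module.span A \<subseteq> W.module.span S"
proof -
  have sub: "VectorSpace.subspace K (W.module.span S) W" by (rule W.span_is_subspace[OF S])
  have "VectorSpace.subspace K {v \<in> carrier V. T v \<in> W.module.span S} V"
    using submodule.m_closed[OF W.is_module[OF sub]] submodule.smult_closed[OF W.is_module[OF sub]]
      submodule.zero_closed[OF W.is_module[OF sub]]
    by (intro V.subspaceI) auto
  then have "V.module.span A \<subseteq> {v \<in> carrier V. T v \<in> W.module.span S}"
    using A by (intro V.module.span_is_subset V.is_module) auto
  then show ?thesis by blast
qed

text \<open>The images of two finite generating sets generate V. Finiteness is separated from the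
  count in \<open>biproduct_dim\<close>, since rank and nullity presuppose it.\<close>

lemma generated_by_two_fin_dim:
  assumes V: "vectorspace K V" "vectorspace K V1" "vectorspace K V2"
    and b: "b \<in> LinearCombinations.module_hom K V1 V" "d \<in> LinearCombinations.module_hom K V2 V"
    and e: "\<And>v. v \<in> carrier V \<Longrightarrow> \<exists>x \<in> carrier V1. \<exists>y \<in> carrier V2. v = b x \<oplus>\<^bsub>V\<^esub> d y"
    and fd: "vectorspace.fin_dim K V1" "vectorspace.fin_dim K V2"
  shows "vectorspace.fin_dim K V"
proof -
  interpret b: linear_map K V1 V b by (rule linear_mapI[OF V(2,1) b(1)])
  interpret d: linear_map K V2 V d by (rule linear_mapI[OF V(3,1) b(2)])
  obtain A1 where A1: "finite A1" "A1 \<subseteq> carrier V1" "b.V.module.gen_set A1"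
    using fd(1) unfolding b.V.fin_dim_def by blast
  obtain A2 where A2: "finite A2" "A2 \<subseteq> carrier V2" "d.V.module.gen_set A2"
    using fd(2) unfolding d.V.fin_dim_def by blast
  define S where "S = b ` A1 \<union> d ` A2"
  have S: "finite S" "S \<subseteq> carrier V" using A1 A2 by (auto simp: S_def)
  have sub: "VectorSpace.subspace K (b.W.module.span S) V" by (rule b.W.span_is_subspace[OF S(2)])
  have own: "S \<subseteq> b.W.module.span S" by (rule b.W.module.in_own_span[OF S(2)])
  have "b ` carrier V1 \<subseteq> b.W.module.span S" "d ` carrier V2 \<subseteq> b.W.module.span S"
    using b.subset_vimage_span[OF S(2) A1(2)] d.subset_vimage_span[OF S(2) A2(2)] own A1(3) A2(3)
    by (auto simp: S_def)
  then have "b x \<oplus>\<^bsub>V\<^esub> d y \<in> b.W.module.span S" if "x \<in> carrier V1" "y \<in> carrier V2" for x y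
    using that by (intro submodule.m_closed[OF b.W.is_module[OF sub]]) auto
  then have "carrier V \<subseteq> b.W.module.span S" using e by blast
  then have "b.W.module.gen_set S" using b.W.module.span_is_subset2[OF S(2)] by blast
  then show ?thesis unfolding b.W.fin_dim_def using S by blast
qed

text \<open>The hypotheses say that \<open>V\<close> is the direct sum of \<open>V1\<close> and \<open>V2\<close>; only those
  identities are listed that the argument by rank and nullity needs.\<close>

lemma biproduct_dim:
  assumes V: "vectorspace K V" "vectorspace K V1" "vectorspace K V2"
    and a: "a \<in> LinearCombinations.module_hom K V V1" "c \<in> LinearCombinations.module_hom K V V2"
    and b: "b \<in> LinearCombinations.module_hom K V1 V" "d \<in> LinearCombinations.module_hom K V2 V"
    and e: "\<And>v. v \<in> carrier V1 \<Longrightarrow> a (b v) = v" "\<And>v. v \<in> carrier V2 \<Longrightarrow> c (d v) = v"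
      "\<And>v. v \<in> carrier V2 \<Longrightarrow> a (d v) = \<zero>\<^bsub>V1\<^esub>"
      "\<And>v. v \<in> carrier V \<Longrightarrow> b (a v) \<oplus>\<^bsub>V\<^esub> d (c v) = v"
    and fd: "vectorspace.fin_dim K V"
  shows "vectorspace.dim K V = vectorspace.dim K V1 + vectorspace.dim K V2"
proof -
  interpret a: linear_map K V V1 a by (rule linear_mapI[OF V(1,2) a(1)])
  interpret b: linear_map K V1 V b by (rule linear_mapI[OF V(2,1) b(1)])
  interpret d: linear_map K V2 V d by (rule linear_mapI[OF V(3,1) b(2)])
  interpret c: linear_map K V V2 c by (rule linear_mapI[OF V(1,3) a(2)])
  have im: "a.imT = carrier V1"
  proof
    show "a.imT \<subseteq> carrier V1" by (auto simp: a.im_def)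
    show "carrier V1 \<subseteq> a.imT"
    proof
      fix v assume "v \<in> carrier V1"
      then have "v = a (b v)" "b v \<in> carrier V" by (simp_all add: e(1))
      then show "v \<in> a.imT" unfolding a.im_def by blast
    qed
  qed
  have ker: "a.kerT = d.imT"
  proof
    show "d.imT \<subseteq> a.kerT" using e(3) by (auto simp: a.ker_def d.im_def)
    show "a.kerT \<subseteq> d.imT"
    proof
      fix v assume v: "v \<in> a.kerT"
      then have "v \<in> carrier V" "a v = \<zero>\<^bsub>V1\<^esub>" by (auto simp: a.ker_def)
      then have "v = d (c v)" using e(4)[of v] by simp
      then show "v \<in> d.imT" using \<open>v \<in> carrier V\<close> unfolding d.im_def by auto
    qed
  qed
  have inj: "inj_on d (carrier V2)" using e(2) by (metis inj_onI)
  have "vectorspace.fin_dim K V2"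
    using d.inj_fin_dim[OF inj] fd by simp
  then have "vectorspace.dim K (V\<lparr>carrier := d.imT\<rparr>) = vectorspace.dim K V2"
    using d.inj_dim_im[OF inj] by simp
  moreover have "V1\<lparr>carrier := a.imT\<rparr> = V1" using im by simp
  ultimately show ?thesis using a.rank_nullity[OF fd] ker by simp
qed

section \<open>Linear categories and direct sums\<close>

text \<open>Composition carries no objects and morphism sets are pairwise disjoint, so source and target
  are functions of the morphism; rewriting with them decides all typing side conditions.\<close>

definition arr :: "('k, 'o, 'm, 'x) lincat_scheme \<Rightarrow> 'm \<Rightarrow> 'o \<Rightarrow> 'o \<Rightarrow> bool" where
  "arr C f X Y \<longleftrightarrow> X \<in> Ob C \<and> Y \<in> Ob C \<and> f \<in> carrier (Hom C X Y)"

context linear_category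
begin

definition ar :: "'m \<Rightarrow> bool" where "ar f \<longleftrightarrow> (\<exists>X Y. arr C f X Y)"
definition dm :: "'m \<Rightarrow> 'o" where "dm f = (THE X. \<exists>Y. arr C f X Y)"
definition cd :: "'m \<Rightarrow> 'o" where "cd f = (THE Y. \<exists>X. arr C f X Y)"

lemma arr_unique: "arr C f X Y \<Longrightarrow> arr C f X' Y' \<Longrightarrow> X = X' \<and> Y = Y'"
  unfolding arr_def using Hom_disjoint by blast

lemma dm_eq: "arr C f X Y \<Longrightarrow> dm f = X" and cd_eq: "arr C f X Y \<Longrightarrow> cd f = Y"
  unfolding dm_def cd_def by (rule the_equality; use arr_unique in blast)+

lemma arr_dm_cd: "ar f \<Longrightarrow> arr C f (dm f) (cd f)"
  unfolding ar_def using dm_eq cd_eq by blast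

lemma dm_Ob [simp]: "ar f \<Longrightarrow> dm f \<in> Ob C" and cd_Ob [simp]: "ar f \<Longrightarrow> cd f \<in> Ob C"
  using arr_dm_cd unfolding arr_def by blast+

lemma arr_iff [simp]: "arr C f X Y \<longleftrightarrow> ar f \<and> dm f = X \<and> cd f = Y \<and> X \<in> Ob C \<and> Y \<in> Ob C"
  using arr_dm_cd dm_eq cd_eq unfolding ar_def arr_def by blast

lemma mem_Hom_iff [simp]:
  "X \<in> Ob C \<Longrightarrow> Y \<in> Ob C \<Longrightarrow> f \<in> carrier (Hom C X Y) \<longleftrightarrow> ar f \<and> dm f = X \<and> cd f = Y"
  using arr_iff unfolding arr_def by blast

lemma Hom_abelian_group: "X \<in> Ob C \<Longrightarrow> Y \<in> Ob C \<Longrightarrow> abelian_group (Hom C X Y)"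
  using Hom_vectorspace unfolding vectorspace_def module_def by blast

lemma arr_cmp: "arr C f X Y \<Longrightarrow> arr C g Y Z \<Longrightarrow> arr C (g \<cdot> f) X Z"
  using cmp_linear_left[of X Y Z f] unfolding arr_def module_hom_def by blast

lemma ar_cmp [simp]:
  assumes "ar f" "ar g" "cd f = dm g"
  shows "ar (g \<cdot> f)" "dm (g \<cdot> f) = dm f" "cd (g \<cdot> f) = cd g"
  using arr_cmp[of f "dm f" "cd f" g "cd g"] assms by auto

lemma ar_ident [simp]:
  assumes "X \<in> Ob C"
  shows "ar (ident C X)" "dm (ident C X) = X" "cd (ident C X) = X"
  using ident_closed[OF assms] assms by auto

lemma ar_zero [simp]:
  assumes "X \<in> Ob C" "Y \<in> Ob C"
  shows "ar \<zero>\<^bsub>Hom C X Y\<^esub>" "dm \<zero>\<^bsub>Hom C X Y\<^esub> = X" "cd \<zero>\<^bsub>Hom C X Y\<^esub> = Y"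
  using abelian_monoid.zero_closed[OF abelian_group.axioms(1)[OF Hom_abelian_group[OF assms]]] assms
  by auto

lemma ar_add [simp]:
  assumes "ar f" "ar g" "dm f = X" "cd f = Y" "dm g = X" "cd g = Y"
  shows "ar (f \<oplus>\<^bsub>Hom C X Y\<^esub> g)" "dm (f \<oplus>\<^bsub>Hom C X Y\<^esub> g) = X" "cd (f \<oplus>\<^bsub>Hom C X Y\<^esub> g) = Y"
proof -
  have o: "X \<in> Ob C" "Y \<in> Ob C" using assms by auto
  show "ar (f \<oplus>\<^bsub>Hom C X Y\<^esub> g)" "dm (f \<oplus>\<^bsub>Hom C X Y\<^esub> g) = X" "cd (f \<oplus>\<^bsub>Hom C X Y\<^esub> g) = Y"
    using abelian_monoid.a_closed[OF abelian_group.axioms(1)[OF Hom_abelian_group[OF o]], of f g] assms o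
    by auto
qed

lemma ar_minus [simp]:
  assumes "ar f" "dm f = X" "cd f = Y"
  shows "ar (\<ominus>\<^bsub>Hom C X Y\<^esub> f)" "dm (\<ominus>\<^bsub>Hom C X Y\<^esub> f) = X" "cd (\<ominus>\<^bsub>Hom C X Y\<^esub> f) = Y"
proof -
  have o: "X \<in> Ob C" "Y \<in> Ob C" using assms by auto
  show "ar (\<ominus>\<^bsub>Hom C X Y\<^esub> f)" "dm (\<ominus>\<^bsub>Hom C X Y\<^esub> f) = X" "cd (\<ominus>\<^bsub>Hom C X Y\<^esub> f) = Y"
    using abelian_group.a_inv_closed[OF Hom_abelian_group[OF o], of f] assms o by auto
qed

lemma ar_smult [simp]:
  assumes "ar f" "dm f = X" "cd f = Y" "c \<in> carrier K"
  shows "ar (c \<odot>\<^bsub>Hom C X Y\<^esub> f)" "dm (c \<odot>\<^bsub>Hom C X Y\<^esub> f) = X" "cd (c \<odot>\<^bsub>Hom C X Y\<^esub> f) = Y"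
proof -
  have o: "X \<in> Ob C" "Y \<in> Ob C" using assms by auto
  interpret vectorspace K "Hom C X Y" using Hom_vectorspace o .
  show "ar (c \<odot>\<^bsub>Hom C X Y\<^esub> f)" "dm (c \<odot>\<^bsub>Hom C X Y\<^esub> f) = X" "cd (c \<odot>\<^bsub>Hom C X Y\<^esub> f) = Y"
    using smult_closed[of c f] assms o by auto
qed

lemma assoc [simp]: "ar f \<Longrightarrow> ar g \<Longrightarrow> ar h \<Longrightarrow> cd f = dm g \<Longrightarrow> cd g = dm h \<Longrightarrow> (h \<cdot> g) \<cdot> f = h \<cdot> (g \<cdot> f)"
  by (rule cmp_assoc[of "dm f" "dm g" "dm h" "cd h"]) auto

lemma cmp_ident_left [simp]: "ar f \<Longrightarrow> cd f = Y \<Longrightarrow> ident C Y \<cdot> f = f"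
  by (rule ident_left[of "dm f"]) auto

lemma cmp_ident_right [simp]: "ar f \<Longrightarrow> dm f = X \<Longrightarrow> f \<cdot> ident C X = f"
  by (rule ident_right[of _ "cd f"]) auto

lemma Hom_abelian_monoid: "X \<in> Ob C \<Longrightarrow> Y \<in> Ob C \<Longrightarrow> abelian_monoid (Hom C X Y)"
  using Hom_abelian_group abelian_group.axioms(1) by blast

lemma add_zero [simp]:
  assumes "ar f" "dm f = X" "cd f = Y"
  shows "f \<oplus>\<^bsub>Hom C X Y\<^esub> \<zero>\<^bsub>Hom C X Y\<^esub> = f" "\<zero>\<^bsub>Hom C X Y\<^esub> \<oplus>\<^bsub>Hom C X Y\<^esub> f = f"
proof -
  have o: "X \<in> Ob C" "Y \<in> Ob C" using assms by auto
  interpret abelian_group "Hom C X Y" using Hom_abelian_group o .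
  show "f \<oplus>\<^bsub>Hom C X Y\<^esub> \<zero>\<^bsub>Hom C X Y\<^esub> = f" "\<zero>\<^bsub>Hom C X Y\<^esub> \<oplus>\<^bsub>Hom C X Y\<^esub> f = f"
    using r_zero[of f] l_zero[of f] assms o by auto
qed

lemma add_neg [simp]:
  assumes "ar f" "dm f = X" "cd f = Y"
  shows "f \<oplus>\<^bsub>Hom C X Y\<^esub> (\<ominus>\<^bsub>Hom C X Y\<^esub> f) = \<zero>\<^bsub>Hom C X Y\<^esub>"
proof -
  have o: "X \<in> Ob C" "Y \<in> Ob C" using assms by auto
  interpret abelian_group "Hom C X Y" using Hom_abelian_group o .
  show ?thesis using r_neg[of f] assms o by auto
qed

lemma add_comm:
  assumes "ar f" "dm f = X" "cd f = Y" "ar g" "dm g = X" "cd g = Y"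
  shows "f \<oplus>\<^bsub>Hom C X Y\<^esub> g = g \<oplus>\<^bsub>Hom C X Y\<^esub> f"
proof -
  have o: "X \<in> Ob C" "Y \<in> Ob C" using assms by auto
  interpret abelian_group "Hom C X Y" using Hom_abelian_group o .
  show ?thesis using a_comm[of f g] assms o by auto
qed

lemma add_assoc:
  assumes "ar f" "dm f = X" "cd f = Y" "ar g" "dm g = X" "cd g = Y" "ar h" "dm h = X" "cd h = Y"
  shows "(f \<oplus>\<^bsub>Hom C X Y\<^esub> g) \<oplus>\<^bsub>Hom C X Y\<^esub> h = f \<oplus>\<^bsub>Hom C X Y\<^esub> (g \<oplus>\<^bsub>Hom C X Y\<^esub> h)"
proof -
  have o: "X \<in> Ob C" "Y \<in> Ob C" using assms by auto
  interpret abelian_group "Hom C X Y" using Hom_abelian_group o .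
  show ?thesis using a_assoc[of f g h] assms o by auto
qed

lemma diff_add:
  assumes "ar f" "dm f = X" "cd f = Y" "ar g" "dm g = X" "cd g = Y"
  shows "g \<oplus>\<^bsub>Hom C X Y\<^esub> (f \<oplus>\<^bsub>Hom C X Y\<^esub> (\<ominus>\<^bsub>Hom C X Y\<^esub> g)) = f"
proof -
  have o: "X \<in> Ob C" "Y \<in> Ob C" using assms by auto
  interpret abelian_group "Hom C X Y" using Hom_abelian_group o .
  show ?thesis using assms o a_lcomm[of g f "\<ominus>\<^bsub>Hom C X Y\<^esub> g"] r_neg[of g] by auto
qed

lemma diff_zero_eq:
  assumes "ar f" "dm f = X" "cd f = Y" "ar g" "dm g = X" "cd g = Y"
    "f \<oplus>\<^bsub>Hom C X Y\<^esub> (\<ominus>\<^bsub>Hom C X Y\<^esub> g) = \<zero>\<^bsub>Hom C X Y\<^esub>"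
  shows "f = g"
  using diff_add[OF assms(1-6)] assms by simp

lemma cmp_left_map:
  "ar f \<Longrightarrow> Z \<in> Ob C \<Longrightarrow> (\<lambda>g. g \<cdot> f) \<in> LinearCombinations.module_hom K (Hom C (cd f) Z) (Hom C (dm f) Z)"
  by (rule cmp_linear_left) auto

lemma cmp_right_map:
  "ar g \<Longrightarrow> X \<in> Ob C \<Longrightarrow> (\<lambda>f. g \<cdot> f) \<in> LinearCombinations.module_hom K (Hom C X (dm g)) (Hom C X (cd g))"
  by (rule cmp_linear_right) auto

lemma linear_cmp_left:
  "ar f \<Longrightarrow> Z \<in> Ob C \<Longrightarrow> linear_map K (Hom C (cd f) Z) (Hom C (dm f) Z) (\<lambda>g. g \<cdot> f)"
  by (intro linear_mapI Hom_vectorspace cmp_left_map) auto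

lemma linear_cmp_right:
  "ar g \<Longrightarrow> X \<in> Ob C \<Longrightarrow> linear_map K (Hom C X (dm g)) (Hom C X (cd g)) (\<lambda>f. g \<cdot> f)"
  by (intro linear_mapI Hom_vectorspace cmp_right_map) auto

lemma cmp_add_right [simp]:
  "ar h \<Longrightarrow> ar f \<Longrightarrow> ar g \<Longrightarrow> dm f = X \<Longrightarrow> dm g = X \<Longrightarrow> cd f = Y \<Longrightarrow> cd g = Y \<Longrightarrow> dm h = Y \<Longrightarrow>
    h \<cdot> (f \<oplus>\<^bsub>Hom C X Y\<^esub> g) = h \<cdot> f \<oplus>\<^bsub>Hom C X (cd h)\<^esub> h \<cdot> g"
  using module_hom_add[OF cmp_right_map[of h X], of f g] by auto

lemma cmp_add_left [simp]:
  "ar h \<Longrightarrow> ar f \<Longrightarrow> ar g \<Longrightarrow> dm f = Y \<Longrightarrow> dm g = Y \<Longrightarrow> cd f = Z \<Longrightarrow> cd g = Z \<Longrightarrow> cd h = Y \<Longrightarrow>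
    (f \<oplus>\<^bsub>Hom C Y Z\<^esub> g) \<cdot> h = f \<cdot> h \<oplus>\<^bsub>Hom C (dm h) Z\<^esub> g \<cdot> h"
  using module_hom_add[OF cmp_left_map[of h Z], of f g] by auto

lemma cmp_zero_right [simp]: "ar h \<Longrightarrow> dm h = Y \<Longrightarrow> X \<in> Ob C \<Longrightarrow> h \<cdot> \<zero>\<^bsub>Hom C X Y\<^esub> = \<zero>\<^bsub>Hom C X (cd h)\<^esub>"
  using linear_map.T0_is_0[OF linear_cmp_right[of h X]] by auto

lemma cmp_zero_left [simp]: "ar h \<Longrightarrow> cd h = Y \<Longrightarrow> Z \<in> Ob C \<Longrightarrow> \<zero>\<^bsub>Hom C Y Z\<^esub> \<cdot> h = \<zero>\<^bsub>Hom C (dm h) Z\<^esub>"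
  using linear_map.T0_is_0[OF linear_cmp_left[of h Z]] by auto

lemma cmp_neg_right [simp]:
  "ar h \<Longrightarrow> ar f \<Longrightarrow> dm f = X \<Longrightarrow> cd f = Y \<Longrightarrow> dm h = Y \<Longrightarrow>
    h \<cdot> (\<ominus>\<^bsub>Hom C X Y\<^esub> f) = \<ominus>\<^bsub>Hom C X (cd h)\<^esub> (h \<cdot> f)"
  using linear_map.T_neg[OF linear_cmp_right[of h X], of f] by auto

lemma cmp_neg_left [simp]:
  "ar h \<Longrightarrow> ar f \<Longrightarrow> dm f = Y \<Longrightarrow> cd f = Z \<Longrightarrow> cd h = Y \<Longrightarrow>
    (\<ominus>\<^bsub>Hom C Y Z\<^esub> f) \<cdot> h = \<ominus>\<^bsub>Hom C (dm h) Z\<^esub> (f \<cdot> h)"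
  using linear_map.T_neg[OF linear_cmp_left[of h Z], of f] by auto

lemma cmp_smult_right [simp]:
  "ar h \<Longrightarrow> ar f \<Longrightarrow> dm f = X \<Longrightarrow> cd f = Y \<Longrightarrow> dm h = Y \<Longrightarrow> c \<in> carrier K \<Longrightarrow>
    h \<cdot> (c \<odot>\<^bsub>Hom C X Y\<^esub> f) = c \<odot>\<^bsub>Hom C X (cd h)\<^esub> (h \<cdot> f)"
  using module_hom_smult[OF cmp_right_map[of h X], of c f] by auto

lemma cmp_smult_left [simp]:
  "ar h \<Longrightarrow> ar f \<Longrightarrow> dm f = Y \<Longrightarrow> cd f = Z \<Longrightarrow> cd h = Y \<Longrightarrow> c \<in> carrier K \<Longrightarrow>
    (c \<odot>\<^bsub>Hom C Y Z\<^esub> f) \<cdot> h = c \<odot>\<^bsub>Hom C (dm h) Z\<^esub> (f \<cdot> h)"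
  using module_hom_smult[OF cmp_left_map[of h Z], of c f] by auto

lemma cmp_sum_right:
  assumes "ar h" "X \<in> Ob C" "\<And>a. a \<in> A \<Longrightarrow> arr C (g a) X (dm h)"
  shows "h \<cdot> (\<Oplus>\<^bsub>Hom C X (dm h)\<^esub> a \<in> A. g a) = (\<Oplus>\<^bsub>Hom C X (cd h)\<^esub> a \<in> A. h \<cdot> g a)"
proof (cases "finite A")
  case inf: False
  then show ?thesis using assms by (simp add: finsum_def finprod_def)
next
  case True
  interpret linear_map K "Hom C X (dm h)" "Hom C X (cd h)" "\<lambda>f. h \<cdot> f" using linear_cmp_right assms by blast
  show ?thesis using True assms(3)
  proof (induction A)
    case (insert a A)
    then have "g \<in> A \<rightarrow> carrier (Hom C X (dm h))" "(\<lambda>a. h \<cdot> g a) \<in> A \<rightarrow> carrier (Hom C X (cd h))"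
      "g a \<in> carrier (Hom C X (dm h))" "h \<cdot> g a \<in> carrier (Hom C X (cd h))"
      using assms(1,2) by auto
    moreover have "h \<cdot> finsum (Hom C X (dm h)) g A = (\<Oplus>\<^bsub>Hom C X (cd h)\<^esub> a \<in> A. h \<cdot> g a)" using insert.IH insert.prems by blast
    ultimately show ?case using insert.hyps V.module.M.finsum_closed[of g A] by simp
  qed simp
qed

lemma cmp_sum_left:
  assumes "ar h" "Z \<in> Ob C" "\<And>a. a \<in> A \<Longrightarrow> arr C (g a) (cd h) Z"
  shows "(\<Oplus>\<^bsub>Hom C (cd h) Z\<^esub> a \<in> A. g a) \<cdot> h = (\<Oplus>\<^bsub>Hom C (dm h) Z\<^esub> a \<in> A. g a \<cdot> h)"
proof (cases "finite A")
  case inf: False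
  then show ?thesis using assms by (simp add: finsum_def finprod_def)
next
  case True
  interpret linear_map K "Hom C (cd h) Z" "Hom C (dm h) Z" "\<lambda>f. f \<cdot> h" using linear_cmp_left assms by blast
  show ?thesis using True assms(3)
  proof (induction A)
    case (insert a A)
    then have "g \<in> A \<rightarrow> carrier (Hom C (cd h) Z)" "(\<lambda>a. g a \<cdot> h) \<in> A \<rightarrow> carrier (Hom C (dm h) Z)"
      "g a \<in> carrier (Hom C (cd h) Z)" "g a \<cdot> h \<in> carrier (Hom C (dm h) Z)"
      using assms(1,2) by auto
    moreover have "finsum (Hom C (cd h) Z) g A \<cdot> h = (\<Oplus>\<^bsub>Hom C (dm h) Z\<^esub> a \<in> A. g a \<cdot> h)" using insert.IH insert.prems by blast
    ultimately show ?case using insert.hyps V.module.M.finsum_closed[of g A] by simp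
  qed simp
qed

lemma arr_sum:
  assumes "X \<in> Ob C" "Y \<in> Ob C" "\<And>a. a \<in> A \<Longrightarrow> arr C (g a) X Y"
  shows "arr C (\<Oplus>\<^bsub>Hom C X Y\<^esub> a \<in> A. g a) X Y"
proof -
  interpret abelian_group "Hom C X Y" using Hom_abelian_group assms by blast
  have "(\<Oplus>\<^bsub>Hom C X Y\<^esub> a \<in> A. g a) \<in> carrier (Hom C X Y)" using assms by (intro finsum_closed) auto
  then show ?thesis using assms by simp
qed

section \<open>Zero objects, isomorphisms and biproducts\<close>

lemma zero_ob_Ob: "is_zero_object C N \<Longrightarrow> N \<in> Ob C"
  by (simp add: is_zero_object_def)

lemma arr_to_zero_ob: "is_zero_object C N \<Longrightarrow> arr C f X N \<Longrightarrow> f = \<zero>\<^bsub>Hom C X N\<^esub>"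
  and arr_from_zero_ob: "is_zero_object C N \<Longrightarrow> arr C f N X \<Longrightarrow> f = \<zero>\<^bsub>Hom C N X\<^esub>"
  unfolding is_zero_object_def arr_def by blast+

lemma zero_obI:
  assumes "X \<in> Ob C" "ident C X = \<zero>\<^bsub>Hom C X X\<^esub>"
  shows "is_zero_object C X"
proof -
  have "f = \<zero>\<^bsub>Hom C Y X\<^esub>" if "arr C f Y X" for f Y
    using cmp_ident_left[of f X] that assms(2) by simp
  moreover have "f = \<zero>\<^bsub>Hom C X Y\<^esub>" if "arr C f X Y" for f Y
    using cmp_ident_right[of f X] that assms(2) by simp
  ultimately show ?thesis using assms(1) unfolding is_zero_object_def by auto
qed

lemma iso_mor_iff:
  "iso_mor C X Y f \<and> X \<in> Ob C \<and> Y \<in> Ob C \<longleftrightarrow>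
    arr C f X Y \<and> (\<exists>g. arr C g Y X \<and> g \<cdot> f = ident C X \<and> f \<cdot> g = ident C Y)"
  unfolding iso_mor_def arr_def by blast

lemma section_mor_iff:
  "section_mor C X Y f \<and> X \<in> Ob C \<and> Y \<in> Ob C \<longleftrightarrow> arr C f X Y \<and> (\<exists>r. arr C r Y X \<and> r \<cdot> f = ident C X)"
  unfolding section_mor_def arr_def by blast

lemma retraction_mor_iff:
  "retraction_mor C X Y f \<and> X \<in> Ob C \<and> Y \<in> Ob C \<longleftrightarrow> arr C f X Y \<and> (\<exists>s. arr C s Y X \<and> f \<cdot> s = ident C Y)"
  unfolding retraction_mor_def arr_def by blast

lemma isomorphic_iff:
  "isomorphic C X Y \<longleftrightarrow> (\<exists>f g. arr C f X Y \<and> arr C g Y X \<and> g \<cdot> f = ident C X \<and> f \<cdot> g = ident C Y)"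
  unfolding isomorphic_def iso_mor_def arr_def by blast

lemma isomorphic_refl: "X \<in> Ob C \<Longrightarrow> isomorphic C X X"
  unfolding isomorphic_iff by (intro exI[of _ "ident C X"]) simp

lemma isomorphic_sym: "isomorphic C X Y \<Longrightarrow> isomorphic C Y X"
  unfolding isomorphic_iff by blast

text \<open>Associativity is oriented to the right, so an inverse pair inside a longer composite is
  never a subterm of its own. This form of the cancellation matches right-nested composites.\<close>

lemma cancel_left: "g \<cdot> f = ident C X \<Longrightarrow> ar f \<Longrightarrow> ar g \<Longrightarrow> cd f = dm g \<Longrightarrow> ar h \<Longrightarrow> cd h = dm f \<Longrightarrow> dm f = X \<Longrightarrow>
    g \<cdot> (f \<cdot> h) = h"
  using assoc[of h f g] by simp

lemma cancel_zero: "g \<cdot> f = \<zero>\<^bsub>Hom C X Y\<^esub> \<Longrightarrow> ar f \<Longrightarrow> ar g \<Longrightarrow> cd f = dm g \<Longrightarrow> ar h \<Longrightarrow> cd h = dm f \<Longrightarrow>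
    dm f = X \<Longrightarrow> cd g = Y \<Longrightarrow> g \<cdot> (f \<cdot> h) = \<zero>\<^bsub>Hom C (dm h) Y\<^esub>"
  using assoc[of h f g] by auto

lemma isomorphic_trans: "isomorphic C X Y \<Longrightarrow> isomorphic C Y Z \<Longrightarrow> isomorphic C X Z"
  unfolding isomorphic_iff
proof (elim exE conjE)
  fix f g f' g' assume a: "arr C f X Y" "arr C g Y X" "g \<cdot> f = ident C X" "f \<cdot> g = ident C Y"
    "arr C f' Y Z" "arr C g' Z Y" "g' \<cdot> f' = ident C Y" "f' \<cdot> g' = ident C Z"
  have "(g \<cdot> g') \<cdot> (f' \<cdot> f) = ident C X" "(f' \<cdot> f) \<cdot> (g \<cdot> g') = ident C Z"
    using a by (simp_all add: cancel_left[OF a(7)] cancel_left[OF a(4)])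
  then show "\<exists>f g. arr C f X Z \<and> arr C g Z X \<and> g \<cdot> f = ident C X \<and> f \<cdot> g = ident C Z"
    using a by (intro exI[of _ "f' \<cdot> f"] exI[of _ "g \<cdot> g'"]) simp
qed

lemma biproduct_iff:
  "biproduct C X Y B i j p q \<longleftrightarrow> arr C i X B \<and> arr C j Y B \<and> arr C p B X \<and> arr C q B Y \<and>
     p \<cdot> i = ident C X \<and> q \<cdot> j = ident C Y \<and> p \<cdot> j = \<zero>\<^bsub>Hom C Y X\<^esub> \<and> q \<cdot> i = \<zero>\<^bsub>Hom C X Y\<^esub> \<and>
     i \<cdot> p \<oplus>\<^bsub>Hom C B B\<^esub> j \<cdot> q = ident C B"
  unfolding biproduct_def arr_def by blast

text \<open>The quantified facts at the end repeat the biproduct identities with a further factor,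
  so that they apply to right-nested composites. The last two decompose morphisms into and out of
  B.\<close>

lemma biproduct_simps:
  assumes "biproduct C X Y B i j p q"
  shows "ar i" "ar j" "ar p" "ar q" "dm i = X" "dm j = Y" "dm p = B" "dm q = B"
    "cd i = B" "cd j = B" "cd p = X" "cd q = Y" "X \<in> Ob C" "Y \<in> Ob C" "B \<in> Ob C"
    "p \<cdot> i = ident C X" "q \<cdot> j = ident C Y" "p \<cdot> j = \<zero>\<^bsub>Hom C Y X\<^esub>" "q \<cdot> i = \<zero>\<^bsub>Hom C X Y\<^esub>"
    "i \<cdot> p \<oplus>\<^bsub>Hom C B B\<^esub> j \<cdot> q = ident C B"
    "\<And>h. ar h \<Longrightarrow> cd h = X \<Longrightarrow> p \<cdot> (i \<cdot> h) = h" "\<And>h. ar h \<Longrightarrow> cd h = Y \<Longrightarrow> q \<cdot> (j \<cdot> h) = h"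
    "\<And>h. ar h \<Longrightarrow> cd h = X \<Longrightarrow> q \<cdot> (i \<cdot> h) = \<zero>\<^bsub>Hom C (dm h) Y\<^esub>"
    "\<And>h. ar h \<Longrightarrow> cd h = Y \<Longrightarrow> p \<cdot> (j \<cdot> h) = \<zero>\<^bsub>Hom C (dm h) X\<^esub>"
    "\<And>h. ar h \<Longrightarrow> cd h = B \<Longrightarrow> i \<cdot> (p \<cdot> h) \<oplus>\<^bsub>Hom C (dm h) B\<^esub> j \<cdot> (q \<cdot> h) = h"
    "\<And>h. ar h \<Longrightarrow> dm h = B \<Longrightarrow> h \<cdot> (i \<cdot> p) \<oplus>\<^bsub>Hom C B (cd h)\<^esub> h \<cdot> (j \<cdot> q) = h"
proof -
  show "ar i" "ar j" "ar p" "ar q" "dm i = X" "dm j = Y" "dm p = B" "dm q = B"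
    "cd i = B" "cd j = B" "cd p = X" "cd q = Y" "X \<in> Ob C" "Y \<in> Ob C" "B \<in> Ob C"
    "p \<cdot> i = ident C X" "q \<cdot> j = ident C Y" "p \<cdot> j = \<zero>\<^bsub>Hom C Y X\<^esub>" "q \<cdot> i = \<zero>\<^bsub>Hom C X Y\<^esub>"
    and s: "i \<cdot> p \<oplus>\<^bsub>Hom C B B\<^esub> j \<cdot> q = ident C B"
    using assms by (simp_all add: biproduct_iff)
  note t = this
  show "\<And>h. ar h \<Longrightarrow> cd h = X \<Longrightarrow> p \<cdot> (i \<cdot> h) = h" "\<And>h. ar h \<Longrightarrow> cd h = Y \<Longrightarrow> q \<cdot> (j \<cdot> h) = h"
    "\<And>h. ar h \<Longrightarrow> cd h = X \<Longrightarrow> q \<cdot> (i \<cdot> h) = \<zero>\<^bsub>Hom C (dm h) Y\<^esub>"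
    "\<And>h. ar h \<Longrightarrow> cd h = Y \<Longrightarrow> p \<cdot> (j \<cdot> h) = \<zero>\<^bsub>Hom C (dm h) X\<^esub>"
    using t by (auto simp: cancel_left[OF t(16)] cancel_left[OF t(17)] cancel_zero[OF t(18)] cancel_zero[OF t(19)])
  show "i \<cdot> (p \<cdot> h) \<oplus>\<^bsub>Hom C (dm h) B\<^esub> j \<cdot> (q \<cdot> h) = h" if "ar h" "cd h = B" for h
  proof -
    have "(i \<cdot> p \<oplus>\<^bsub>Hom C B B\<^esub> j \<cdot> q) \<cdot> h = h" unfolding s using that by simp
    then show ?thesis using that t(1-15) by simp
  qed
  show "h \<cdot> (i \<cdot> p) \<oplus>\<^bsub>Hom C B (cd h)\<^esub> h \<cdot> (j \<cdot> q) = h" if "ar h" "dm h = B" for h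
  proof -
    have "h \<cdot> (i \<cdot> p \<oplus>\<^bsub>Hom C B B\<^esub> j \<cdot> q) = h" unfolding s using that by simp
    then show ?thesis using that t(1-15) by simp
  qed
qed

lemma biproduct_swap: "biproduct C X Y B i j p q \<Longrightarrow> biproduct C Y X B j i q p"
  using add_comm[of "i \<cdot> p" B B "j \<cdot> q"] unfolding biproduct_iff by simp

lemma biproduct_iso:
  assumes b: "biproduct C X Y B i j p q" and f: "arr C f B B'" "arr C g B' B" "g \<cdot> f = ident C B" "f \<cdot> g = ident C B'"
  shows "biproduct C X Y B' (f \<cdot> i) (f \<cdot> j) (p \<cdot> g) (q \<cdot> g)"
proof -
  note s = biproduct_simps[OF b]
  have "f \<cdot> (i \<cdot> (p \<cdot> g) \<oplus>\<^bsub>Hom C B' B\<^esub> j \<cdot> (q \<cdot> g)) = ident C B'"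
    using s(25)[of g] f by simp
  then have "f \<cdot> (i \<cdot> (p \<cdot> g)) \<oplus>\<^bsub>Hom C B' B'\<^esub> f \<cdot> (j \<cdot> (q \<cdot> g)) = ident C B'"
    using f s(1-15) by simp
  then show ?thesis unfolding biproduct_iff using f by (simp add: s(1-24) cancel_left[OF f(3)])
qed

lemma biproduct_assoc:
  assumes b1: "biproduct C A S X i j p q" and b2: "biproduct C X Y Z i' j' p' q'"
    and b3: "biproduct C S Y W k l m n"
  shows "biproduct C A W Z (i' \<cdot> i) (i' \<cdot> (j \<cdot> m) \<oplus>\<^bsub>Hom C W Z\<^esub> j' \<cdot> n) (p \<cdot> p')
    (k \<cdot> (q \<cdot> p') \<oplus>\<^bsub>Hom C Z W\<^esub> l \<cdot> q')"
proof -
  note s = biproduct_simps[OF b1] biproduct_simps[OF b2] biproduct_simps[OF b3]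
  have "i' \<cdot> (i \<cdot> (p \<cdot> p') \<oplus>\<^bsub>Hom C Z X\<^esub> j \<cdot> (q \<cdot> p')) = i' \<cdot> p'"
    using biproduct_simps(25)[OF b1, of p'] biproduct_simps(1-15)[OF b2] by simp
  then have *: "i' \<cdot> (i \<cdot> (p \<cdot> p')) \<oplus>\<^bsub>Hom C Z Z\<^esub> i' \<cdot> (j \<cdot> (q \<cdot> p')) = i' \<cdot> p'"
    using biproduct_simps(1-15)[OF b1] biproduct_simps(1-15)[OF b2] by simp
  show ?thesis unfolding biproduct_iff
    by (simp add: s * flip: add_assoc)
qed

text \<open>Direct sums as iterated biproducts, so that proofs can go by induction on the list. The
  maps are hidden in the existential quantifiers; agreement with the indexed notion is
  \<open>direct_sum_iff_dsum\<close>.\<close>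

fun dsum :: "'o list \<Rightarrow> 'o \<Rightarrow> bool" where
  "dsum [] X \<longleftrightarrow> is_zero_object C X"
| "dsum (A # As) X \<longleftrightarrow> (\<exists>S i j p q. biproduct C A S X i j p q \<and> dsum As S)"

lemma dsum_ConsI: "biproduct C A S X i j p q \<Longrightarrow> dsum As S \<Longrightarrow> dsum (A # As) X"
  by (simp only: dsum.simps) blast

lemma dsum_Ob: "dsum As X \<Longrightarrow> X \<in> Ob C \<and> set As \<subseteq> Ob C"
proof (induction As arbitrary: X)
  case (Cons A As)
  then obtain S i j p q where b: "biproduct C A S X i j p q" "dsum As S" by auto
  show ?case using biproduct_simps(13,15)[OF b(1)] Cons.IH[OF b(2)] by simp
qed (simp add: zero_ob_Ob)

lemma sum_Suc:
  assumes "X \<in> Ob C" "Y \<in> Ob C" "\<And>k. k < Suc n \<Longrightarrow> arr C (f k) X Y"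
  shows "(\<Oplus>\<^bsub>Hom C X Y\<^esub> k \<in> {..<Suc n}. f k) = f 0 \<oplus>\<^bsub>Hom C X Y\<^esub> (\<Oplus>\<^bsub>Hom C X Y\<^esub> k \<in> {..<n}. f (Suc k))"
proof -
  interpret abelian_monoid "Hom C X Y" using Hom_abelian_monoid assms(1,2) by blast
  have m: "f k \<in> carrier (Hom C X Y)" if "k < Suc n" for k using assms(3)[OF that] assms(1,2) by simp
  have f: "f \<in> {..<Suc n} \<rightarrow> carrier (Hom C X Y)" using m by blast
  have "(\<Oplus>\<^bsub>Hom C X Y\<^esub> k \<in> insert 0 (Suc ` {..<n}). f k)
      = f 0 \<oplus>\<^bsub>Hom C X Y\<^esub> (\<Oplus>\<^bsub>Hom C X Y\<^esub> k \<in> Suc ` {..<n}. f k)"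
    using m by (intro finsum_insert) auto
  also have "(\<Oplus>\<^bsub>Hom C X Y\<^esub> k \<in> Suc ` {..<n}. f k) = (\<Oplus>\<^bsub>Hom C X Y\<^esub> k \<in> {..<n}. f (Suc k))"
    using m by (intro finsum_reindex) auto
  finally show ?thesis by (simp add: lessThan_Suc_eq_insert_0)
qed

lemma sum_delta:
  assumes "X \<in> Ob C" "Y \<in> Ob C" "l < (n :: nat)" "arr C g X Y"
    "\<And>k. k < n \<Longrightarrow> f k = (if k = l then g else \<zero>\<^bsub>Hom C X Y\<^esub>)"
  shows "(\<Oplus>\<^bsub>Hom C X Y\<^esub> k \<in> {..<n}. f k) = g"
proof -
  interpret abelian_monoid "Hom C X Y" using Hom_abelian_monoid assms(1,2) by blast
  have g: "g \<in> carrier (Hom C X Y)" using assms by simp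
  have "(\<Oplus>\<^bsub>Hom C X Y\<^esub> k \<in> {..<n}. f k) = (\<Oplus>\<^bsub>Hom C X Y\<^esub> k \<in> {..<n}. if l = k then g else \<zero>\<^bsub>Hom C X Y\<^esub>)"
    using g assms(5) by (intro finsum_cong') auto
  also have "\<dots> = g" using assms(3) g by (intro finsum_singleton) auto
  finally show ?thesis .
qed

definition sum_maps :: "'o list \<Rightarrow> 'o \<Rightarrow> (nat \<Rightarrow> 'm) \<Rightarrow> (nat \<Rightarrow> 'm) \<Rightarrow> bool" where
  "sum_maps As X i p \<longleftrightarrow> set As \<subseteq> Ob C \<and> X \<in> Ob C \<and>
     (\<forall>k < length As. arr C (i k) (As ! k) X \<and> arr C (p k) X (As ! k)) \<and>
     (\<forall>k < length As. \<forall>l < length As.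
        p k \<cdot> i l = (if k = l then ident C (As ! k) else \<zero>\<^bsub>Hom C (As ! l) (As ! k)\<^esub>)) \<and>
     (\<Oplus>\<^bsub>Hom C X X\<^esub> k \<in> {..<length As}. i k \<cdot> p k) = ident C X"

lemma direct_sum_iff: "direct_sum C As X \<longleftrightarrow> (\<exists>i p. sum_maps As X i p)"
proof -
  have "arr C f (As ! k) X \<longleftrightarrow> f \<in> carrier (Hom C (As ! k) X)" "arr C f X (As ! k) \<longleftrightarrow> f \<in> carrier (Hom C X (As ! k))"
    if "set As \<subseteq> Ob C" "X \<in> Ob C" "k < length As" for f k
    using that nth_mem unfolding arr_def by blast+
  then have "sum_maps As X i p \<longleftrightarrow> set As \<subseteq> Ob C \<and> X \<in> Ob C \<and>
      (\<forall>k < length As. i k \<in> carrier (Hom C (As ! k) X) \<and> p k \<in> carrier (Hom C X (As ! k))) \<and>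
      (\<forall>k < length As. \<forall>l < length As.
         p k \<cdot> i l = (if k = l then ident C (As ! k) else \<zero>\<^bsub>Hom C (As ! l) (As ! k)\<^esub>)) \<and>
      (\<Oplus>\<^bsub>Hom C X X\<^esub> k \<in> {..<length As}. i k \<cdot> p k) = ident C X" for i p
    unfolding sum_maps_def by (auto simp del: arr_iff mem_Hom_iff)
  then show ?thesis unfolding direct_sum_def by (simp only: ex_simps)
qed

lemma sum_mapsD:
  assumes "sum_maps As X i p"
  shows "\<And>k. k < length As \<Longrightarrow> arr C (i k) (As ! k) X" "\<And>k. k < length As \<Longrightarrow> arr C (p k) X (As ! k)"
    "\<And>k l. k < length As \<Longrightarrow> l < length As \<Longrightarrow>
        p k \<cdot> i l = (if k = l then ident C (As ! k) else \<zero>\<^bsub>Hom C (As ! l) (As ! k)\<^esub>)"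
    "(\<Oplus>\<^bsub>Hom C X X\<^esub> k \<in> {..<length As}. i k \<cdot> p k) = ident C X" "set As \<subseteq> Ob C" "X \<in> Ob C"
  using assms unfolding sum_maps_def by (simp_all del: arr_iff)

lemma direct_sum_ConsI:
  assumes b: "biproduct C A S X i0 j p0 q" and d: "direct_sum C As S"
  shows "direct_sum C (A # As) X"
proof -
  note s = biproduct_simps[OF b]
  obtain i p where m: "sum_maps As S i p" using d unfolding direct_sum_iff by blast
  note a = sum_mapsD(1,2)[OF m] and o = sum_mapsD(3)[OF m] and su = sum_mapsD(4)[OF m] and O = sum_mapsD(5,6)[OF m]
  define i' where "i' k = (case k of 0 \<Rightarrow> i0 | Suc k \<Rightarrow> j \<cdot> i k)" for k
  define p' where "p' k = (case k of 0 \<Rightarrow> p0 | Suc k \<Rightarrow> p k \<cdot> q)" for k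
  have t: "arr C (i' k) ((A # As) ! k) X" "arr C (p' k) X ((A # As) ! k)" if "k < Suc (length As)" for k
    using a that s(1-15) by (cases k; simp add: i'_def p'_def)+
  have orth: "p' k \<cdot> i' l = (if k = l then ident C ((A # As) ! k) else \<zero>\<^bsub>Hom C ((A # As) ! l) ((A # As) ! k)\<^esub>)"
    if "k < Suc (length As)" "l < Suc (length As)" for k l
  proof (cases k; cases l)
    fix k' l' assume k: "k = Suc k'" "l = Suc l'"
    then have "p k' \<cdot> (q \<cdot> (j \<cdot> i l')) = p k' \<cdot> i l'" using a[of l'] that by (simp add: s(22))
    then show ?thesis using k that a[of l'] a[of k'] s(1-15) o[of k' l'] by (simp add: i'_def p'_def)
  qed (use that a s in \<open>auto simp: i'_def p'_def\<close>)
  have "(\<Oplus>\<^bsub>Hom C X X\<^esub> k \<in> {..<Suc (length As)}. i' k \<cdot> p' k)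
      = i0 \<cdot> p0 \<oplus>\<^bsub>Hom C X X\<^esub> (\<Oplus>\<^bsub>Hom C X X\<^esub> k \<in> {..<length As}. j \<cdot> ((i k \<cdot> p k) \<cdot> q))"
  proof (subst sum_Suc)
    show "arr C (i' k \<cdot> p' k) X X" if "k < Suc (length As)" for k using t[OF that] by simp
    have "(\<Oplus>\<^bsub>Hom C X X\<^esub> k \<in> {..<length As}. i' (Suc k) \<cdot> p' (Suc k))
        = (\<Oplus>\<^bsub>Hom C X X\<^esub> k \<in> {..<length As}. j \<cdot> ((i k \<cdot> p k) \<cdot> q))"
      using a s(1-15) Hom_abelian_monoid[of X X]
      by (intro abelian_monoid.finsum_cong') (auto simp: i'_def p'_def)
    then show "i' 0 \<cdot> p' 0 \<oplus>\<^bsub>Hom C X X\<^esub> (\<Oplus>\<^bsub>Hom C X X\<^esub> k \<in> {..<length As}. i' (Suc k) \<cdot> p' (Suc k))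
      = i0 \<cdot> p0 \<oplus>\<^bsub>Hom C X X\<^esub> (\<Oplus>\<^bsub>Hom C X X\<^esub> k \<in> {..<length As}. j \<cdot> ((i k \<cdot> p k) \<cdot> q))"
      by (simp add: i'_def p'_def)
  qed (use s(15) in auto)
  also have "(\<Oplus>\<^bsub>Hom C X X\<^esub> k \<in> {..<length As}. j \<cdot> ((i k \<cdot> p k) \<cdot> q))
      = j \<cdot> ((\<Oplus>\<^bsub>Hom C S S\<^esub> k \<in> {..<length As}. i k \<cdot> p k) \<cdot> q)"
    using a s(1-15) cmp_sum_left[of q S "{..<length As}" "\<lambda>k. i k \<cdot> p k"]
      cmp_sum_right[of j X "{..<length As}" "\<lambda>k. (i k \<cdot> p k) \<cdot> q"] by simp
  finally have "(\<Oplus>\<^bsub>Hom C X X\<^esub> k \<in> {..<Suc (length As)}. i' k \<cdot> p' k) = ident C X"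
    using su s by simp
  moreover have "\<forall>k < length (A # As). arr C (i' k) ((A # As) ! k) X \<and> arr C (p' k) X ((A # As) ! k)"
    using t by (simp del: arr_iff)
  moreover have "\<forall>k < length (A # As). \<forall>l < length (A # As). p' k \<cdot> i' l =
      (if k = l then ident C ((A # As) ! k) else \<zero>\<^bsub>Hom C ((A # As) ! l) ((A # As) ! k)\<^esub>)"
    using orth by (simp del: nth_Cons_Suc)
  ultimately have "sum_maps (A # As) X i' p'" unfolding sum_maps_def using O s(13,15) by simp
  then show ?thesis unfolding direct_sum_iff by blast
qed

lemma dsum_imp_direct_sum: "dsum As X \<Longrightarrow> direct_sum C As X"
proof (induction As arbitrary: X)
  case Nil
  then have "X \<in> Ob C" and "ident C X = \<zero>\<^bsub>Hom C X X\<^esub>"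
    using zero_ob_Ob arr_to_zero_ob[of X "ident C X" X] by auto
  then have "sum_maps [] X undefined undefined"
    using abelian_monoid.finsum_empty[OF Hom_abelian_monoid] unfolding sum_maps_def by simp
  then show ?case unfolding direct_sum_iff by blast
next
  case (Cons A As)
  then obtain S i j p q where b: "biproduct C A S X i j p q" "dsum As S" by auto
  show ?case using direct_sum_ConsI[OF b(1) Cons.IH[OF b(2)]] .
qed

text \<open>The sum \<open>S\<close> of the tail is given independently of \<open>X\<close>, so the
  maps between them are assembled from components, and every identity is tested on
  components.\<close>

lemma direct_sum_ConsD:
  assumes d: "direct_sum C (A # As) X" and S: "direct_sum C As S"
  shows "\<exists>i j p q. biproduct C A S X i j p q"
proof -
  let ?n = "length As"
  obtain i p where "sum_maps (A # As) X i p" using d unfolding direct_sum_iff by blast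
  note m = sum_mapsD[OF this, unfolded list.size(4) Nat.add_0_right add_Suc_right set_simps]
  note a = m(1,2) and o = m(3) and su = m(4)
  have O: "X \<in> Ob C" "A \<in> Ob C" "set As \<subseteq> Ob C" using m(5,6) by auto
  obtain i2 p2 where m2: "sum_maps As S i2 p2" using S unfolding direct_sum_iff by blast
  note a2 = sum_mapsD(1,2)[OF m2] and o2 = sum_mapsD(3)[OF m2] and su2 = sum_mapsD(4)[OF m2] and O2 = sum_mapsD(6)[OF m2]
  have aS: "arr C (i (Suc k)) (As ! k) X" "arr C (p (Suc k)) X (As ! k)" if "k < ?n" for k
    using a[of "Suc k"] that by (simp_all del: arr_iff)
  have a0: "arr C (i 0) A X" "arr C (p 0) X A" using a[of 0] by simp_all
  have oS: "p (Suc k) \<cdot> i (Suc l) = p2 k \<cdot> i2 l" if "k < ?n" "l < ?n" for k l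
    using o[of "Suc k" "Suc l"] o2[OF that] that by simp
  \<comment> \<open>The maps \<open>j\<close> and \<open>q\<close> match the component of
    \<open>S\<close> with index k with the component of \<open>X\<close> with index k + 1.\<close>
  define j where "j = (\<Oplus>\<^bsub>Hom C S X\<^esub> k \<in> {..<?n}. i (Suc k) \<cdot> p2 k)"
  define q where "q = (\<Oplus>\<^bsub>Hom C X S\<^esub> k \<in> {..<?n}. i2 k \<cdot> p (Suc k))"
  have j: "arr C j S X" and q: "arr C q X S"
    unfolding j_def q_def using a2 aS O O2 by (intro arr_sum; simp)+
  have ji: "j \<cdot> i2 l = i (Suc l)" if l: "l < ?n" for l
  proof -
    have "j \<cdot> i2 l = (\<Oplus>\<^bsub>Hom C (As ! l) X\<^esub> k \<in> {..<?n}. (i (Suc k) \<cdot> p2 k) \<cdot> i2 l)"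
      unfolding j_def using cmp_sum_left[of "i2 l" X "{..<?n}" "\<lambda>k. i (Suc k) \<cdot> p2 k"] a2 aS l O by simp
    also have "\<dots> = i (Suc l)"
      using a2 aS l O by (intro sum_delta[OF _ _ l]) (auto simp: o2)
    finally show ?thesis .
  qed
  have pq: "p2 l \<cdot> q = p (Suc l)" if l: "l < ?n" for l
  proof -
    have "p2 l \<cdot> q = (\<Oplus>\<^bsub>Hom C X (As ! l)\<^esub> k \<in> {..<?n}. p2 l \<cdot> (i2 k \<cdot> p (Suc k)))"
      unfolding q_def using cmp_sum_right[of "p2 l" X "{..<?n}" "\<lambda>k. i2 k \<cdot> p (Suc k)"] a2 aS l O by simp
    also have "\<dots> = p (Suc l)"
    proof (rule sum_delta[OF _ _ l])
      fix k assume k: "k < ?n"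
      have "p2 l \<cdot> (i2 k \<cdot> p (Suc k)) = (p2 l \<cdot> i2 k) \<cdot> p (Suc k)" using a2 aS k l by simp
      then show "p2 l \<cdot> (i2 k \<cdot> p (Suc k)) = (if k = l then p (Suc l) else \<zero>\<^bsub>Hom C X (As ! l)\<^esub>)"
        using o2[OF l k] aS[OF k] aS[OF l] O k l a2[OF k] by (auto simp del: assoc)
    qed (use aS[OF l] in auto)
    finally show ?thesis .
  qed
  have decomp: "(\<Oplus>\<^bsub>Hom C Y S\<^esub> k \<in> {..<?n}. i2 k \<cdot> (p2 k \<cdot> f)) = f" if f: "arr C f Y S" for f Y
  proof -
    have "(\<Oplus>\<^bsub>Hom C Y S\<^esub> k \<in> {..<?n}. i2 k \<cdot> (p2 k \<cdot> f)) = (\<Oplus>\<^bsub>Hom C Y S\<^esub> k \<in> {..<?n}. (i2 k \<cdot> p2 k) \<cdot> f)"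
      using f a2 O2 by (intro abelian_monoid.finsum_cong'[OF Hom_abelian_monoid]) auto
    also have "\<dots> = (\<Oplus>\<^bsub>Hom C S S\<^esub> k \<in> {..<?n}. i2 k \<cdot> p2 k) \<cdot> f"
      using cmp_sum_left[of f S "{..<?n}" "\<lambda>k. i2 k \<cdot> p2 k"] f a2 O2 by simp
    finally show ?thesis using su2 f by simp
  qed
  have decompr: "(\<Oplus>\<^bsub>Hom C S Y\<^esub> k \<in> {..<?n}. (f \<cdot> i2 k) \<cdot> p2 k) = f" if f: "arr C f S Y" for f Y
  proof -
    have "(\<Oplus>\<^bsub>Hom C S Y\<^esub> k \<in> {..<?n}. (f \<cdot> i2 k) \<cdot> p2 k) = (\<Oplus>\<^bsub>Hom C S Y\<^esub> k \<in> {..<?n}. f \<cdot> (i2 k \<cdot> p2 k))"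
      using f a2 O2 by (intro abelian_monoid.finsum_cong'[OF Hom_abelian_monoid]) auto
    also have "\<dots> = f \<cdot> (\<Oplus>\<^bsub>Hom C S S\<^esub> k \<in> {..<?n}. i2 k \<cdot> p2 k)"
      using cmp_sum_right[of f S "{..<?n}" "\<lambda>k. i2 k \<cdot> p2 k"] f a2 O2 by simp
    finally show ?thesis using su2 f by simp
  qed
  \<comment> \<open>Morphisms into and out of \<open>S\<close> are determined by their components,
    which reduces the biproduct identities to the orthogonality relations of the two sums.\<close>
  have compl: "f = g" if "arr C f Y S" "arr C g Y S" "\<And>k. k < ?n \<Longrightarrow> p2 k \<cdot> f = p2 k \<cdot> g" for f g Y
  proof -
    have "(\<Oplus>\<^bsub>Hom C Y S\<^esub> k \<in> {..<?n}. i2 k \<cdot> (p2 k \<cdot> f)) = (\<Oplus>\<^bsub>Hom C Y S\<^esub> k \<in> {..<?n}. i2 k \<cdot> (p2 k \<cdot> g))"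
      using that a2 O2 by (intro abelian_monoid.finsum_cong'[OF Hom_abelian_monoid]) auto
    then show ?thesis using decomp[OF that(1)] decomp[OF that(2)] by simp
  qed
  have compr: "f = g" if "arr C f S Y" "arr C g S Y" "\<And>k. k < ?n \<Longrightarrow> f \<cdot> i2 k = g \<cdot> i2 k" for f g Y
  proof -
    have "(\<Oplus>\<^bsub>Hom C S Y\<^esub> k \<in> {..<?n}. (f \<cdot> i2 k) \<cdot> p2 k) = (\<Oplus>\<^bsub>Hom C S Y\<^esub> k \<in> {..<?n}. (g \<cdot> i2 k) \<cdot> p2 k)"
      using that a2 O2 by (intro abelian_monoid.finsum_cong'[OF Hom_abelian_monoid]) auto
    then show ?thesis using decompr[OF that(1)] decompr[OF that(2)] by simp
  qed
  have pj: "p (Suc k) \<cdot> j = p2 k" if k: "k < ?n" for k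
  proof (rule compr)
    fix l assume l: "l < ?n"
    have "(p (Suc k) \<cdot> j) \<cdot> i2 l = p (Suc k) \<cdot> i (Suc l)" using ji[OF l] aS[OF k] a2[OF l] j by simp
    then show "(p (Suc k) \<cdot> j) \<cdot> i2 l = p2 k \<cdot> i2 l" using oS[OF k l] by simp
  qed (use aS[OF k] a2[OF k] j in auto)
  have "q \<cdot> j = ident C S"
  proof (rule compl)
    fix k assume k: "k < ?n"
    have "p2 k \<cdot> (q \<cdot> j) = (p2 k \<cdot> q) \<cdot> j" using a2[OF k] q j by simp
    then show "p2 k \<cdot> (q \<cdot> j) = p2 k \<cdot> ident C S" using pq[OF k] pj[OF k] a2[OF k] by simp
  qed (use q j O2 in auto)
  moreover have "p 0 \<cdot> j = \<zero>\<^bsub>Hom C S A\<^esub>"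
  proof (rule compr)
    fix l assume l: "l < ?n"
    show "(p 0 \<cdot> j) \<cdot> i2 l = \<zero>\<^bsub>Hom C S A\<^esub> \<cdot> i2 l"
      using ji[OF l] a0 a2[OF l] j O O2 o[of 0 "Suc l"] l by simp
  qed (use a0 j O O2 in auto)
  moreover have "q \<cdot> i 0 = \<zero>\<^bsub>Hom C A S\<^esub>"
  proof (rule compl)
    fix l assume l: "l < ?n"
    have "p2 l \<cdot> (q \<cdot> i 0) = (p2 l \<cdot> q) \<cdot> i 0" using a2[OF l] q a0 by simp
    then show "p2 l \<cdot> (q \<cdot> i 0) = p2 l \<cdot> \<zero>\<^bsub>Hom C A S\<^esub>"
      using pq[OF l] a0 a2[OF l] O O2 o[of "Suc l" 0] l by simp
  qed (use a0 q O O2 in auto)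
  moreover have "i 0 \<cdot> p 0 \<oplus>\<^bsub>Hom C X X\<^esub> j \<cdot> q = ident C X"
  proof -
    have "j \<cdot> q = (\<Oplus>\<^bsub>Hom C X X\<^esub> k \<in> {..<?n}. (i (Suc k) \<cdot> p2 k) \<cdot> q)"
      unfolding j_def using cmp_sum_left[of q X "{..<?n}" "\<lambda>k. i (Suc k) \<cdot> p2 k"] a2 aS q O by simp
    also have "\<dots> = (\<Oplus>\<^bsub>Hom C X X\<^esub> k \<in> {..<?n}. i (Suc k) \<cdot> p (Suc k))"
      using a2 aS q O pq by (intro abelian_monoid.finsum_cong'[OF Hom_abelian_monoid]) auto
    finally show ?thesis using su sum_Suc[of X X ?n "\<lambda>k. i k \<cdot> p k"] a O by simp
  qed
  moreover have "p 0 \<cdot> i 0 = ident C A" using o[of 0 0] by simp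
  ultimately show ?thesis using a0 q j O O2 unfolding biproduct_iff
    by (intro exI[of _ "i 0"] exI[of _ j] exI[of _ "p 0"] exI[of _ q]) simp
qed

lemma biproduct_iso_right:
  assumes b: "biproduct C A S X i j p q"
    and f: "arr C f S S'" "arr C g S' S" "g \<cdot> f = ident C S" "f \<cdot> g = ident C S'"
  shows "biproduct C A S' X i (j \<cdot> g) p (f \<cdot> q)"
  unfolding biproduct_iff using f biproduct_simps[OF b]
  by (simp add: cancel_left[OF f(3)])

lemma biproduct_zero_right:
  assumes "is_zero_object C N" "A \<in> Ob C"
  shows "biproduct C A N A (ident C A) \<zero>\<^bsub>Hom C N A\<^esub> (ident C A) \<zero>\<^bsub>Hom C A N\<^esub>"
  unfolding biproduct_iff using assms zero_ob_Ob arr_to_zero_ob[OF assms(1), of "ident C N" N] by simp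

lemma biproduct_zero_iso:
  assumes b: "biproduct C A N X i j p q" and N: "is_zero_object C N"
  shows "arr C i A X" "arr C p X A" "p \<cdot> i = ident C A" "i \<cdot> p = ident C X"
proof -
  note s = biproduct_simps[OF b]
  have "j = \<zero>\<^bsub>Hom C N X\<^esub>" using arr_from_zero_ob[OF N, of j X] s(1-15) by simp
  then show "i \<cdot> p = ident C X" using s(1-15) s(20) by simp
qed (use biproduct_simps[OF b] in simp_all)

lemma biproduct_zero_isomorphic:
  assumes "biproduct C A N X i j p q" "is_zero_object C N"
  shows "isomorphic C A X"
  using biproduct_zero_iso[OF assms] unfolding isomorphic_iff by blast

end

context additive_category
begin

lemma ex_dsum: "set As \<subseteq> Ob C \<Longrightarrow> \<exists>S. dsum As S"
proof (induction As)
  case (Cons A As)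
  then obtain S where S: "dsum As S" by auto
  then obtain B i j p q where "biproduct C A S B i j p q" using ex_biproduct[of A S] dsum_Ob Cons.prems by auto
  then show ?case using dsum_ConsI S by blast
qed (metis dsum.simps(1) ex_zero_object)

text \<open>Splitting off the first component requires an object that is the sum of the others; in
  an additive category it exists by \<open>ex_dsum\<close>.\<close>

lemma direct_sum_iff_dsum: "direct_sum C As X \<longleftrightarrow> dsum As X"
proof
  show "direct_sum C As X \<Longrightarrow> dsum As X"
  proof (induction As)
    case Nil
    then obtain i p where "sum_maps [] X i p" unfolding direct_sum_iff by blast
    then have "X \<in> Ob C" "ident C X = \<zero>\<^bsub>Hom C X X\<^esub>"
      unfolding sum_maps_def by (auto simp: abelian_monoid.finsum_empty[OF Hom_abelian_monoid])
    then show ?case using zero_obI by simp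
  next
    case (Cons A As)
    then have "set As \<subseteq> Ob C" unfolding direct_sum_def by simp
    then obtain S where S: "dsum As S" using ex_dsum by blast
    then show ?case using direct_sum_ConsD[OF Cons.prems dsum_imp_direct_sum[OF S]] dsum_ConsI by blast
  qed
qed (rule dsum_imp_direct_sum)

lemma dsum_single: "dsum [A] X \<longleftrightarrow> isomorphic C A X"
proof
  assume "dsum [A] X"
  then show "isomorphic C A X" using biproduct_zero_isomorphic by auto
next
  assume "isomorphic C A X"
  then obtain f g where f: "arr C f A X" "arr C g X A" "g \<cdot> f = ident C A" "f \<cdot> g = ident C X"
    unfolding isomorphic_iff by blast
  obtain N where N: "is_zero_object C N" using ex_zero_object by blast
  have "biproduct C A N A (ident C A) \<zero>\<^bsub>Hom C N A\<^esub> (ident C A) \<zero>\<^bsub>Hom C A N\<^esub>"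
    using biproduct_zero_right[OF N] f by simp
  from biproduct_iso[OF this f] show "dsum [A] X" by (rule dsum_ConsI) (simp add: N)
qed

lemma direct_sum_pair: "direct_sum C [A, B] X \<longleftrightarrow> (\<exists>i j p q. biproduct C A B X i j p q)"
proof -
  have "dsum [A, B] X \<longleftrightarrow> (\<exists>S i j p q. biproduct C A S X i j p q \<and> isomorphic C B S)"
    unfolding dsum_single[symmetric] by (simp del: dsum.simps(1))
  also have "\<dots> \<longleftrightarrow> (\<exists>i j p q. biproduct C A B X i j p q)"
  proof
    assume "\<exists>S i j p q. biproduct C A S X i j p q \<and> isomorphic C B S"
    then obtain S i j p q f g where b: "biproduct C A S X i j p q" and f: "arr C f B S" "arr C g S B"
        "g \<cdot> f = ident C B" "f \<cdot> g = ident C S"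
      unfolding isomorphic_iff by blast
    show "\<exists>i j p q. biproduct C A B X i j p q" using biproduct_iso_right[OF b f(2,1,4,3)] by blast
  next
    assume "\<exists>i j p q. biproduct C A B X i j p q"
    then show "\<exists>S i j p q. biproduct C A S X i j p q \<and> isomorphic C B S"
      using isomorphic_refl unfolding biproduct_def by blast
  qed
  finally show ?thesis unfolding direct_sum_iff_dsum .
qed

lemma dsum_iso: "dsum As X \<Longrightarrow> isomorphic C X Y \<Longrightarrow> dsum As Y"
proof (cases As)
  case Nil
  assume a: "dsum As X" "isomorphic C X Y"
  then obtain f g where f: "arr C f X Y" "arr C g Y X" "f \<cdot> g = ident C Y"
    unfolding isomorphic_iff by blast
  then have "g = \<zero>\<^bsub>Hom C Y X\<^esub>" using arr_to_zero_ob[of X g Y] a(1) Nil by simp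
  then show ?thesis using f Nil by (simp add: zero_obI)
next
  case (Cons A As')
  assume a: "dsum As X" "isomorphic C X Y"
  then obtain f g where f: "arr C f X Y" "arr C g Y X" "g \<cdot> f = ident C X" "f \<cdot> g = ident C Y"
    unfolding isomorphic_iff by blast
  obtain S i j p q where b: "biproduct C A S X i j p q" "dsum As' S" using a(1) Cons by auto
  show ?thesis using dsum_ConsI[OF biproduct_iso[OF b(1) f] b(2)] Cons by simp
qed

lemma dsum_component_iso: "list_all2 (isomorphic C) As Bs \<Longrightarrow> dsum As X \<Longrightarrow> dsum Bs X"
proof (induction As Bs arbitrary: X rule: list_all2_induct)
  case (Cons A As B Bs)
  then obtain S i j p q f g where b: "biproduct C A S X i j p q" "dsum As S"
      and f: "arr C f A B" "arr C g B A" "g \<cdot> f = ident C A" "f \<cdot> g = ident C B"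
    unfolding isomorphic_iff dsum.simps by blast
  show ?case
    by (rule dsum_ConsI[OF biproduct_swap[OF biproduct_iso_right[OF biproduct_swap[OF b(1)] f]] Cons.IH[OF b(2)]])
qed simp

lemma dsum_append: "dsum As X \<Longrightarrow> dsum Bs Y \<Longrightarrow> biproduct C X Y Z i j p q \<Longrightarrow> dsum (As @ Bs) Z"
proof (induction As arbitrary: X Z i j p q)
  case Nil
  then have "isomorphic C Y Z" using biproduct_zero_isomorphic[OF biproduct_swap] by simp
  then show ?case using dsum_iso Nil by simp
next
  case (Cons A As)
  then obtain S i' j' p' q' where b: "biproduct C A S X i' j' p' q'" "dsum As S" by auto
  then obtain W k l m n where w: "biproduct C S Y W k l m n"
    using ex_biproduct[of S Y] biproduct_simps(14)[OF b(1)] biproduct_simps(14)[OF Cons.prems(3)] by blast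
  show ?case using dsum_ConsI[OF biproduct_assoc[OF b(1) Cons.prems(3) w] Cons.IH[OF b(2) Cons.prems(2) w]] by simp
qed

text \<open>A component found in the tail is brought to the front by reassociating, with the head
  moved into the complement.\<close>

lemma dsum_summand:
  assumes "dsum As X" "A \<in> set As"
  shows "\<exists>S i j p q. biproduct C A S X i j p q"
  using assms
proof (induction As arbitrary: X)
  case (Cons B As)
  then obtain S i j p q where b: "biproduct C B S X i j p q" "dsum As S" by auto
  show ?case
  proof (cases "A = B")
    case False
    then obtain S' i' j' p' q' where b': "biproduct C A S' S i' j' p' q'"
      using Cons.IH[OF b(2)] Cons.prems(2) by auto
    obtain W k l m n where w: "biproduct C S' B W k l m n"
      using ex_biproduct[of S' B] biproduct_simps(14)[OF b'] biproduct_simps(13)[OF b(1)] by blast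
    show ?thesis using biproduct_assoc[OF b' biproduct_swap[OF b(1)] w] by blast
  qed (use b in blast)
qed simp

end

section \<open>Objects with local endomorphism rings\<close>

context linear_category
begin

text \<open>Locality of the endomorphism ring in contraposed form: an invertible sum has an
  invertible summand. Units are expressed as isomorphisms, so the notion is visibly
  self-dual.\<close>

definition local_ob :: "'o \<Rightarrow> bool" where
  "local_ob A \<longleftrightarrow> A \<in> Ob C \<and> ident C A \<noteq> \<zero>\<^bsub>Hom C A A\<^esub> \<and>
     (\<forall>f g. arr C f A A \<longrightarrow> arr C g A A \<longrightarrow> iso_mor C A A (f \<oplus>\<^bsub>Hom C A A\<^esub> g) \<longrightarrow> iso_mor C A A f \<or> iso_mor C A A g)"

lemma local_ob_Ob: "local_ob A \<Longrightarrow> A \<in> Ob C"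
  by (simp add: local_ob_def)

lemma local_ring_local_ob:
  assumes "local_ring (End_ring C A)" "A \<in> Ob C"
  shows "local_ob A"
proof -
  have "f \<in> Units (End_ring C A) \<longleftrightarrow> iso_mor C A A f" for f
    unfolding Units_def End_ring_def iso_mor_def by auto
  moreover have "carrier (End_ring C A) = carrier (Hom C A A)" "\<one>\<^bsub>End_ring C A\<^esub> = ident C A"
    "\<zero>\<^bsub>End_ring C A\<^esub> = \<zero>\<^bsub>Hom C A A\<^esub>" "\<And>f g. f \<oplus>\<^bsub>End_ring C A\<^esub> g = f \<oplus>\<^bsub>Hom C A A\<^esub> g"
    by (simp_all add: End_ring_def)
  ultimately show ?thesis
    using assms unfolding local_ring_def local_ob_def arr_def by (metis DiffI)
qed

lemma iso_morE:
  assumes "iso_mor C X Y f" "X \<in> Ob C" "Y \<in> Ob C"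
  obtains g where "arr C f X Y" "arr C g Y X" "g \<cdot> f = ident C X" "f \<cdot> g = ident C Y"
  using assms iso_mor_iff by blast

lemma iso_morI:
  assumes "arr C f X Y" "arr C g Y X" "g \<cdot> f = ident C X" "f \<cdot> g = ident C Y"
  shows "iso_mor C X Y f"
  using assms iso_mor_iff by blast

lemma iso_mor_ident: "X \<in> Ob C \<Longrightarrow> iso_mor C X X (ident C X)"
  by (rule iso_morI[of _ _ _ "ident C X"]) auto

lemma iso_mor_inv_cmp:
  assumes "iso_mor C X X (g \<cdot> f)" "arr C f X Y" "arr C g Y X"
  shows "section_mor C X Y f" "retraction_mor C Y X g"
proof -
  have "X \<in> Ob C" using assms(2) by simp
  then obtain u where u: "arr C u X X" "u \<cdot> (g \<cdot> f) = ident C X" "(g \<cdot> f) \<cdot> u = ident C X"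
    using iso_morE[OF assms(1)] by metis
  have "(u \<cdot> g) \<cdot> f = ident C X" "g \<cdot> (f \<cdot> u) = ident C X" using u assms by simp_all
  then show "section_mor C X Y f" "retraction_mor C Y X g"
    using section_mor_iff[of X Y f] retraction_mor_iff[of Y X g] u(1) assms by (auto intro: ar_cmp)
qed

text \<open>One of \<open>e\<close> and 1 - e is invertible. The first case forces e = 1; in the
  second, e(1 - e) = 0 forces e = 0.\<close>

lemma idempotent_local:
  assumes A: "local_ob A" and e: "arr C e A A" "e \<cdot> e = e" and ne: "e \<noteq> \<zero>\<^bsub>Hom C A A\<^esub>"
  shows "e = ident C A"
proof -
  let ?d = "ident C A \<oplus>\<^bsub>Hom C A A\<^esub> (\<ominus>\<^bsub>Hom C A A\<^esub> e)"
  have O: "A \<in> Ob C" using A by (rule local_ob_Ob)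
  have d: "arr C ?d A A" "e \<oplus>\<^bsub>Hom C A A\<^esub> ?d = ident C A" using e O diff_add[of "ident C A" A A e] by auto
  then consider "iso_mor C A A e" | "iso_mor C A A ?d"
    using A e(1) iso_mor_ident[OF O] unfolding local_ob_def by metis
  then show ?thesis
  proof cases
    case 1
    then obtain u where u: "arr C u A A" "u \<cdot> e = ident C A" using iso_morE O by metis
    have "e = (u \<cdot> e) \<cdot> e" using u e by simp
    also have "\<dots> = u \<cdot> (e \<cdot> e)" using u(1) e(1) by simp
    also have "\<dots> = ident C A" using u e(2) by simp
    finally show ?thesis .
  next
    case 2
    then obtain u where u: "arr C u A A" "?d \<cdot> u = ident C A" using iso_morE O by metis
    have "e = e \<cdot> (?d \<cdot> u)" using u(2) e by simp
    also have "\<dots> = (e \<cdot> ?d) \<cdot> u" using u(1) e(1) d(1) by (simp del: cmp_add_left cmp_add_right)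
    also have "e \<cdot> ?d = \<zero>\<^bsub>Hom C A A\<^esub>" using e O by simp
    finally show ?thesis using ne u(1) by simp
  qed
qed

text \<open>The composite \<open>s \<cdot> r\<close> is an idempotent of a local object, and it is
  nonzero because \<open>r\<close> and \<open>s\<close> recover the identity of \<open>B\<close>
  from it.\<close>

lemma local_retraction_iso:
  assumes A: "local_ob A" and B: "ident C B \<noteq> \<zero>\<^bsub>Hom C B B\<^esub>"
    and r: "arr C r A B" "arr C s B A" "r \<cdot> s = ident C B"
  shows "s \<cdot> r = ident C A"
proof (rule idempotent_local[OF A])
  show "arr C (s \<cdot> r) A A" "(s \<cdot> r) \<cdot> (s \<cdot> r) = s \<cdot> r" using r by (simp_all add: cancel_left[OF r(3)])
  show "s \<cdot> r \<noteq> \<zero>\<^bsub>Hom C A A\<^esub>"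
  proof
    assume "s \<cdot> r = \<zero>\<^bsub>Hom C A A\<^esub>"
    then have "r \<cdot> (s \<cdot> r) \<cdot> s = \<zero>\<^bsub>Hom C B B\<^esub>" using r by simp
    moreover have "r \<cdot> (s \<cdot> r) \<cdot> s = ident C B" using r by (simp add: cancel_left[OF r(3)])
    ultimately show False using B by simp
  qed
qed

lemma local_retraction_isomorphic:
  assumes "local_ob A" "ident C B \<noteq> \<zero>\<^bsub>Hom C B B\<^esub>" "retraction_mor C A B r" "B \<in> Ob C"
  shows "isomorphic C A B"
  using local_retraction_iso[OF assms(1,2), of r] assms(3,4) retraction_mor_iff[of A B r] local_ob_Ob[OF assms(1)]
  unfolding isomorphic_iff by metis

lemma local_section_isomorphic:
  assumes "local_ob A" "ident C B \<noteq> \<zero>\<^bsub>Hom C B B\<^esub>" "section_mor C B A s" "B \<in> Ob C"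
  shows "isomorphic C A B"
  using local_retraction_iso[OF assms(1,2)] assms(3,4) section_mor_iff[of B A s] local_ob_Ob[OF assms(1)]
  unfolding isomorphic_iff by metis

text \<open>Composing with a section of the sum gives two endomorphisms of A that add up to the
  identity. Hence nonretractions into a local object are closed under addition.\<close>

lemma local_retraction_add:
  assumes A: "local_ob A" and f: "arr C f X A" and g: "arr C g X A"
    and r: "retraction_mor C X A (f \<oplus>\<^bsub>Hom C X A\<^esub> g)"
  shows "retraction_mor C X A f \<or> retraction_mor C X A g"
proof -
  have O: "X \<in> Ob C" "A \<in> Ob C" using f by auto
  then obtain s where s: "arr C s A X" "(f \<oplus>\<^bsub>Hom C X A\<^esub> g) \<cdot> s = ident C A"
    using r retraction_mor_iff by blast
  then have "f \<cdot> s \<oplus>\<^bsub>Hom C A A\<^esub> g \<cdot> s = ident C A" using f g by simp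
  then have "iso_mor C A A (f \<cdot> s \<oplus>\<^bsub>Hom C A A\<^esub> g \<cdot> s)" using iso_mor_ident[OF O(2)] by simp
  moreover have "arr C (f \<cdot> s) A A" "arr C (g \<cdot> s) A A" using f g s by auto
  ultimately have "iso_mor C A A (f \<cdot> s) \<or> iso_mor C A A (g \<cdot> s)" using A unfolding local_ob_def by blast
  then show ?thesis using iso_mor_inv_cmp(2) s(1) f g by blast
qed

lemma retraction_cmp_right:
  assumes "arr C f X Y" "arr C g Y Z" "retraction_mor C X Z (g \<cdot> f)"
  shows "retraction_mor C Y Z g"
proof -
  obtain s where "arr C s Z X" "(g \<cdot> f) \<cdot> s = ident C Z" using assms retraction_mor_iff[of X Z "g \<cdot> f"] by auto
  then have "arr C (f \<cdot> s) Z Y" "g \<cdot> (f \<cdot> s) = ident C Z" using assms by auto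
  then show ?thesis using retraction_mor_iff[of Y Z g] assms(2) by blast
qed

text \<open>Since \<open>f\<close> is no retraction, \<open>f \<cdot> g\<close> is not invertible,
  and locality makes the complementary endomorphism invertible.\<close>

lemma local_radical:
  assumes A: "local_ob A" and f: "arr C f X A" "\<not> retraction_mor C X A f" and g: "arr C g A X"
  shows "iso_mor C A A (ident C A \<oplus>\<^bsub>Hom C A A\<^esub> (\<ominus>\<^bsub>Hom C A A\<^esub> (f \<cdot> g)))"
proof -
  have O: "A \<in> Ob C" using f by auto
  let ?d = "ident C A \<oplus>\<^bsub>Hom C A A\<^esub> (\<ominus>\<^bsub>Hom C A A\<^esub> (f \<cdot> g))"
  have d: "arr C ?d A A" "f \<cdot> g \<oplus>\<^bsub>Hom C A A\<^esub> ?d = ident C A"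
    using f g O diff_add[of "ident C A" A A "f \<cdot> g"] by auto
  moreover have "\<not> iso_mor C A A (f \<cdot> g)" using iso_mor_inv_cmp(2) f g by blast
  moreover have "arr C (f \<cdot> g) A A" using f g by simp
  ultimately show ?thesis using A iso_mor_ident[OF O] unfolding local_ob_def by metis
qed

text \<open>Conjugation with the isomorphism preserves sums and transports invertibility in both
  directions.\<close>

lemma local_ob_iso:
  assumes A: "local_ob A" and i: "isomorphic C A B"
  shows "local_ob B"
proof -
  obtain u v where u: "arr C u A B" "arr C v B A" "v \<cdot> u = ident C A" "u \<cdot> v = ident C B"
    using i unfolding isomorphic_iff by blast
  have O: "A \<in> Ob C" "B \<in> Ob C" using u by auto
  have conj: "iso_mor C A A (v \<cdot> (f \<cdot> u))" if f: "arr C f B B" "iso_mor C B B f" for f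
  proof -
    obtain g where g: "arr C g B B" "g \<cdot> f = ident C B" "f \<cdot> g = ident C B" using iso_morE f O by metis
    show ?thesis using f(1) g u O
      by (intro iso_morI[of _ _ _ "v \<cdot> (g \<cdot> u)"])
        (simp_all add: cancel_left[OF u(4)] cancel_left[OF g(2)] cancel_left[OF g(3)])
  qed
  have conj': "iso_mor C B B f" if f: "arr C f B B" "iso_mor C A A (v \<cdot> (f \<cdot> u))" for f
  proof -
    obtain g where g: "arr C g A A" "g \<cdot> (v \<cdot> (f \<cdot> u)) = ident C A" "(v \<cdot> (f \<cdot> u)) \<cdot> g = ident C A"
      using iso_morE f O by metis
    have "(u \<cdot> (g \<cdot> v)) \<cdot> f = (u \<cdot> (g \<cdot> (v \<cdot> (f \<cdot> u)))) \<cdot> v"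
      using f(1) g(1) u(1,2) O by (simp add: u(4))
    then have 1: "(u \<cdot> (g \<cdot> v)) \<cdot> f = ident C B" using u O unfolding g(2) by simp
    have "f \<cdot> (u \<cdot> (g \<cdot> v)) = u \<cdot> (((v \<cdot> (f \<cdot> u)) \<cdot> g) \<cdot> v)"
      using f(1) g(1) u(1,2) O by (simp add: cancel_left[OF u(4)])
    then have 2: "f \<cdot> (u \<cdot> (g \<cdot> v)) = ident C B" using u O unfolding g(3) by simp
    show ?thesis using f(1) g(1) u(1,2) by (intro iso_morI[OF _ _ 1 2]) auto
  qed
  have "ident C B \<noteq> \<zero>\<^bsub>Hom C B B\<^esub>"
  proof
    assume "ident C B = \<zero>\<^bsub>Hom C B B\<^esub>"
    then have "v \<cdot> (ident C B \<cdot> u) = \<zero>\<^bsub>Hom C A A\<^esub>" using u O by simp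
    then show False using A u unfolding local_ob_def by simp
  qed
  moreover have "iso_mor C B B f \<or> iso_mor C B B g"
    if f: "arr C f B B" "arr C g B B" and s: "iso_mor C B B (f \<oplus>\<^bsub>Hom C B B\<^esub> g)" for f g
  proof -
    have "iso_mor C A A (v \<cdot> (f \<cdot> u) \<oplus>\<^bsub>Hom C A A\<^esub> v \<cdot> (g \<cdot> u))" using conj[OF _ s] f u by simp
    moreover have "arr C (v \<cdot> (f \<cdot> u)) A A" "arr C (v \<cdot> (g \<cdot> u)) A A" using f u by auto
    ultimately have "iso_mor C A A (v \<cdot> (f \<cdot> u)) \<or> iso_mor C A A (v \<cdot> (g \<cdot> u))"
      using A unfolding local_ob_def by blast
    then show ?thesis using conj' f by blast
  qed
  ultimately show ?thesis using O unfolding local_ob_def by blast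
qed

lemma zero_ob_ident: "is_zero_object C X \<longleftrightarrow> X \<in> Ob C \<and> ident C X = \<zero>\<^bsub>Hom C X X\<^esub>"
  using zero_obI zero_ob_Ob arr_to_zero_ob[of X "ident C X" X] by auto

end

context additive_category
begin

text \<open>If both summands were nonzero, the projection to the first would have
  \<open>i \<cdot> p\<close> equal to the identity of A; then the identity of the second summand
  would factor through \<open>q \<cdot> i\<close>, which is zero.\<close>

lemma local_indecomposable:
  assumes A: "local_ob A"
  shows "indecomposable C A"
proof -
  have "is_zero_object C X \<or> is_zero_object C Y" if b: "biproduct C X Y A i j p q" for X Y i j p q
  proof (rule ccontr)
    assume "\<not> ?thesis"
    then have ne: "ident C X \<noteq> \<zero>\<^bsub>Hom C X X\<^esub>" "ident C Y \<noteq> \<zero>\<^bsub>Hom C Y Y\<^esub>"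
      using zero_obI biproduct_simps[OF b] by auto
    have "i \<cdot> p = ident C A"
      using local_retraction_iso[OF A ne(1), of p i] biproduct_simps[OF b] by simp
    then have "q \<cdot> ((i \<cdot> p) \<cdot> j) = ident C Y" using biproduct_simps[OF b] by simp
    moreover have "q \<cdot> ((i \<cdot> p) \<cdot> j) = \<zero>\<^bsub>Hom C Y Y\<^esub>" using biproduct_simps(1-19)[OF b] by simp
    ultimately show False using ne by simp
  qed
  then show ?thesis
    using A unfolding indecomposable_def direct_sum_pair local_ob_def zero_ob_ident by blast
qed

text \<open>In a decomposition into local objects, the complement of the first component must be
  zero.\<close>

lemma indecomposable_local:
  assumes ks: "krull_schmidt C" and X: "indecomposable C X"
  shows "local_ob X"
proof -
  have O: "X \<in> Ob C" and nz: "\<not> is_zero_object C X" using X by (auto simp: indecomposable_def)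
  obtain As where As: "dsum As X" "\<forall>A \<in> set As. local_ring (End_ring C A)"
    using ks O unfolding krull_schmidt_def direct_sum_iff_dsum by blast
  obtain A As' where AA: "As = A # As'" using As(1) nz by (cases As) auto
  obtain S i j p q where b: "biproduct C A S X i j p q" using As(1) unfolding AA by auto
  have A: "local_ob A" using As(2) AA local_ring_local_ob biproduct_simps(13)[OF b] by simp
  have "is_zero_object C S"
    using X b A unfolding indecomposable_def direct_sum_pair local_ob_def zero_ob_ident by blast
  then show ?thesis using local_ob_iso[OF A] biproduct_zero_isomorphic[OF b] by blast
qed

lemma ex_local_dsum:
  assumes "krull_schmidt C" "X \<in> Ob C"
  shows "\<exists>As. dsum As X \<and> (\<forall>A \<in> set As. local_ob A)"
  using assms local_ring_local_ob dsum_Ob unfolding krull_schmidt_def direct_sum_iff_dsum by blast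

lemma ind_dsum:
  assumes ks: "krull_schmidt C" and I: "ind_representatives C I" and X: "X \<in> Ob C"
  shows "\<exists>As. dsum As X \<and> set As \<subseteq> I"
proof -
  obtain As where As: "dsum As X" "\<forall>A \<in> set As. local_ob A" using ex_local_dsum[OF ks X] by blast
  have "\<forall>A \<in> set As. \<exists>B \<in> I. isomorphic C A B"
    using As(2) I local_indecomposable unfolding ind_representatives_def by blast
  then obtain f where f: "\<And>A. A \<in> set As \<Longrightarrow> f A \<in> I \<and> isomorphic C A (f A)" by metis
  then have "list_all2 (isomorphic C) As (map f As)" by (simp add: list_all2_conv_all_nth)
  then show ?thesis using dsum_component_iso As(1) f by (intro exI[of _ "map f As"]) auto
qed

lemma ind_isomorphic_eq:
  "ind_representatives C I \<Longrightarrow> A \<in> I \<Longrightarrow> B \<in> I \<Longrightarrow> isomorphic C A B \<Longrightarrow> A = B"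
  using isomorphic_refl[of A] unfolding ind_representatives_def isomorphic_def indecomposable_def by blast

end

section \<open>Extriangulated categories and duality\<close>

lemma opposite_sel [simp]:
  "Ob (opposite C) = Ob C" "Hom (opposite C) X Y = Hom C Y X" "g \<cdot>\<^bsub>opposite C\<^esub> f = f \<cdot>\<^bsub>C\<^esub> g"
  "ident (opposite C) = ident C" "Ext (opposite C) Z X = Ext C X Z" "push (opposite C) = pull C"
  "pull (opposite C) = push C" "(x, Y, y) \<in> realiz (opposite C) Z X \<delta> \<longleftrightarrow> (y, Y, x) \<in> realiz C X Z \<delta>"
  by (simp_all add: opposite_def)

lemma opposite_opposite [simp]: "opposite (opposite C) = C"
  by (cases C) (simp add: opposite_def)

lemma opposite_notions [simp]:
  "arr (opposite C) f X Y \<longleftrightarrow> arr C f Y X"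
  "is_zero_object (opposite C) N \<longleftrightarrow> is_zero_object C N"
  "biproduct (opposite C) X Y B i j p q \<longleftrightarrow> biproduct C X Y B p q i j"
  "iso_mor (opposite C) X Y f \<longleftrightarrow> iso_mor C Y X f"
  "section_mor (opposite C) X Y f \<longleftrightarrow> retraction_mor C Y X f"
  "retraction_mor (opposite C) X Y f \<longleftrightarrow> section_mor C Y X f"
  "realized_by (opposite C) \<delta> X x Y y Z \<longleftrightarrow> realized_by C \<delta> Z y Y x X"
  "(x, Y, y) \<in> sequences (opposite C) X Z \<longleftrightarrow> (y, Y, x) \<in> sequences C Z X"
  by (auto simp: arr_def is_zero_object_def biproduct_def iso_mor_def section_mor_def retraction_mor_def
      realized_by_def sequences_def)

context extriangulated_category
begin

lemma seq_equiv_swap: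
  assumes "((x, Y, y), (x', Y', y')) \<in> seq_equiv C X Z" "X \<in> Ob C" "Z \<in> Ob C"
  shows "((y, Y, x), (y', Y', x')) \<in> seq_equiv (opposite C) Z X"
proof -
  have t: "arr C x X Y" "arr C y Y Z" "arr C x' X Y'" "arr C y' Y' Z"
    using assms unfolding seq_equiv_def sequences_def by auto
  obtain b where b: "iso_mor C Y Y' b" "b \<cdot> x = x'" "y' \<cdot> b = y" using assms unfolding seq_equiv_def by auto
  then obtain b' where b': "arr C b Y Y'" "arr C b' Y' Y" "b' \<cdot> b = ident C Y" "b \<cdot> b' = ident C Y'"
    using iso_morE t by (metis arr_iff)
  have "b' \<cdot> x' = x" "y \<cdot> b' = y'" using b b' t cancel_left[OF b'(3), of x] by auto
  moreover have "iso_mor C Y' Y b'" using iso_morI b' by blast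
  ultimately show ?thesis using t unfolding seq_equiv_def by (auto simp: sequences_def)
qed

end

text \<open>The axioms are self-dual or come in dual pairs. Instantiating a lemma at
  \<open>opposite C\<close> and unfolding therefore gives its dual, with inflations and deflations,
  and with \<open>push\<close> and \<open>pull\<close>, exchanged.\<close>

theorem (in extriangulated_category) opposite_extriangulated:
  "extriangulated_category K (opposite C)"
proof (intro extriangulated_category.intro additive_category.intro linear_category.intro
    additive_category_axioms.intro extriangulated_category_axioms.intro, unfold opposite_sel opposite_notions)
  show "X = X' \<and> Y = Y'" if "X \<in> Ob C" "Y \<in> Ob C" "X' \<in> Ob C" "Y' \<in> Ob C"
      "f \<in> carrier (Hom C Y X)" "f \<in> carrier (Hom C Y' X')" for X Y X' Y' f
    using Hom_disjoint[of Y X Y' X' f] that by auto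
  show "f \<cdot> (g \<cdot> h) = (f \<cdot> g) \<cdot> h" if "W \<in> Ob C" "X \<in> Ob C" "Y \<in> Ob C" "Z \<in> Ob C"
      "f \<in> carrier (Hom C X W)" "g \<in> carrier (Hom C Y X)" "h \<in> carrier (Hom C Z Y)" for W X Y Z f g h
    using that by simp
  show "\<exists>B i j p q. biproduct C X Y B p q i j" if "X \<in> Ob C" "Y \<in> Ob C" for X Y
    using ex_biproduct[of X Y] that by blast
  show "pull C f (push C h \<delta>) = push C h (pull C f \<delta>)"
    if "Z \<in> Ob C" "Z' \<in> Ob C" "X \<in> Ob C" "X' \<in> Ob C"
      "\<delta> \<in> carrier (Ext C X Z)" "f \<in> carrier (Hom C X' X)" "h \<in> carrier (Hom C Z Z')"
    for Z Z' X X' \<delta> f h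
    using that push_pull[of X X' Z Z' \<delta> h f] by simp
  show "realiz (opposite C) Z X \<delta> \<in> sequences (opposite C) X Z // seq_equiv (opposite C) X Z"
    if a: "Z \<in> Ob C" "X \<in> Ob C" "\<delta> \<in> carrier (Ext C X Z)" for Z X \<delta>
  proof -
    obtain s where s: "s \<in> sequences C Z X" "realiz C X Z \<delta> = seq_equiv C Z X `` {s}"
      using realiz_class[of X Z \<delta>] a unfolding quotient_def by auto
    obtain y Y x where syx: "s = (y, Y, x)" by (cases s) auto
    have "(a, B, b) \<in> realiz (opposite C) Z X \<delta> \<longleftrightarrow> ((x, Y, y), (a, B, b)) \<in> seq_equiv (opposite C) X Z" for a B b
    proof
      assume "(a, B, b) \<in> realiz (opposite C) Z X \<delta>"
      then have "((y, Y, x), (b, B, a)) \<in> seq_equiv C Z X" using s(2) syx by simp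
      then show "((x, Y, y), (a, B, b)) \<in> seq_equiv (opposite C) X Z" using seq_equiv_swap a by simp
    next
      \<comment> \<open>\<open>seq_equiv_swap\<close> is not yet available for
        \<open>opposite C\<close>, so the inverse isomorphism of middle terms is produced by
        hand.\<close>
      assume e: "((x, Y, y), (a, B, b)) \<in> seq_equiv (opposite C) X Z"
      then obtain f where t: "arr C y Z Y" "arr C x Y X" "arr C b Z B" "arr C a B X" and
        f: "iso_mor C B Y f" "x \<cdot> f = a" "f \<cdot> b = y"
        using a unfolding seq_equiv_def by (auto simp: sequences_def)
      then obtain g where g: "arr C f B Y" "arr C g Y B" "g \<cdot> f = ident C B" "f \<cdot> g = ident C Y"
        using iso_morE[OF f(1)] by auto
      have "g \<cdot> (f \<cdot> b) = b" using g(1,2) t cancel_left[OF g(3), of b] by simp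
      moreover have "(x \<cdot> f) \<cdot> g = x" using g t by simp
      ultimately have "g \<cdot> y = b" "a \<cdot> g = x" unfolding f(2,3) by simp_all
      moreover have "iso_mor C Y B g" using iso_morI g by blast
      ultimately have "((y, Y, x), (b, B, a)) \<in> seq_equiv C Z X"
        using t unfolding seq_equiv_def by (auto simp: sequences_def)
      then show "(a, B, b) \<in> realiz (opposite C) Z X \<delta>" using s(2) syx by simp
    qed
    then have "realiz (opposite C) Z X \<delta> = seq_equiv (opposite C) X Z `` {(x, Y, y)}" by auto
    moreover have "(x, Y, y) \<in> sequences (opposite C) X Z" using s(1) syx by simp
    ultimately show ?thesis unfolding quotient_def by blast
  qed
  show "\<exists>g \<in> carrier (Hom C Y' Y). x \<cdot> g = f \<cdot> x' \<and> y \<cdot> h = g \<cdot> y'"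
    if "realized_by C \<delta> Z y Y x X" "realized_by C \<delta>' Z' y' Y' x' X'"
      "f \<in> carrier (Hom C X' X)" "h \<in> carrier (Hom C Z' Z)"
      "pull C f \<delta> = push C h \<delta>'" for \<delta> X x Y y Z \<delta>' X' x' Y' y' Z' f h
    using realiz_morphism[of \<delta>' Z' y' Y' x' X' \<delta> Z y Y x X h f] that by metis
  show "realized_by C \<zero>\<^bsub>Ext C X Z\<^esub> Z q B i X"
    if "biproduct C X Z B p q i j" for X Z B i j p q
    using that realiz_zero[OF biproduct_swap, of X Z] by simp
  show "realized_by C (pull C i\<^sub>A (push C p\<^sub>D \<delta>) \<oplus>\<^bsub>Ext C A D\<^esub> pull C j\<^sub>A (push C q\<^sub>D \<delta>'))
      D (p\<^sub>B \<cdot> (y \<cdot> i\<^sub>D) \<oplus>\<^bsub>Hom C D B\<^esub> q\<^sub>B \<cdot> (y' \<cdot> j\<^sub>D))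
      B (p\<^sub>A \<cdot> (x \<cdot> i\<^sub>B) \<oplus>\<^bsub>Hom C B A\<^esub> q\<^sub>A \<cdot> (x' \<cdot> j\<^sub>B)) A"
    if r: "realized_by C \<delta> Z y Y x X" "realized_by C \<delta>' Z' y' Y' x' X'"
      and b: "biproduct C X X' A p\<^sub>A q\<^sub>A i\<^sub>A j\<^sub>A" "biproduct C Y Y' B p\<^sub>B q\<^sub>B i\<^sub>B j\<^sub>B"
      "biproduct C Z Z' D p\<^sub>D q\<^sub>D i\<^sub>D j\<^sub>D"
    for \<delta> X x Y y Z \<delta>' X' x' Y' y' Z' A i\<^sub>A j\<^sub>A p\<^sub>A q\<^sub>A B i\<^sub>B j\<^sub>B p\<^sub>B q\<^sub>B D i\<^sub>D j\<^sub>D p\<^sub>D q\<^sub>D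
  proof -
    note s = biproduct_simps(1-15)[OF b(1)] biproduct_simps(1-15)[OF b(2)] biproduct_simps(1-15)[OF b(3)]
    have d: "\<delta> \<in> carrier (Ext C X Z)" "\<delta>' \<in> carrier (Ext C X' Z')" using r by (auto simp: realized_by_def)
    have "x \<in> carrier (Hom C Y X)" "y \<in> carrier (Hom C Z Y)" "x' \<in> carrier (Hom C Y' X')" "y' \<in> carrier (Hom C Z' Y')"
      using realiz_class[of X Z \<delta>] realiz_class[of X' Z' \<delta>'] r unfolding quotient_def realized_by_def
      by (auto simp: seq_equiv_def sequences_def)
    then have t: "arr C x Y X" "arr C y Z Y" "arr C x' Y' X'" "arr C y' Z' Y'" using s by simp_all
    have "push C p\<^sub>D (pull C i\<^sub>A \<delta>) = pull C i\<^sub>A (push C p\<^sub>D \<delta>)" "push C q\<^sub>D (pull C j\<^sub>A \<delta>') = pull C j\<^sub>A (push C q\<^sub>D \<delta>')"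
      using push_pull[of X A Z D \<delta> p\<^sub>D i\<^sub>A] push_pull[of X' A Z' D \<delta>' q\<^sub>D j\<^sub>A] d s by simp_all
    then show ?thesis using realiz_sum[OF r b(3,2,1)] t s by simp
  qed
  show "ET3 (opposite (opposite C))" "ET4 (opposite (opposite C))" using ET3 ET4 by simp_all
qed (rule base_field Hom_vectorspace ident_closed cmp_linear_left cmp_linear_right ident_left ident_right
  ex_zero_object Ext_vectorspace push_linear push_linear_mor pull_linear pull_linear_mor push_ident pull_ident
  push_cmp pull_cmp ET3_op ET4_op; assumption)+

text \<open>The counterpart of \<open>arr\<close> for extensions. As in \<open>Ext\<close>, the end
  term comes before the starting term, the reverse of the order in
  \<open>realized_by\<close>.\<close>

definition extn :: "('k, 'o, 'm, 'e) extricat \<Rightarrow> 'e \<Rightarrow> 'o \<Rightarrow> 'o \<Rightarrow> bool" where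
  "extn C \<delta> Z X \<longleftrightarrow> Z \<in> Ob C \<and> X \<in> Ob C \<and> \<delta> \<in> carrier (Ext C Z X)"

lemma opposite_extn [simp]: "extn (opposite C) \<delta> Z X \<longleftrightarrow> extn C \<delta> X Z"
  by (auto simp: extn_def)

lemmas opposite_unfold = opposite_sel opposite_notions opposite_extn

context extriangulated_category
begin

lemma extn_zero: "Z \<in> Ob C \<Longrightarrow> X \<in> Ob C \<Longrightarrow> extn C \<zero>\<^bsub>Ext C Z X\<^esub> Z X"
proof -
  assume "Z \<in> Ob C" "X \<in> Ob C"
  then interpret vectorspace K "Ext C Z X" by (rule Ext_vectorspace)
  show ?thesis using \<open>Z \<in> Ob C\<close> \<open>X \<in> Ob C\<close> by (simp add: extn_def)
qed

lemma linear_push: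
  assumes "Z \<in> Ob C" "arr C f X X'"
  shows "linear_map K (Ext C Z X) (Ext C Z X') (push C f)"
  using assms by (intro linear_mapI Ext_vectorspace push_linear) auto

lemma linear_push_mor:
  assumes "extn C \<delta> Z X" "X' \<in> Ob C"
  shows "linear_map K (Hom C X X') (Ext C Z X') (\<lambda>f. push C f \<delta>)"
  using assms unfolding extn_def by (intro linear_mapI Ext_vectorspace Hom_vectorspace push_linear_mor) auto

lemma push_extn: "extn C \<delta> Z X \<Longrightarrow> arr C f X X' \<Longrightarrow> extn C (push C f \<delta>) Z X'"
  using push_linear[of Z X X' f] unfolding extn_def arr_def module_hom_def by blast

lemma push_id: "extn C \<delta> Z X \<Longrightarrow> push C (ident C X) \<delta> = \<delta>"
  unfolding extn_def using push_ident by blast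

lemma push_comp: "extn C \<delta> Z X \<Longrightarrow> arr C f X X' \<Longrightarrow> arr C g X' X'' \<Longrightarrow> push C (g \<cdot> f) \<delta> = push C g (push C f \<delta>)"
  unfolding extn_def arr_def using push_cmp by blast

lemma push_zero: "Z \<in> Ob C \<Longrightarrow> arr C f X X' \<Longrightarrow> push C f \<zero>\<^bsub>Ext C Z X\<^esub> = \<zero>\<^bsub>Ext C Z X'\<^esub>"
  using linear_map.T0_is_0[OF linear_push] .

lemma push_zero_mor: "extn C \<delta> Z X \<Longrightarrow> X' \<in> Ob C \<Longrightarrow> push C \<zero>\<^bsub>Hom C X X'\<^esub> \<delta> = \<zero>\<^bsub>Ext C Z X'\<^esub>"
  using linear_map.T0_is_0[OF linear_push_mor] .

lemma push_add:
  assumes "extn C \<delta> Z X" "extn C \<delta>' Z X" "arr C f X X'"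
  shows "push C f (\<delta> \<oplus>\<^bsub>Ext C Z X\<^esub> \<delta>') = push C f \<delta> \<oplus>\<^bsub>Ext C Z X'\<^esub> push C f \<delta>'"
  using module_hom_add[OF push_linear[of Z X X' f]] assms unfolding extn_def arr_def by blast

lemma push_diff_zero:
  assumes e: "extn C \<delta> Z X" and f: "arr C f X X'" "arr C g X X'" and eq: "push C f \<delta> = push C g \<delta>"
  shows "push C (f \<oplus>\<^bsub>Hom C X X'\<^esub> (\<ominus>\<^bsub>Hom C X X'\<^esub> g)) \<delta> = \<zero>\<^bsub>Ext C Z X'\<^esub>"
proof -
  have O: "X \<in> Ob C" "X' \<in> Ob C" "Z \<in> Ob C" using f e by (auto simp: extn_def)
  interpret linear_map K "Hom C X X'" "Ext C Z X'" "\<lambda>f. push C f \<delta>" using linear_push_mor[OF e O(2)] .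
  show ?thesis using f eq T_minus[of f g] O push_extn[OF e f(2)] by (auto simp: a_minus_def extn_def W.module.M.r_neg)
qed

lemma extn_add: "extn C \<delta> Z X \<Longrightarrow> extn C \<delta>' Z X \<Longrightarrow> extn C (\<delta> \<oplus>\<^bsub>Ext C Z X\<^esub> \<delta>') Z X"
proof -
  assume a: "extn C \<delta> Z X" "extn C \<delta>' Z X"
  then interpret vectorspace K "Ext C Z X" unfolding extn_def by (intro Ext_vectorspace) auto
  show ?thesis using a by (simp add: extn_def)
qed

lemma extn_add_zero:
  assumes "extn C \<delta> Z X"
  shows "\<delta> \<oplus>\<^bsub>Ext C Z X\<^esub> \<zero>\<^bsub>Ext C Z X\<^esub> = \<delta>" "\<zero>\<^bsub>Ext C Z X\<^esub> \<oplus>\<^bsub>Ext C Z X\<^esub> \<delta> = \<delta>"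
proof -
  interpret vectorspace K "Ext C Z X" using assms unfolding extn_def by (intro Ext_vectorspace) auto
  show "\<delta> \<oplus>\<^bsub>Ext C Z X\<^esub> \<zero>\<^bsub>Ext C Z X\<^esub> = \<delta>" "\<zero>\<^bsub>Ext C Z X\<^esub> \<oplus>\<^bsub>Ext C Z X\<^esub> \<delta> = \<delta>"
    using assms by (auto simp: extn_def)
qed

lemma push_pull_comm:
  "extn C \<delta> Z X \<Longrightarrow> arr C f X X' \<Longrightarrow> arr C h Z' Z \<Longrightarrow> push C f (pull C h \<delta>) = pull C h (push C f \<delta>)"
  unfolding extn_def arr_def using push_pull by blast

lemmas linear_pull = extriangulated_category.linear_push[OF opposite_extriangulated, unfolded opposite_unfold]
lemmas linear_pull_mor = extriangulated_category.linear_push_mor[OF opposite_extriangulated, unfolded opposite_unfold]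
lemmas pull_extn = extriangulated_category.push_extn[OF opposite_extriangulated, unfolded opposite_unfold]
lemmas pull_id = extriangulated_category.push_id[OF opposite_extriangulated, unfolded opposite_unfold]
lemmas pull_comp = extriangulated_category.push_comp[OF opposite_extriangulated, unfolded opposite_unfold]
lemmas pull_zero = extriangulated_category.push_zero[OF opposite_extriangulated, unfolded opposite_unfold]
lemmas pull_zero_mor = extriangulated_category.push_zero_mor[OF opposite_extriangulated, unfolded opposite_unfold]
lemmas pull_diff_zero = extriangulated_category.push_diff_zero[OF opposite_extriangulated, unfolded opposite_unfold]

lemma realized_typed:
  assumes "realized_by C \<delta> X x Y y Z"
  shows "arr C x X Y" "arr C y Y Z" "extn C \<delta> Z X"
proof -
  have r: "X \<in> Ob C" "Z \<in> Ob C" "\<delta> \<in> carrier (Ext C Z X)" "(x, Y, y) \<in> realiz C Z X \<delta>"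
    using assms by (auto simp: realized_by_def)
  then have "(x, Y, y) \<in> sequences C X Z"
    using realiz_class[of Z X \<delta>] unfolding quotient_def by (auto simp: seq_equiv_def)
  then show "arr C x X Y" "arr C y Y Z" "extn C \<delta> Z X" using r by (auto simp: sequences_def extn_def)
qed

lemma ex_realization: "extn C \<delta> Z X \<Longrightarrow> \<exists>x Y y. realized_by C \<delta> X x Y y Z"
proof -
  assume e: "extn C \<delta> Z X"
  then obtain s where s: "s \<in> sequences C X Z" "realiz C Z X \<delta> = seq_equiv C X Z `` {s}"
    using realiz_class[of Z X \<delta>] unfolding extn_def quotient_def by blast
  obtain x Y y where [simp]: "s = (x, Y, y)" by (cases s) auto
  have "Y \<in> Ob C" "arr C x X Y" "arr C y Y Z" using s(1) e by (auto simp: sequences_def extn_def)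
  then have "((x, Y, y), (x, Y, y)) \<in> seq_equiv C X Z"
    using s(1) iso_mor_ident[of Y] unfolding seq_equiv_def by (auto intro!: exI[of _ "ident C Y"])
  then have "(x, Y, y) \<in> realiz C Z X \<delta>" using s(2) by simp
  then show ?thesis using e unfolding realized_by_def extn_def by blast
qed

lemma realized_unique:
  assumes "realized_by C \<delta> X x Y y Z" "realized_by C \<delta> X x' Y' y' Z"
  shows "\<exists>b c. arr C b Y Y' \<and> arr C c Y' Y \<and> c \<cdot> b = ident C Y \<and> b \<cdot> c = ident C Y' \<and> b \<cdot> x = x' \<and> y' \<cdot> b = y"
proof -
  obtain s where s: "s \<in> sequences C X Z" "realiz C Z X \<delta> = seq_equiv C X Z `` {s}"
    using realiz_class[of Z X \<delta>] assms(1) unfolding realized_by_def quotient_def by blast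
  obtain x0 Y0 y0 where [simp]: "s = (x0, Y0, y0)" by (cases s) auto
  have O: "Y0 \<in> Ob C" "Y \<in> Ob C" "Y' \<in> Ob C" "X \<in> Ob C" "Z \<in> Ob C"
    using s(1) realized_typed[OF assms(1)] realized_typed[OF assms(2)] by (auto simp: sequences_def)
  have t: "arr C x0 X Y0" "arr C y0 Y0 Z" using s(1) O by (auto simp: sequences_def)
  obtain b1 where b1: "iso_mor C Y0 Y b1" "b1 \<cdot> x0 = x" "y \<cdot> b1 = y0"
    using assms(1) s(2) unfolding realized_by_def seq_equiv_def by auto
  obtain b2 where b2: "iso_mor C Y0 Y' b2" "b2 \<cdot> x0 = x'" "y' \<cdot> b2 = y0"
    using assms(2) s(2) unfolding realized_by_def seq_equiv_def by auto
  obtain c1 where c1: "arr C b1 Y0 Y" "arr C c1 Y Y0" "c1 \<cdot> b1 = ident C Y0" "b1 \<cdot> c1 = ident C Y"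
    using iso_morE[OF b1(1) O(1,2)] by blast
  obtain c2 where c2: "arr C b2 Y0 Y'" "arr C c2 Y' Y0" "c2 \<cdot> b2 = ident C Y0" "b2 \<cdot> c2 = ident C Y'"
    using iso_morE[OF b2(1) O(1,3)] by blast
  note ty = c1(1,2) c2(1,2) t realized_typed[OF assms(1)] realized_typed[OF assms(2)]
  have "(b2 \<cdot> c1) \<cdot> (b1 \<cdot> c2) = ident C Y'" "(b1 \<cdot> c2) \<cdot> (b2 \<cdot> c1) = ident C Y"
    using ty c1 c2 by (simp_all add: cancel_left[OF c1(3)] cancel_left[OF c2(3)])
  moreover have "(b2 \<cdot> c1) \<cdot> x = x'" using ty b2(2) unfolding b1(2)[symmetric] by (simp add: cancel_left[OF c1(3)])
  moreover have "y' \<cdot> (b2 \<cdot> c1) = y"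
  proof -
    have "y' \<cdot> (b2 \<cdot> c1) = (y' \<cdot> b2) \<cdot> c1" using ty by simp
    also have "\<dots> = y \<cdot> (b1 \<cdot> c1)" unfolding b2(3) b1(3)[symmetric] using ty by simp
    finally show ?thesis using c1 ty by simp
  qed
  moreover have "arr C (b2 \<cdot> c1) Y Y'" "arr C (b1 \<cdot> c2) Y' Y" using ty by auto
  ultimately show ?thesis by blast
qed

lemma realized_isomorphic:
  "realized_by C \<delta> X x Y y Z \<Longrightarrow> realized_by C \<delta> X x' Y' y' Z \<Longrightarrow> isomorphic C Y Y'"
  using realized_unique unfolding isomorphic_iff by blast

lemma ET3_obtain:
  assumes "realized_by C \<delta> X x Y y Z" "realized_by C \<delta>' X' x' Y' y' Z'" "arr C f X X'" "arr C g Y Y'"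
    "g \<cdot> x = x' \<cdot> f"
  obtains h where "arr C h Z Z'" "push C f \<delta> = pull C h \<delta>'" "h \<cdot> y = y' \<cdot> g"
proof -
  have O: "Z \<in> Ob C" "Z' \<in> Ob C" using assms realized_by_def by metis+
  have "f \<in> carrier (Hom C X X')" "g \<in> carrier (Hom C Y Y')" using assms(3,4) unfolding arr_def by blast+
  then obtain h where "h \<in> carrier (Hom C Z Z')" "push C f \<delta> = pull C h \<delta>'" "h \<cdot> y = y' \<cdot> g"
    using ET3 assms unfolding ET3_def by blast
  then show ?thesis using that O by simp
qed

lemmas ET3_op_obtain = extriangulated_category.ET3_obtain[OF opposite_extriangulated, unfolded opposite_unfold]

lemma realized_morphism_obtain:
  assumes "realized_by C \<delta> X x Y y Z" "realized_by C \<delta>' X' x' Y' y' Z'" "arr C f X X'" "arr C h Z Z'"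
    "push C f \<delta> = pull C h \<delta>'"
  obtains g where "arr C g Y Y'" "g \<cdot> x = x' \<cdot> f" "h \<cdot> y = y' \<cdot> g"
proof -
  have "f \<in> carrier (Hom C X X')" "h \<in> carrier (Hom C Z Z')" using assms(3,4) unfolding arr_def by blast+
  then obtain g where "g \<in> carrier (Hom C Y Y')" "g \<cdot> x = x' \<cdot> f" "h \<cdot> y = y' \<cdot> g"
    using realiz_morphism[OF assms(1,2) _ _ assms(5)] by blast
  moreover have "Y \<in> Ob C" "Y' \<in> Ob C" using realized_typed[OF assms(1)] realized_typed[OF assms(2)] by auto
  ultimately show ?thesis using that by simp
qed

section \<open>Exactness properties of conflations\<close>

lemma realized_id_left:
  assumes "is_zero_object C N" "Y \<in> Ob C"
  shows "realized_by C \<zero>\<^bsub>Ext C N Y\<^esub> Y (ident C Y) Y \<zero>\<^bsub>Hom C Y N\<^esub> N"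
  using realiz_zero[OF biproduct_zero_right[OF assms]] .

lemma realized_id_right:
  assumes "is_zero_object C N" "Y \<in> Ob C"
  shows "realized_by C \<zero>\<^bsub>Ext C Y N\<^esub> N \<zero>\<^bsub>Hom C N Y\<^esub> Y (ident C Y) Y"
  using realiz_zero[OF biproduct_swap[OF biproduct_zero_right[OF assms]]] .

text \<open>(ET3) for \<open>x\<close> and the identity of Y, with the trivial conflation Y
  \<rightarrow> Y \<rightarrow> 0 as target, exhibits the pushforward as a restriction of the zero
  extension.\<close>

lemma push_inflation:
  assumes r: "realized_by C \<delta> X x Y y Z"
  shows "push C x \<delta> = \<zero>\<^bsub>Ext C Z Y\<^esub>"
proof -
  note t = realized_typed[OF r]
  obtain N where N: "is_zero_object C N" using ex_zero_object by blast
  have Y: "Y \<in> Ob C" using t by simp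
  obtain h where "arr C h Z N" "push C x \<delta> = pull C h \<zero>\<^bsub>Ext C N Y\<^esub>"
    using ET3_obtain[OF r realized_id_left[OF N Y] t(1), of "ident C Y"] Y by auto
  then show ?thesis using pull_zero[OF Y, of h Z N] by simp
qed

text \<open>Comparing the trivial conflation X \<rightarrow> X \<rightarrow> 0 with the given one by
  (ET3) factors \<open>y \<cdot> x\<close> through the zero object.\<close>

lemma deflation_inflation:
  assumes r: "realized_by C \<delta> X x Y y Z"
  shows "y \<cdot> x = \<zero>\<^bsub>Hom C X Z\<^esub>"
proof -
  note t = realized_typed[OF r]
  obtain N where N: "is_zero_object C N" using ex_zero_object by blast
  have X: "X \<in> Ob C" using t by simp
  obtain h where "arr C h N Z" "h \<cdot> \<zero>\<^bsub>Hom C X N\<^esub> = y \<cdot> x"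
    using ET3_obtain[OF realized_id_left[OF N X] r, of "ident C X" x] t by auto
  then show ?thesis using X by auto
qed

text \<open>Exactness of Hom(Y, W) \<rightarrow> Hom(X, W) \<rightarrow> E(Z, W). The vanishing
  makes \<open>f\<close> and the identity of Z a morphism to the split extension of Z by W, and its
  middle map is then projected to W.\<close>

lemma extend_along_inflation:
  assumes r: "realized_by C \<delta> X x Y y Z" and f: "arr C f X W" and z: "push C f \<delta> = \<zero>\<^bsub>Ext C Z W\<^esub>"
  obtains g where "arr C g Y W" "g \<cdot> x = f"
proof -
  note t = realized_typed[OF r]
  have O: "W \<in> Ob C" "Z \<in> Ob C" using f t by auto
  obtain B i j p q where b: "biproduct C W Z B i j p q" using ex_biproduct[OF O] by blast
  note s = biproduct_simps[OF b]
  have "push C f \<delta> = pull C (ident C Z) \<zero>\<^bsub>Ext C Z W\<^esub>" using z pull_id[OF extn_zero[OF O(2,1)]] by simp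
  then obtain g where g: "arr C g Y B" "g \<cdot> x = i \<cdot> f"
    using realized_morphism_obtain[OF r realiz_zero[OF b] f, of "ident C Z"] O by auto
  have "(p \<cdot> g) \<cdot> x = f" using g t s f by simp
  then show ?thesis using that[of "p \<cdot> g"] g s by simp
qed

text \<open>Exactness of Hom(Z, W) \<rightarrow> Hom(Y, W) \<rightarrow> Hom(X, W), by (ET3) with
  the trivial conflation 0 \<rightarrow> W \<rightarrow> W as target.\<close>

lemma factor_through_deflation:
  assumes r: "realized_by C \<delta> X x Y y Z" and f: "arr C f Y W" and z: "f \<cdot> x = \<zero>\<^bsub>Hom C X W\<^esub>"
  obtains h where "arr C h Z W" "h \<cdot> y = f"
proof -
  note t = realized_typed[OF r]
  obtain N where N: "is_zero_object C N" using ex_zero_object by blast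
  have O: "W \<in> Ob C" "X \<in> Ob C" "N \<in> Ob C" using t f N zero_ob_Ob by auto
  show ?thesis
    using ET3_obtain[OF r realized_id_right[OF N O(1)], of "\<zero>\<^bsub>Hom C X N\<^esub>" f] that O f z by auto
qed

text \<open>Here the split extension of Y by W is the source: its middle map to M, restricted to the
  summand Y, is the lift.\<close>

lemma lift_of_pull_zero:
  assumes th: "realized_by C \<theta> W m M n Z" and f: "arr C f Y Z" and z: "pull C f \<theta> = \<zero>\<^bsub>Ext C Y W\<^esub>"
  obtains g where "arr C g Y M" "n \<cdot> g = f"
proof -
  note t = realized_typed[OF th]
  have O: "W \<in> Ob C" "Y \<in> Ob C" using t f by auto
  obtain B i j p q where b: "biproduct C W Y B i j p q" using ex_biproduct[OF O] by blast
  note s = biproduct_simps[OF b]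
  have "push C (ident C W) \<zero>\<^bsub>Ext C Y W\<^esub> = pull C f \<theta>" using z push_id[OF extn_zero[OF O(2,1)]] by simp
  then obtain g where g: "arr C g B M" "f \<cdot> q = n \<cdot> g"
    using realized_morphism_obtain[OF realiz_zero[OF b] th _ f, of "ident C W"] O by auto
  have "n \<cdot> (g \<cdot> j) = (n \<cdot> g) \<cdot> j" using g t s by simp
  also have "\<dots> = f" unfolding g(2)[symmetric] using f s by simp
  finally show ?thesis using that[of "g \<cdot> j"] g s by simp
qed

text \<open>Exactness of Hom(X, W) \<rightarrow> E(Z, W) \<rightarrow> E(Y, W). The deflation
  \<open>y\<close> lifts to the middle term of a realization of \<open>\<theta>\<close>, and the
  dual of (ET3) completes the lift to a map on the left.\<close>

lemma push_of_pull_zero: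
  assumes r: "realized_by C \<delta> X x Y y Z" and th: "extn C \<theta> Z W" and z: "pull C y \<theta> = \<zero>\<^bsub>Ext C Y W\<^esub>"
  obtains f where "arr C f X W" "push C f \<delta> = \<theta>"
proof -
  note t = realized_typed[OF r]
  obtain m M n where m: "realized_by C \<theta> W m M n Z" using ex_realization[OF th] by blast
  obtain g where g: "arr C g Y M" "n \<cdot> g = y" using lift_of_pull_zero[OF m t(2) z] by blast
  obtain h where "arr C h X W" "pull C (ident C Z) \<theta> = push C h \<delta>"
    using ET3_op_obtain[OF m r, of "ident C Z" g] g t by auto
  then show ?thesis using that pull_id[OF th] by auto
qed

lemmas pull_deflation = extriangulated_category.push_inflation[OF opposite_extriangulated, unfolded opposite_unfold]
lemmas factor_through_inflation = extriangulated_category.factor_through_deflation[OF opposite_extriangulated, unfolded opposite_unfold]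

text \<open>Realizations are unique up to isomorphism of the middle term, so the split one is
  carried over, with \<open>x\<close> and \<open>y\<close> as inclusion and projection.\<close>

lemma realized_zero_biproduct:
  assumes r: "realized_by C \<zero>\<^bsub>Ext C Z X\<^esub> X x Y y Z"
  obtains j p where "biproduct C X Z Y x j p y"
proof -
  note t = realized_typed[OF r]
  have O: "X \<in> Ob C" "Z \<in> Ob C" using t by auto
  obtain B i j p q where b: "biproduct C X Z B i j p q" using ex_biproduct[OF O] by blast
  obtain f g where f: "arr C f B Y" "arr C g Y B" "g \<cdot> f = ident C B" "f \<cdot> g = ident C Y" "f \<cdot> i = x" "y \<cdot> f = q"
    using realized_unique[OF realiz_zero[OF b] r] by blast
  have "q \<cdot> g = y" unfolding f(6)[symmetric] using f(1-4) t by simp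
  then show ?thesis using biproduct_iso[OF b f(1-4)] that f(5) by auto
qed

text \<open>Two extensions of the same object are realized simultaneously by applying (ET4) to the
  canonical inflation of a summand, followed by the inflation realizing their sum.\<close>

lemma pullback_half:
  assumes d: "extn C \<delta>1 Y X1" "extn C \<delta>2 Y X2" and b: "biproduct C X1 X2 A i j p q"
    and r: "realized_by C (push C i \<delta>1 \<oplus>\<^bsub>Ext C Y A\<^esub> push C j \<delta>2) A a V v Y"
  shows "\<exists>x W w u. realized_by C \<delta>2 X2 x W w Y \<and> realized_by C (pull C w \<delta>1) X1 (a \<cdot> i) V u W"
proof -
  note s = biproduct_simps[OF b]
  let ?\<mu> = "push C i \<delta>1 \<oplus>\<^bsub>Ext C Y A\<^esub> push C j \<delta>2"
  have ij: "arr C i X1 A" "arr C j X2 A" "arr C p A X1" "arr C q A X2" using s by auto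
  have e: "extn C (push C i \<delta>1) Y A" "extn C (push C j \<delta>2) Y A" using push_extn d ij by blast+
  have Y: "Y \<in> Ob C" using d by (simp add: extn_def)
  obtain W u x w \<delta> where W: "arr C u V W" "arr C x X2 W" "arr C w W Y" "extn C \<delta> W X1"
      and r1: "realized_by C \<delta> X1 (a \<cdot> i) V u W" and r2: "realized_by C (push C q ?\<mu>) X2 x W w Y"
      and e3: "push C i \<delta> = pull C w ?\<mu>"
  proof -
    have "\<exists>W \<in> Ob C. \<exists>u \<in> carrier (Hom C V W). \<exists>x \<in> carrier (Hom C X2 W). \<exists>w \<in> carrier (Hom C W Y).
      \<exists>\<delta> \<in> carrier (Ext C W X1). u \<cdot> a = x \<cdot> q \<and> w \<cdot> u = v \<and> realized_by C \<delta> X1 (a \<cdot> i) V u W \<and>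
        realized_by C (push C q ?\<mu>) X2 x W w Y \<and> pull C x \<delta> = \<zero>\<^bsub>Ext C X2 X1\<^esub> \<and> push C i \<delta> = pull C w ?\<mu>"
      using ET4 realiz_zero[OF b] r unfolding ET4_def by blast
    then show ?thesis using that realized_typed by metis
  qed
  have "push C q ?\<mu> = push C (q \<cdot> i) \<delta>1 \<oplus>\<^bsub>Ext C Y X2\<^esub> push C (q \<cdot> j) \<delta>2"
    using push_add[OF e ij(4)] push_comp[OF d(1) ij(1) ij(4)] push_comp[OF d(2) ij(2) ij(4)] by simp
  then have q: "push C q ?\<mu> = \<delta>2"
    using s push_zero_mor[OF d(1), of X2] push_id[OF d(2)] extn_add_zero[OF d(2)] by simp
  have "push C p ?\<mu> = push C (p \<cdot> i) \<delta>1 \<oplus>\<^bsub>Ext C Y X1\<^esub> push C (p \<cdot> j) \<delta>2"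
    using push_add[OF e ij(3)] push_comp[OF d(1) ij(1) ij(3)] push_comp[OF d(2) ij(2) ij(3)] by simp
  then have p: "push C p ?\<mu> = \<delta>1"
    using s push_zero_mor[OF d(2), of X1] push_id[OF d(1)] extn_add_zero[OF d(1)] by simp
  \<comment> \<open>Since \<open>p\<close> splits \<open>i\<close>, the extension
    \<open>\<delta>\<close> is determined by \<open>push C i \<delta>\<close>, which (ET4)
    identifies with a restriction of the sum.\<close>
  have "\<delta> = push C (p \<cdot> i) \<delta>" using s push_id[OF W(4)] by simp
  also have "\<dots> = push C p (pull C w ?\<mu>)" using push_comp[OF W(4) ij(1,3)] e3 by simp
  also have "\<dots> = pull C w \<delta>1" using push_pull_comm[OF extn_add[OF e] ij(3) W(3)] p by simp
  finally show ?thesis using r1 r2 q by auto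
qed

text \<open>Both halves start from one realization of the sum of the two extensions, the second with
  the summands swapped. This is why the two restricted conflations share the middle term
  \<open>V\<close>.\<close>

lemma pullback_pair:
  assumes d: "extn C \<delta>1 Y X1" "extn C \<delta>2 Y X2"
  obtains V x1 W1 w1 x2 W2 w2 u1 v1 u2 v2 where
    "realized_by C \<delta>1 X1 x1 W1 w1 Y" "realized_by C \<delta>2 X2 x2 W2 w2 Y"
    "realized_by C (pull C w2 \<delta>1) X1 u1 V v1 W2" "realized_by C (pull C w1 \<delta>2) X2 u2 V v2 W1"
proof -
  have O: "X1 \<in> Ob C" "X2 \<in> Ob C" "Y \<in> Ob C" using d by (auto simp: extn_def)
  obtain A i j p q where b: "biproduct C X1 X2 A i j p q" using ex_biproduct[OF O(1,2)] by blast
  have ij: "arr C i X1 A" "arr C j X2 A" using biproduct_simps[OF b] by auto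
  have e: "extn C (push C i \<delta>1) Y A" "extn C (push C j \<delta>2) Y A" using push_extn d ij by blast+
  obtain a V v where r: "realized_by C (push C i \<delta>1 \<oplus>\<^bsub>Ext C Y A\<^esub> push C j \<delta>2) A a V v Y"
    using ex_realization[OF extn_add[OF e]] by blast
  interpret vectorspace K "Ext C Y A" using Ext_vectorspace O ij by simp
  have "push C i \<delta>1 \<oplus>\<^bsub>Ext C Y A\<^esub> push C j \<delta>2 = push C j \<delta>2 \<oplus>\<^bsub>Ext C Y A\<^esub> push C i \<delta>1"
    using e M.a_comm by (auto simp: extn_def)
  then have r': "realized_by C (push C j \<delta>2 \<oplus>\<^bsub>Ext C Y A\<^esub> push C i \<delta>1) A a V v Y" using r by simp
  show ?thesis
    using pullback_half[OF d b r] pullback_half[OF d(2,1) biproduct_swap[OF b] r'] that by blast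
qed

lemmas pushout_pair = extriangulated_category.pullback_pair[OF opposite_extriangulated, unfolded opposite_unfold]

end

section \<open>Almost split extensions\<close>

context vectorspace
begin

lemma subspace_dim_strict_mono:
  assumes fd: "fin_dim" and N: "VectorSpace.subspace K N V" "VectorSpace.subspace K M V" and lt: "N \<subset> M"
  shows "vectorspace.dim K (vs N) < vectorspace.dim K (vs M)"
proof -
  interpret M: vectorspace K "vs M" by (rule subspace_is_vs[OF N(2)])
  have "VectorSpace.subspace K N (vs M)"
    using lt submodule.m_closed[OF is_module[OF N(1)]] submodule.smult_closed[OF is_module[OF N(1)]]
      submodule.zero_closed[OF is_module[OF N(1)]]
    by (intro M.subspaceI) auto
  from M.subspace_dim(2)[OF subspace_fin_dim[OF fd N(2)] this] show ?thesis using lt by simp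
qed

end

context extriangulated_category
begin

lemma section_morE:
  assumes "section_mor C X Y f" "X \<in> Ob C" "Y \<in> Ob C"
  obtains r where "arr C f X Y" "arr C r Y X" "r \<cdot> f = ident C X"
  using assms section_mor_iff by blast

lemma retraction_morE:
  assumes "retraction_mor C X Y f" "X \<in> Ob C" "Y \<in> Ob C"
  obtains r where "arr C f X Y" "arr C r Y X" "f \<cdot> r = ident C Y"
  using assms retraction_mor_iff by blast

lemma local_radical_left:
  assumes A: "local_ob A" and f: "arr C f A X" "\<not> section_mor C A X f" and g: "arr C g X A"
  shows "iso_mor C A A (ident C A \<oplus>\<^bsub>Hom C A A\<^esub> (\<ominus>\<^bsub>Hom C A A\<^esub> (g \<cdot> f)))"
proof -
  have O: "A \<in> Ob C" using f by auto
  let ?d = "ident C A \<oplus>\<^bsub>Hom C A A\<^esub> (\<ominus>\<^bsub>Hom C A A\<^esub> (g \<cdot> f))"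
  have d: "arr C ?d A A" "g \<cdot> f \<oplus>\<^bsub>Hom C A A\<^esub> ?d = ident C A"
    using f g O diff_add[of "ident C A" A A "g \<cdot> f"] by auto
  moreover have "\<not> iso_mor C A A (g \<cdot> f)" using iso_mor_inv_cmp(1) f g by blast
  moreover have "arr C (g \<cdot> f) A A" using f g by simp
  ultimately show ?thesis using A iso_mor_ident[OF O] unfolding local_ob_def by metis
qed

lemma pull_iso_zero:
  assumes i: "iso_mor C B B f" and e: "extn C \<eta> B A" and z: "pull C f \<eta> = \<zero>\<^bsub>Ext C B A\<^esub>"
  shows "\<eta> = \<zero>\<^bsub>Ext C B A\<^esub>"
proof -
  have O: "B \<in> Ob C" "A \<in> Ob C" using e by (auto simp: extn_def)
  obtain g where g: "arr C f B B" "arr C g B B" "f \<cdot> g = ident C B" using iso_morE[OF i O(1,1)] by metis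
  have "\<eta> = pull C g (pull C f \<eta>)" using pull_comp[OF e g(1,2)] g(3) pull_id[OF e] by simp
  then show ?thesis using z pull_zero[OF O(2) g(2)] by simp
qed

lemma push_iso_zero:
  assumes i: "iso_mor C A A f" and e: "extn C \<eta> B A" and z: "push C f \<eta> = \<zero>\<^bsub>Ext C B A\<^esub>"
  shows "\<eta> = \<zero>\<^bsub>Ext C B A\<^esub>"
  using extriangulated_category.pull_iso_zero[OF opposite_extriangulated, unfolded opposite_unfold, OF i e z] .

text \<open>An argument in the style of Nakayama: the identity minus \<open>g \<cdot> u\<close>
  kills \<open>\<eta>\<close> and is invertible, because \<open>g\<close> is no retraction into a
  local object.\<close>

lemma pull_nonretraction_fixed:
  assumes B: "local_ob B" and e: "extn C \<eta> B A" and g: "arr C g W B" "\<not> retraction_mor C W B g"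
    and u: "arr C u B W" and eq: "pull C (g \<cdot> u) \<eta> = \<eta>"
  shows "\<eta> = \<zero>\<^bsub>Ext C B A\<^esub>"
proof (rule pull_iso_zero[OF local_radical[OF B g u] e])
  have "arr C (ident C B) B B" "arr C (g \<cdot> u) B B" using g u by auto
  from pull_diff_zero[OF e this]
  show "pull C (ident C B \<oplus>\<^bsub>Hom C B B\<^esub> \<ominus>\<^bsub>Hom C B B\<^esub> (g \<cdot> u)) \<eta> = \<zero>\<^bsub>Ext C B A\<^esub>"
    using eq pull_id[OF e] by simp
qed

lemma push_nonsection_fixed:
  assumes A: "local_ob A" and e: "extn C \<eta> B A" and f: "arr C f A X" "\<not> section_mor C A X f"
    and u: "arr C u X A" and eq: "push C (u \<cdot> f) \<eta> = \<eta>"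
  shows "\<eta> = \<zero>\<^bsub>Ext C B A\<^esub>"
proof (rule push_iso_zero[OF local_radical_left[OF A f u] e])
  have "arr C (ident C A) A A" "arr C (u \<cdot> f) A A" using f u by auto
  from push_diff_zero[OF e this]
  show "push C (ident C A \<oplus>\<^bsub>Hom C A A\<^esub> \<ominus>\<^bsub>Hom C A A\<^esub> (u \<cdot> f)) \<eta> = \<zero>\<^bsub>Ext C B A\<^esub>"
    using eq push_id[OF e] by simp
qed

lemma pull_biproduct_zero:
  assumes b: "biproduct C X Y B i j p q" and e: "extn C \<eta> B A"
    and z: "pull C i \<eta> = \<zero>\<^bsub>Ext C X A\<^esub>" "pull C j \<eta> = \<zero>\<^bsub>Ext C Y A\<^esub>"
  shows "\<eta> = \<zero>\<^bsub>Ext C B A\<^esub>"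
proof -
  note s = biproduct_simps[OF b]
  have t: "arr C i X B" "arr C j Y B" "arr C p B X" "arr C q B Y" and A: "A \<in> Ob C"
    using s e by (auto simp: extn_def)
  interpret linear_map K "Hom C B B" "Ext C B A" "\<lambda>f. pull C f \<eta>" using linear_pull_mor[OF e s(15)] .
  have "\<eta> = pull C (i \<cdot> p \<oplus>\<^bsub>Hom C B B\<^esub> j \<cdot> q) \<eta>" using s(20) pull_id[OF e] by simp
  also have "\<dots> = pull C (i \<cdot> p) \<eta> \<oplus>\<^bsub>Ext C B A\<^esub> pull C (j \<cdot> q) \<eta>" using T_add[of "i \<cdot> p" "j \<cdot> q"] s(1-15) by simp
  also have "\<dots> = \<zero>\<^bsub>Ext C B A\<^esub>"
    using pull_comp[OF e t(1,3)] pull_comp[OF e t(2,4)] z pull_zero[OF A t(3)] pull_zero[OF A t(4)]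
    by simp
  finally show ?thesis .
qed

text \<open>The hypothesis ranges over all sections from the components, because \<open>dsum\<close>
  keeps no record of its inclusions.\<close>

lemma pull_dsum_zero:
  assumes "dsum Bs Q" "extn C \<eta> Q A"
    "\<And>B i. B \<in> set Bs \<Longrightarrow> section_mor C B Q i \<Longrightarrow> pull C i \<eta> = \<zero>\<^bsub>Ext C B A\<^esub>"
  shows "\<eta> = \<zero>\<^bsub>Ext C Q A\<^esub>"
  using assms
proof (induction Bs arbitrary: Q \<eta>)
  case Nil
  then have Q: "is_zero_object C Q" "Q \<in> Ob C" using zero_ob_Ob by auto
  then have "\<eta> = pull C \<zero>\<^bsub>Hom C Q Q\<^esub> \<eta>" using pull_id[OF Nil(2)] zero_ob_ident by metis
  then show ?case using pull_zero_mor[OF Nil(2) Q(2)] by simp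
next
  case (Cons B Bs)
  then obtain S i j p q where b: "biproduct C B S Q i j p q" and S: "dsum Bs S" by auto
  note s = biproduct_simps[OF b]
  have ij: "arr C i B Q" "arr C j S Q" "arr C p Q B" "arr C q Q S" using s by auto
  have "section_mor C B Q i" using section_mor_iff ij(1,3) s(16) by blast
  then have "pull C i \<eta> = \<zero>\<^bsub>Ext C B A\<^esub>" using Cons.prems(3)[of B i] by simp
  moreover have "pull C j \<eta> = \<zero>\<^bsub>Ext C S A\<^esub>"
  proof (rule Cons.IH[OF S])
    show "extn C (pull C j \<eta>) S A" using pull_extn[OF Cons.prems(2) ij(2)] .
    fix B' i' assume B': "B' \<in> set Bs" "section_mor C B' S i'"
    have "B' \<in> Ob C" using dsum_Ob[OF S] B' by blast
    then obtain r where r: "arr C i' B' S" "arr C r S B'" "r \<cdot> i' = ident C B'"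
      using B'(2) section_mor_iff s(14) by blast
    have "(r \<cdot> q) \<cdot> (j \<cdot> i') = ident C B'" using r s by simp
    moreover have "arr C (j \<cdot> i') B' Q" "arr C (r \<cdot> q) Q B'" using r ij by auto
    ultimately have "section_mor C B' Q (j \<cdot> i')" using section_mor_iff by blast
    then show "pull C i' (pull C j \<eta>) = \<zero>\<^bsub>Ext C B' A\<^esub>"
      using Cons.prems(3)[of B'] B' pull_comp[OF Cons.prems(2) ij(2) r(1)] by simp
  qed
  ultimately show ?case using pull_biproduct_zero[OF b Cons.prems(2)] by blast
qed

text \<open>A test object for E(-, A). Duality provides one for every A; with finitely many
  indecomposables, their sum is one for the dual notion.\<close>

definition detects :: "'o \<Rightarrow> 'o \<Rightarrow> bool" where
  "detects Q A \<longleftrightarrow> Q \<in> Ob C \<and> (\<forall>Z \<theta>. extn C \<theta> Z A \<longrightarrow> \<theta> \<noteq> \<zero>\<^bsub>Ext C Z A\<^esub> \<longrightarrow>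
     (\<exists>v. arr C v Q Z \<and> pull C v \<theta> \<noteq> \<zero>\<^bsub>Ext C Q A\<^esub>))"

text \<open>Among the nonzero restrictions of \<open>\<theta>\<close> to summands of \<open>Q\<close>, one whose orbit under
  morphisms from \<open>Q\<close> has the least dimension vanishes on all nonretractions.\<close>

lemma ex_socle_element:
  assumes fin: "ext_finite K C" and Q: "detects Q A" and Bs: "dsum Bs Q" "\<And>B. B \<in> set Bs \<Longrightarrow> local_ob B"
    and th: "extn C \<theta> Z A" "\<theta> \<noteq> \<zero>\<^bsub>Ext C Z A\<^esub>"
  obtains B k where "B \<in> set Bs" "arr C k B Z" "pull C k \<theta> \<noteq> \<zero>\<^bsub>Ext C B A\<^esub>"
    "\<And>W g. arr C g W B \<Longrightarrow> \<not> retraction_mor C W B g \<Longrightarrow> pull C g (pull C k \<theta>) = \<zero>\<^bsub>Ext C W A\<^esub>"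
proof -
  have O: "Q \<in> Ob C" "A \<in> Ob C" using Q th by (auto simp: detects_def extn_def)
  interpret E: vectorspace K "Ext C Q A" using Ext_vectorspace O .
  have fd: "E.fin_dim" using fin O by (simp add: ext_finite_def)
  define D where "D \<eta> B = {pull C v \<eta> | v. arr C v Q B}" for \<eta> B
  have Dsub: "VectorSpace.subspace K (D \<eta> B) (Ext C Q A)" if "extn C \<eta> B A" for \<eta> B
  proof -
    interpret linear_map K "Hom C Q B" "Ext C Q A" "\<lambda>f. pull C f \<eta>" using linear_pull_mor[OF that O(1)] .
    have "imT = D \<eta> B" using that O unfolding im_def D_def arr_def extn_def by blast
    then show ?thesis using imT_is_subspace by simp
  qed
  define r where "r \<eta> B = vectorspace.dim K (Ext C Q A\<lparr>carrier := D \<eta> B\<rparr>)" for \<eta> B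
  define P where "P Bk \<longleftrightarrow> fst Bk \<in> set Bs \<and> arr C (snd Bk) (fst Bk) Z \<and> pull C (snd Bk) \<theta> \<noteq> \<zero>\<^bsub>Ext C (fst Bk) A\<^esub>" for Bk
  have step: "\<exists>B \<in> set Bs. \<exists>k. arr C k B W \<and> pull C k \<eta> \<noteq> \<zero>\<^bsub>Ext C B A\<^esub>"
    if \<eta>: "extn C \<eta> W A" "\<eta> \<noteq> \<zero>\<^bsub>Ext C W A\<^esub>" for \<eta> W
  proof -
    obtain v where v: "arr C v Q W" "pull C v \<eta> \<noteq> \<zero>\<^bsub>Ext C Q A\<^esub>" using Q \<eta> unfolding detects_def by blast
    obtain B i where B: "B \<in> set Bs" "section_mor C B Q i" "pull C i (pull C v \<eta>) \<noteq> \<zero>\<^bsub>Ext C B A\<^esub>"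
      using pull_dsum_zero[OF Bs(1) pull_extn[OF \<eta>(1) v(1)]] v(2) by blast
    have "arr C i B Q" using B(2) dsum_Ob[OF Bs(1)] B(1) by (auto simp: section_mor_def)
    then have "arr C (v \<cdot> i) B W" "pull C (v \<cdot> i) \<eta> \<noteq> \<zero>\<^bsub>Ext C B A\<^esub>"
      using v(1) B(3) pull_comp[OF \<eta>(1) v(1)] by auto
    then show ?thesis using B(1) by blast
  qed
  have "\<exists>Bk. P Bk" using step[OF th] unfolding P_def by auto
  then obtain Bk where "P Bk" and min: "\<And>Bk'. P Bk' \<Longrightarrow> r (pull C (snd Bk) \<theta>) (fst Bk) \<le> r (pull C (snd Bk') \<theta>) (fst Bk')"
    using ex_has_least_nat[of P _ "\<lambda>Bk. r (pull C (snd Bk) \<theta>) (fst Bk)"] by blast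
  define B where "B = fst Bk"
  define k where "k = snd Bk"
  have B: "B \<in> set Bs" "arr C k B Z" "pull C k \<theta> \<noteq> \<zero>\<^bsub>Ext C B A\<^esub>"
    using \<open>P Bk\<close> unfolding P_def B_def k_def by blast+
  note min = min[folded B_def k_def]
  define \<eta> where "\<eta> = pull C k \<theta>"
  have \<eta>: "extn C \<eta> B A" unfolding \<eta>_def using pull_extn[OF th(1) B(2)] .
  have "pull C g \<eta> = \<zero>\<^bsub>Ext C W A\<^esub>" if g: "arr C g W B" "\<not> retraction_mor C W B g" for W g
  proof (rule ccontr)
    assume ne: "pull C g \<eta> \<noteq> \<zero>\<^bsub>Ext C W A\<^esub>"
    obtain B' v where B': "B' \<in> set Bs" "arr C v B' W" "pull C v (pull C g \<eta>) \<noteq> \<zero>\<^bsub>Ext C B' A\<^esub>"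
      using step[OF pull_extn[OF \<eta> g(1)] ne] by blast
    let ?g = "g \<cdot> v"
    have g': "arr C ?g B' B" "\<not> retraction_mor C B' B ?g"
      using g B' retraction_cmp_right[OF B'(2) g(1)] by auto
    have e: "pull C ?g \<eta> = pull C v (pull C g \<eta>)" using pull_comp[OF \<eta> g(1) B'(2)] .
    have e': "extn C (pull C ?g \<eta>) B' A" using pull_extn[OF \<eta> g'(1)] .
    have "pull C (k \<cdot> ?g) \<theta> = pull C ?g \<eta>" unfolding \<eta>_def using pull_comp[OF th(1) B(2) g'(1)] .
    then have le: "r \<eta> B \<le> r (pull C ?g \<eta>) B'"
      using min[of "(B', k \<cdot> ?g)"] B' B(2) g'(1) e unfolding P_def \<eta>_def by simp
    have sub: "D (pull C ?g \<eta>) B' \<subseteq> D \<eta> B"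
    proof
      fix x assume "x \<in> D (pull C ?g \<eta>) B'"
      then obtain w where w: "arr C w Q B'" "x = pull C w (pull C ?g \<eta>)" unfolding D_def by blast
      then have "x = pull C (?g \<cdot> w) \<eta>" "arr C (?g \<cdot> w) Q B" using pull_comp[OF \<eta> g'(1) w(1)] g'(1) by auto
      then show "x \<in> D \<eta> B" unfolding D_def by blast
    qed
    \<comment> \<open>Minimality of the dimension turns the inclusion of orbits into an
      equality.\<close>
    have eqD: "D (pull C ?g \<eta>) B' = D \<eta> B"
      using E.subspace_dim_strict_mono[OF fd Dsub[OF e'] Dsub[OF \<eta>]] sub le unfolding r_def by fastforce
    \<comment> \<open>As \<open>B\<close> is a summand of \<open>Q\<close>, the projection
      \<open>p\<close> gives an element of the orbit. By equality of the orbits,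
      \<open>\<eta>\<close> is then its own restriction along a morphism that factors through the
      nonretraction \<open>?g\<close>.\<close>
    obtain S i j p q where b: "biproduct C B S Q i j p q" using dsum_summand[OF Bs(1) B(1)] by blast
    have ip: "arr C i B Q" "arr C p Q B" "p \<cdot> i = ident C B" using biproduct_simps[OF b] by auto
    have "pull C p \<eta> \<in> D (pull C ?g \<eta>) B'" unfolding eqD using ip(2) unfolding D_def by blast
    then obtain u where u: "arr C u Q B'" "pull C p \<eta> = pull C u (pull C ?g \<eta>)" unfolding D_def by blast
    have ui: "arr C (u \<cdot> i) B B'" using u(1) ip(1) by simp
    have "pull C (?g \<cdot> (u \<cdot> i)) \<eta> = pull C i (pull C u (pull C ?g \<eta>))"
      using pull_comp[OF \<eta> g'(1) ui] pull_comp[OF e' u(1) ip(1)] by simp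
    also have "\<dots> = \<eta>" unfolding u(2)[symmetric] using pull_comp[OF \<eta> ip(2,1)] ip(3) pull_id[OF \<eta>] by simp
    finally have "\<eta> = \<zero>\<^bsub>Ext C B A\<^esub>" by (rule pull_nonretraction_fixed[OF Bs(2)[OF B(1)] \<eta> g' ui])
    then show False using B(3) \<eta>_def by simp
  qed
  then show ?thesis using that B unfolding \<eta>_def by blast
qed

section \<open>Duality and the two quotient categories\<close>

lemma coset_self: "arr C h X Y \<Longrightarrow> \<zero>\<^bsub>Hom C X Y\<^esub> \<in> H \<Longrightarrow> h \<in> H +>\<^bsub>Hom C X Y\<^esub> h"
  unfolding a_r_coset_def' using add_zero(2)[of h X Y] by force

lemma upper_ideal_zero: "X \<in> Ob C \<Longrightarrow> Y \<in> Ob C \<Longrightarrow> \<zero>\<^bsub>Hom C X Y\<^esub> \<in> upper_ideal C X Y"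
  using push_zero_mor[of _ _ X Y] unfolding upper_ideal_def extn_def by auto

lemma lower_ideal_zero: "X \<in> Ob C \<Longrightarrow> Y \<in> Ob C \<Longrightarrow> \<zero>\<^bsub>Hom C X Y\<^esub> \<in> lower_ideal C X Y"
  using pull_zero_mor[of _ Y _ X] unfolding lower_ideal_def extn_def by auto

lemma lower_quotient_simps:
  "Ob (lower_quotient C) = Ob C"
  "carrier (Hom (lower_quotient C) X Y) = a_rcosets\<^bsub>Hom C X Y\<^esub> (lower_ideal C X Y)"
  "ident (lower_quotient C) X = lower_ideal C X X +>\<^bsub>Hom C X X\<^esub> ident C X"
  by (simp_all add: lower_quotient_def quotient_category_def quotient_space_def)

lemma upper_quotient_simps:
  "Ob (upper_quotient C) = Ob C"
  "carrier (Hom (upper_quotient C) X Y) = a_rcosets\<^bsub>Hom C X Y\<^esub> (upper_ideal C X Y)"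
  "ident (upper_quotient C) X = upper_ideal C X X +>\<^bsub>Hom C X X\<^esub> ident C X"
  by (simp_all add: upper_quotient_def quotient_category_def quotient_space_def)

text \<open>Representatives of two inverse residue classes compose to the identity up to a morphism
  of the ideal, and such a morphism acts as zero on extensions.\<close>

lemma upper_quotient_iso_push:
  assumes iso: "iso_mor (upper_quotient C) B A \<Theta>" and A: "A \<in> Ob C" and B: "B \<in> Ob C"
  shows "\<exists>\<iota> \<kappa>. arr C \<iota> B A \<and> arr C \<kappa> A B \<and> (\<forall>\<theta> Z. extn C \<theta> Z A \<longrightarrow> push C \<iota> (push C \<kappa> \<theta>) = \<theta>)"
proof -
  obtain F G where FG: "F \<in> carrier (Hom (upper_quotient C) B A)" "G \<in> carrier (Hom (upper_quotient C) A B)"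
      "F \<cdot>\<^bsub>upper_quotient C\<^esub> G = ident (upper_quotient C) A"
    using iso unfolding iso_mor_def by blast
  obtain \<iota> where \<iota>: "arr C \<iota> B A" "F = upper_ideal C B A +>\<^bsub>Hom C B A\<^esub> \<iota>"
    using FG(1) A B unfolding upper_quotient_simps A_RCOSETS_def' by auto
  obtain \<kappa> where \<kappa>: "arr C \<kappa> A B" "G = upper_ideal C A B +>\<^bsub>Hom C A B\<^esub> \<kappa>"
    using FG(2) A B unfolding upper_quotient_simps A_RCOSETS_def' by auto
  have ik: "arr C (\<iota> \<cdot> \<kappa>) A A" using \<iota> \<kappa> by simp
  have "\<iota> \<in> F \<inter> carrier (Hom C B A)" "\<kappa> \<in> G \<inter> carrier (Hom C A B)"
    using coset_self[OF \<iota>(1)] coset_self[OF \<kappa>(1)] \<iota> \<kappa> upper_ideal_zero A B by auto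
  \<comment> \<open>A composite in the quotient is a union over all pairs of representatives; the
    chosen pair contributes one of its members.\<close>
  then have "upper_ideal C A A +>\<^bsub>Hom C A A\<^esub> (\<iota> \<cdot> \<kappa>) \<in> {upper_ideal C X Z +>\<^bsub>Hom C X Z\<^esub> (g \<cdot> f) | X Y Z f g.
      X \<in> Ob C \<and> Y \<in> Ob C \<and> Z \<in> Ob C \<and> f \<in> G \<inter> carrier (Hom C X Y) \<and> g \<in> F \<inter> carrier (Hom C Y Z)}"
    using A B by (intro CollectI exI[of _ A] exI[of _ "B"] exI[of _ \<kappa>] exI[of _ \<iota>] conjI refl) auto
  moreover have "F \<cdot>\<^bsub>upper_quotient C\<^esub> G = \<Union>{upper_ideal C X Z +>\<^bsub>Hom C X Z\<^esub> (g \<cdot> f) | X Y Z f g.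
      X \<in> Ob C \<and> Y \<in> Ob C \<and> Z \<in> Ob C \<and> f \<in> G \<inter> carrier (Hom C X Y) \<and> g \<in> F \<inter> carrier (Hom C Y Z)}"
    by (simp add: upper_quotient_def quotient_category_def)
  ultimately have "upper_ideal C A A +>\<^bsub>Hom C A A\<^esub> (\<iota> \<cdot> \<kappa>) \<subseteq> F \<cdot>\<^bsub>upper_quotient C\<^esub> G" by blast
  then have "\<iota> \<cdot> \<kappa> \<in> upper_ideal C A A +>\<^bsub>Hom C A A\<^esub> ident C A"
    using coset_self[OF ik upper_ideal_zero] A FG(3) by (auto simp: upper_quotient_simps)
  then obtain n where n: "n \<in> upper_ideal C A A" "\<iota> \<cdot> \<kappa> = n \<oplus>\<^bsub>Hom C A A\<^esub> ident C A" unfolding a_r_coset_def' by auto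
  have push_ik: "push C \<iota> (push C \<kappa> \<theta>) = \<theta>" if th: "extn C \<theta> Z A" for \<theta> Z
  proof -
    have Z: "Z \<in> Ob C" using th by (simp add: extn_def)
    interpret linear_map K "Hom C A A" "Ext C Z A" "\<lambda>f. push C f \<theta>" using linear_push_mor[OF th A] .
    have "push C n \<theta> = \<zero>\<^bsub>Ext C Z A\<^esub>" "arr C n A A" using n(1) th A unfolding upper_ideal_def extn_def by auto
    then have "push C (\<iota> \<cdot> \<kappa>) \<theta> = \<theta>"
      unfolding n(2) using T_add[of n "ident C A"] A push_id[OF th] extn_add_zero(2)[OF th] by simp
    then show ?thesis using push_comp[OF th \<kappa>(1) \<iota>(1)] by simp
  qed
  then show ?thesis using \<iota>(1) \<kappa>(1) by blast
qed

text \<open>Because composition is a union of cosets, the identity law amounts to showing that every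
  pair of representatives contributes the same coset. This rests on closure of the ideal under
  addition, negation and composition from the left.\<close>

lemma lower_quotient_ident_right:
  assumes Q: "Q \<in> Ob C" and Z: "Z \<in> Ob C" and u: "u \<in> carrier (Hom (lower_quotient C) Q Z)"
  shows "u \<cdot>\<^bsub>lower_quotient C\<^esub> ident (lower_quotient C) Q = u"
proof -
  obtain v where v: "arr C v Q Z" "u = lower_ideal C Q Z +>\<^bsub>Hom C Q Z\<^esub> v"
    using u Q Z unfolding lower_quotient_simps A_RCOSETS_def' by auto
  have sub: "h \<in> lower_ideal C Q Z \<Longrightarrow> arr C h Q Z" for h using Q Z by (auto simp: lower_ideal_def)
  have low: "arr C h Q Z \<Longrightarrow> h \<in> lower_ideal C Q Z \<longleftrightarrow> (\<forall>W \<delta>. extn C \<delta> Z W \<longrightarrow> pull C h \<delta> = \<zero>\<^bsub>Ext C Q W\<^esub>)" for h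
    using Q Z unfolding lower_ideal_def extn_def by auto
  have addl: "a \<oplus>\<^bsub>Hom C Q Z\<^esub> b \<in> lower_ideal C Q Z" "\<ominus>\<^bsub>Hom C Q Z\<^esub> a \<in> lower_ideal C Q Z"
    if ab: "a \<in> lower_ideal C Q Z" "b \<in> lower_ideal C Q Z" for a b
  proof -
    have t: "arr C a Q Z" "arr C b Q Z" using ab sub by blast+
    have "pull C (a \<oplus>\<^bsub>Hom C Q Z\<^esub> b) \<delta> = \<zero>\<^bsub>Ext C Q W\<^esub> \<and> pull C (\<ominus>\<^bsub>Hom C Q Z\<^esub> a) \<delta> = \<zero>\<^bsub>Ext C Q W\<^esub>"
      if d: "extn C \<delta> Z W" for \<delta> W
    proof -
      interpret linear_map K "Hom C Q Z" "Ext C Q W" "\<lambda>f. pull C f \<delta>" using linear_pull_mor[OF d Q] .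
      show ?thesis using T_add[of a b] T_neg[of a] t ab low[OF t(1)] low[OF t(2)] d Q Z by auto
    qed
    then show "a \<oplus>\<^bsub>Hom C Q Z\<^esub> b \<in> lower_ideal C Q Z" "\<ominus>\<^bsub>Hom C Q Z\<^esub> a \<in> lower_ideal C Q Z"
      using low[of "a \<oplus>\<^bsub>Hom C Q Z\<^esub> b"] low[of "\<ominus>\<^bsub>Hom C Q Z\<^esub> a"] t by auto
  qed
  have coset_eq: "lower_ideal C Q Z +>\<^bsub>Hom C Q Z\<^esub> (m \<oplus>\<^bsub>Hom C Q Z\<^esub> h) = lower_ideal C Q Z +>\<^bsub>Hom C Q Z\<^esub> h"
    if m: "m \<in> lower_ideal C Q Z" and h: "arr C h Q Z" for m h
  proof -
    interpret abelian_group "Hom C Q Z" using Hom_abelian_group Q Z .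
    have 1: "a \<oplus>\<^bsub>Hom C Q Z\<^esub> (m \<oplus>\<^bsub>Hom C Q Z\<^esub> h) = (a \<oplus>\<^bsub>Hom C Q Z\<^esub> m) \<oplus>\<^bsub>Hom C Q Z\<^esub> h"
      and 2: "a \<oplus>\<^bsub>Hom C Q Z\<^esub> h = (a \<oplus>\<^bsub>Hom C Q Z\<^esub> \<ominus>\<^bsub>Hom C Q Z\<^esub> m) \<oplus>\<^bsub>Hom C Q Z\<^esub> (m \<oplus>\<^bsub>Hom C Q Z\<^esub> h)"
      if "a \<in> lower_ideal C Q Z" for a
      using sub[OF that] sub[OF m] h Q Z by (simp_all add: add_assoc diff_add r_neg1 r_neg2)
    show ?thesis unfolding a_r_coset_def'
    proof (intro equalityI subsetI; elim UN_E singletonE)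
      fix x a assume "a \<in> lower_ideal C Q Z" "x = a \<oplus>\<^bsub>Hom C Q Z\<^esub> (m \<oplus>\<^bsub>Hom C Q Z\<^esub> h)"
      then show "x \<in> (\<Union>a \<in> lower_ideal C Q Z. {a \<oplus>\<^bsub>Hom C Q Z\<^esub> h})" using 1 addl(1) m by blast
    next
      fix x a assume a: "a \<in> lower_ideal C Q Z" "x = a \<oplus>\<^bsub>Hom C Q Z\<^esub> h"
      have "x = (a \<oplus>\<^bsub>Hom C Q Z\<^esub> \<ominus>\<^bsub>Hom C Q Z\<^esub> m) \<oplus>\<^bsub>Hom C Q Z\<^esub> (m \<oplus>\<^bsub>Hom C Q Z\<^esub> h)"
        unfolding a(2) by (rule 2[OF a(1)])
      moreover have "a \<oplus>\<^bsub>Hom C Q Z\<^esub> \<ominus>\<^bsub>Hom C Q Z\<^esub> m \<in> lower_ideal C Q Z"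
        by (rule addl(1)[OF a(1) addl(2)[OF m m]])
      ultimately show "x \<in> (\<Union>a \<in> lower_ideal C Q Z. {a \<oplus>\<^bsub>Hom C Q Z\<^esub> (m \<oplus>\<^bsub>Hom C Q Z\<^esub> h)})" by blast
    qed
  qed
  have ideal: "h \<cdot> n \<in> lower_ideal C Q Z" if n: "n \<in> lower_ideal C Q Q" and h: "arr C h Q Z" for n h
  proof -
    have t: "arr C n Q Q" using n Q by (auto simp: lower_ideal_def)
    have "pull C (h \<cdot> n) \<delta> = \<zero>\<^bsub>Ext C Q W\<^esub>" if d: "extn C \<delta> Z W" for \<delta> W
      using pull_comp[OF d h t] pull_extn[OF d h] n unfolding lower_ideal_def extn_def by auto
    then show ?thesis using low[of "h \<cdot> n"] t h by auto
  qed
  let ?S = "{lower_ideal C X Z' +>\<^bsub>Hom C X Z'\<^esub> (g \<cdot> f) | X Y Z' f g. X \<in> Ob C \<and> Y \<in> Ob C \<and> Z' \<in> Ob C \<and>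
    f \<in> ident (lower_quotient C) Q \<inter> carrier (Hom C X Y) \<and> g \<in> u \<inter> carrier (Hom C Y Z')}"
  have "S = u" if SS: "S \<in> ?S" for S
  proof -
    obtain X Y Z' f g where S: "S = lower_ideal C X Z' +>\<^bsub>Hom C X Z'\<^esub> (g \<cdot> f)" and
      O: "X \<in> Ob C" "Y \<in> Ob C" "Z' \<in> Ob C" and fg': "f \<in> ident (lower_quotient C) Q" "g \<in> u"
      "f \<in> carrier (Hom C X Y)" "g \<in> carrier (Hom C Y Z')" using SS by blast
    have fg: "f \<in> ident (lower_quotient C) Q" "g \<in> u" "arr C f X Y" "arr C g Y Z'" using fg' O by simp_all
    obtain n where n: "n \<in> lower_ideal C Q Q" "f = n \<oplus>\<^bsub>Hom C Q Q\<^esub> ident C Q"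
      using fg(1) unfolding lower_quotient_simps a_r_coset_def' by auto
    obtain m where m: "m \<in> lower_ideal C Q Z" "g = m \<oplus>\<^bsub>Hom C Q Z\<^esub> v"
      using fg(2) unfolding v(2) a_r_coset_def' by auto
    have nt: "arr C n Q Q" using n(1) Q by (auto simp: lower_ideal_def)
    have f: "arr C f Q Q" and g: "arr C g Q Z" unfolding n(2) m(2) using nt sub[OF m(1)] v(1) Q by auto
    have "X = Q" "Y = Q" "Z' = Z" using arr_unique[OF fg(3) f] arr_unique[OF fg(4) g] by auto
    moreover have "g \<cdot> f = g \<cdot> n \<oplus>\<^bsub>Hom C Q Z\<^esub> g" unfolding n(2) using g nt by simp
    ultimately have "S = lower_ideal C Q Z +>\<^bsub>Hom C Q Z\<^esub> g" using S coset_eq[OF ideal[OF n(1) g] g] by simp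
    then show ?thesis unfolding m(2) v(2) using coset_eq[OF m(1) v(1)] by simp
  qed
  moreover have "u \<in> ?S"
  proof -
    have "ident C Q \<in> ident (lower_quotient C) Q" "v \<in> u"
      unfolding lower_quotient_simps v(2) using coset_self[OF v(1) lower_ideal_zero[OF Q Z]] coset_self[OF _ lower_ideal_zero[OF Q Q], of "ident C Q"] Q by simp_all
    moreover have "v \<cdot> ident C Q = v" using v(1) by simp
    ultimately show ?thesis using Q Z v
      by (intro CollectI exI[of _ Q] exI[of _ Q] exI[of _ Z] exI[of _ "ident C Q"] exI[of _ v]) auto
  qed
  ultimately have "?S = {u}" by blast
  moreover have "u \<cdot>\<^bsub>lower_quotient C\<^esub> ident (lower_quotient C) Q = \<Union>?S"
    by (simp add: lower_quotient_def quotient_category_def)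
  ultimately show ?thesis by simp
qed

text \<open>For \<open>\<tau>Q = A\<close>, a functional on \<open>E(Z, A)\<close> that does not vanish at \<open>\<theta>\<close> is by duality the
  composite of a restriction along some \<open>Q \<rightarrow> Z\<close> and a functional on \<open>E(Q, A)\<close>.\<close>

lemma ARS_detects:
  assumes ars: "ARS_duality K C" and fin: "ext_finite K C" and A: "A \<in> Ob C"
  shows "\<exists>Q. detects Q A"
proof -
  obtain \<tau>o \<tau>m \<eta> where eqv: "is_equivalence (lower_quotient C) (upper_quotient C) \<tau>o \<tau>m"
    and hb: "\<forall>X \<in> Ob C. \<forall>Y \<in> Ob C.
          \<eta> X Y \<in> LinearCombinations.module_hom K (Hom (lower_quotient C) X Y)
                     (dual_space K (Ext C Y (\<tau>o X))) \<and>
          bij_betw (\<eta> X Y) (carrier (Hom (lower_quotient C) X Y))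
                     (carrier (dual_space K (Ext C Y (\<tau>o X))))"
    and hn: "\<forall>X \<in> Ob C. \<forall>Y \<in> Ob C. \<forall>Y' \<in> Ob C. \<forall>u \<in> carrier (Hom (lower_quotient C) X Y).
          \<forall>G \<in> carrier (Hom (lower_quotient C) Y Y'). \<forall>g \<in> G. \<forall>\<delta> \<in> carrier (Ext C Y' (\<tau>o X)).
            \<eta> X Y' (G \<cdot>\<^bsub>lower_quotient C\<^esub> u) \<delta> = \<eta> X Y u (pull C g \<delta>)"
    using ars unfolding ARS_duality_def by (elim exE conjE) (rule that)
  have bij: "bij_betw (\<eta> X Y) (carrier (Hom (lower_quotient C) X Y))
                     (carrier (dual_space K (Ext C Y (\<tau>o X))))" if "X \<in> Ob C" "Y \<in> Ob C" for X Y
    using hb that by blast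
  note nat = hn[rule_format]
  note Obl = lower_quotient_simps(1) upper_quotient_simps(1)
  obtain Go Gm where Go: "is_functor (upper_quotient C) (lower_quotient C) Go Gm"
    and ni: "naturally_isomorphic (upper_quotient C) (upper_quotient C) (\<tau>o \<circ> Go) (\<tau>m \<circ> Gm) id id"
    using eqv unfolding is_equivalence_def by blast
  obtain \<Theta> where nt: "\<forall>X \<in> Ob C. iso_mor (upper_quotient C) ((\<tau>o \<circ> Go) X) (id X) (\<Theta> X)"
    using ni unfolding naturally_isomorphic_def Obl by blast
  \<comment> \<open>The quasi-inverse gives \<open>\<tau>o Q\<close> isomorphic to \<open>A\<close>
    only in the upper quotient. The morphisms \<open>\<iota>\<close> and \<open>\<kappa>\<close>
    transport extensions between the two objects in \<open>C\<close> itself.\<close>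
  define Q where "Q = Go A"
  have Q: "Q \<in> Ob C" unfolding Q_def using Go A unfolding is_functor_def Obl by simp
  have tQ: "\<tau>o Q \<in> Ob C"
  proof -
    have "is_functor (lower_quotient C) (upper_quotient C) \<tau>o \<tau>m"
      using eqv unfolding is_equivalence_def by (rule conjunct1)
    then show ?thesis using Q unfolding is_functor_def Obl by simp
  qed
  have "iso_mor (upper_quotient C) (\<tau>o Q) A (\<Theta> A)" using nt A unfolding Q_def by simp
  then obtain \<iota> \<kappa> where \<iota>: "arr C \<iota> (\<tau>o Q) A" and \<kappa>: "arr C \<kappa> A (\<tau>o Q)"
    and push_ik: "\<And>\<theta> Z. extn C \<theta> Z A \<Longrightarrow> push C \<iota> (push C \<kappa> \<theta>) = \<theta>"
    using upper_quotient_iso_push[OF _ A tQ] by blast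
  have "\<exists>v. arr C v Q Z \<and> pull C v \<theta> \<noteq> \<zero>\<^bsub>Ext C Q A\<^esub>" if th: "extn C \<theta> Z A" "\<theta> \<noteq> \<zero>\<^bsub>Ext C Z A\<^esub>" for Z \<theta>
  proof -
    have Z: "Z \<in> Ob C" using th by (simp add: extn_def)
    let ?\<theta> = "push C \<kappa> \<theta>"
    have e: "extn C ?\<theta> Z (\<tau>o Q)" using push_extn[OF th(1) \<kappa>] .
    have "?\<theta> \<noteq> \<zero>\<^bsub>Ext C Z (\<tau>o Q)\<^esub>" using push_ik[OF th(1)] push_zero[OF Z \<iota>] th(2) by auto
    then obtain \<psi> where \<psi>: "\<psi> \<in> LinearCombinations.module_hom K (Ext C Z (\<tau>o Q)) (scalar_space K)" "\<psi> ?\<theta> \<noteq> \<zero>\<^bsub>K\<^esub>"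
      using functional_nonzero[OF Ext_vectorspace[OF Z tQ]] fin Z tQ e unfolding ext_finite_def extn_def by blast
    interpret EZ: vectorspace K "Ext C Z (\<tau>o Q)" using Ext_vectorspace Z tQ .
    have "restrict \<psi> (carrier (Ext C Z (\<tau>o Q))) \<in> carrier (dual_space K (Ext C Z (\<tau>o Q)))"
      using \<psi>(1) unfolding dual_space_def module_hom_def by auto
    then obtain u where u: "u \<in> carrier (Hom (lower_quotient C) Q Z)"
        "\<eta> Q Z u = restrict \<psi> (carrier (Ext C Z (\<tau>o Q)))"
      using bij[OF Q Z] unfolding bij_betw_def by (metis imageE)
    obtain v where v: "arr C v Q Z" "u = lower_ideal C Q Z +>\<^bsub>Hom C Q Z\<^esub> v"
      using u(1) Q Z unfolding lower_quotient_simps A_RCOSETS_def' by auto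
    have idm: "ident (lower_quotient C) Q \<in> carrier (Hom (lower_quotient C) Q Q)"
      unfolding lower_quotient_simps A_RCOSETS_def' using Q by auto
    \<comment> \<open>Naturality in the second argument, evaluated at the identity of
      \<open>Q\<close> as in the Yoneda lemma.\<close>
    have eq: "\<psi> \<delta> = \<eta> Q Q (ident (lower_quotient C) Q) (pull C v \<delta>)" if "extn C \<delta> Z (\<tau>o Q)" for \<delta>
      using nat[OF Q Q Z idm u(1), of v \<delta>] lower_quotient_ident_right[OF Q Z u(1)] u(2) coset_self[OF v(1) lower_ideal_zero[OF Q Z]] v(2) that by (simp add: extn_def)
    have "\<eta> Q Q (ident (lower_quotient C) Q) \<in> carrier (dual_space K (Ext C Q (\<tau>o Q)))"
      using bij[OF Q Q] idm unfolding bij_betw_def by blast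
    then have add: "\<eta> Q Q (ident (lower_quotient C) Q) \<in> LinearCombinations.module_hom K (Ext C Q (\<tau>o Q)) (scalar_space K)"
      by (simp add: dual_space_def)
    interpret EQ: vectorspace K "Ext C Q (\<tau>o Q)" using Ext_vectorspace Q tQ .
    have "\<eta> Q Q (ident (lower_quotient C) Q) \<zero>\<^bsub>Ext C Q (\<tau>o Q)\<^esub> = \<zero>\<^bsub>K\<^esub>"
      (is "?c = _")
    proof -
      have "?c \<in> carrier K" using module_hom_closed[OF add] by (auto simp: scalar_space_def)
      moreover have "?c \<oplus>\<^bsub>K\<^esub> ?c = ?c"
        using module_hom_add[OF add, of "\<zero>\<^bsub>Ext C Q (\<tau>o Q)\<^esub>" "\<zero>\<^bsub>Ext C Q (\<tau>o Q)\<^esub>"]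
        by (simp add: scalar_space_def)
      ultimately show ?thesis using abelian_group.r_neg1[OF ring.is_abelian_group[OF cring.axioms(1)[OF fieldE(1)[OF base_field]]], of ?c ?c]
          abelian_group.l_neg[OF ring.is_abelian_group[OF cring.axioms(1)[OF fieldE(1)[OF base_field]]], of ?c] by simp
    qed
    then have "pull C v ?\<theta> \<noteq> \<zero>\<^bsub>Ext C Q (\<tau>o Q)\<^esub>" using eq[OF e] \<psi>(2) by auto
    then have "pull C v \<theta> \<noteq> \<zero>\<^bsub>Ext C Q A\<^esub>"
      using push_pull_comm[OF th(1) \<kappa> v(1)] push_zero[OF Q \<kappa>] by auto
    then show ?thesis using v(1) by blast
  qed
  then show ?thesis using Q unfolding detects_def by blast
qed

text \<open>A socle element is killed by restriction along nonretractions. If a nonsection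
  \<open>f\<close> did not kill it, the deflation realizing the pushforward would be no retraction,
  so the element would restrict to zero along it. By exactness a morphism \<open>u\<close> would map
  the pushforward back to the element, contradicting \<open>push_nonsection_fixed\<close>.\<close>

lemma ex_almost_split:
  assumes ars: "ARS_duality K C" and fin: "ext_finite K C" and ks: "krull_schmidt C"
    and A: "local_ob A" and th: "extn C \<theta> Z A" "\<theta> \<noteq> \<zero>\<^bsub>Ext C Z A\<^esub>"
  shows "\<exists>B \<epsilon>. almost_split C B A \<epsilon> \<and> B \<in> Ob C"
proof -
  have AO: "A \<in> Ob C" using A by (rule local_ob_Ob)
  obtain Q where Q: "detects Q A" using ARS_detects[OF ars fin AO] by blast
  obtain Bs where Bs: "dsum Bs Q" "\<And>B. B \<in> set Bs \<Longrightarrow> local_ob B"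
    using ex_local_dsum[OF ks, of Q] Q unfolding detects_def by blast
  obtain B k where B: "B \<in> set Bs" "arr C k B Z" "pull C k \<theta> \<noteq> \<zero>\<^bsub>Ext C B A\<^esub>"
    "\<And>W g. arr C g W B \<Longrightarrow> \<not> retraction_mor C W B g \<Longrightarrow> pull C g (pull C k \<theta>) = \<zero>\<^bsub>Ext C W A\<^esub>"
    using ex_socle_element[OF fin Q Bs th] by blast
  let ?e = "pull C k \<theta>"
  have e: "extn C ?e B A" using pull_extn[OF th(1) B(2)] .
  have "push C f ?e = \<zero>\<^bsub>Ext C B X\<^esub>" if f: "arr C f A X" "\<not> section_mor C A X f" for f X
  proof (rule ccontr)
    assume ne: "push C f ?e \<noteq> \<zero>\<^bsub>Ext C B X\<^esub>"
    have fe: "extn C (push C f ?e) B X" using push_extn[OF e f(1)] .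
    obtain x M m where r: "realized_by C (push C f ?e) X x M m B" using ex_realization[OF fe] by blast
    have m: "arr C m M B" using realized_typed[OF r] by blast
    have O: "M \<in> Ob C" "B \<in> Ob C" "X \<in> Ob C" using m f by auto
    have "\<not> retraction_mor C M B m"
    proof
      assume "retraction_mor C M B m"
      then obtain s where s: "arr C s B M" "m \<cdot> s = ident C B" using retraction_mor_iff O by blast
      then have "push C f ?e = pull C s (pull C m (push C f ?e))" using pull_comp[OF fe m s(1)] pull_id[OF fe] by simp
      then show False using ne pull_deflation[OF r] pull_zero[OF O(3) s(1)] by simp
    qed
    then have "pull C m ?e = \<zero>\<^bsub>Ext C M A\<^esub>" using B(4) m by blast
    then obtain u where u: "arr C u X A" "push C u (push C f ?e) = ?e" using push_of_pull_zero[OF r e] by blast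
    then have "push C (u \<cdot> f) ?e = ?e" using push_comp[OF e f(1) u(1)] by simp
    then show False using push_nonsection_fixed[OF A e f u(1)] B(3) by blast
  qed
  then have "almost_split C B A ?e"
    using B(3,4) e unfolding almost_split_def extn_def arr_def by blast
  then show ?thesis using e by (auto simp: extn_def)
qed

text \<open>Both pushouts along the inflations \<open>A \<rightarrow> M\<close> and \<open>A \<rightarrow> W\<close> are split, because
  neither inflation is a section.\<close>

lemma socle_middle_terms:
  assumes e: "realized_by C \<epsilon> A m M n B" "\<epsilon> \<noteq> \<zero>\<^bsub>Ext C B A\<^esub>"
      "\<And>X f. arr C f A X \<Longrightarrow> \<not> section_mor C A X f \<Longrightarrow> push C f \<epsilon> = \<zero>\<^bsub>Ext C B X\<^esub>"
    and d: "realized_by C \<delta> A a W w Y" "\<delta> \<noteq> \<zero>\<^bsub>Ext C Y A\<^esub>"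
      "\<And>X f. arr C f A X \<Longrightarrow> \<not> section_mor C A X f \<Longrightarrow> push C f \<delta> = \<zero>\<^bsub>Ext C Y X\<^esub>"
  shows "\<exists>V. dsum [W, B] V \<and> dsum [M, Y] V"
proof -
  have nonsec: "\<not> section_mor C A X x" if r: "realized_by C \<eta> A x X z Z" and ne: "\<eta> \<noteq> \<zero>\<^bsub>Ext C Z A\<^esub>" for \<eta> x X z Z
  proof
    assume s: "section_mor C A X x"
    have x: "arr C x A X" "extn C \<eta> Z A" using realized_typed[OF r] by blast+
    then obtain q where q: "arr C q X A" "q \<cdot> x = ident C A"
      using section_morE[OF s] by (metis arr_iff)
    have "\<eta> = push C q (push C x \<eta>)" using push_comp[OF x(2,1) q(1)] q(2) push_id[OF x(2)] by simp
    then show False using ne push_inflation[OF r] push_zero[of Z q X A] q(1) x(2) by (simp add: extn_def)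
  qed
  have ext: "extn C \<epsilon> B A" "extn C \<delta> Y A" using realized_typed e(1) d(1) by blast+
  obtain V x1 W1 w1 x2 W2 w2 u1 v1 u2 v2 where
    r: "realized_by C \<epsilon> A w1 W1 x1 B" "realized_by C \<delta> A w2 W2 x2 Y"
    "realized_by C (push C w2 \<epsilon>) W2 v1 V u1 B" "realized_by C (push C w1 \<delta>) W1 v2 V u2 Y"
    by (rule pushout_pair[OF ext])
  have "push C w2 \<epsilon> = \<zero>\<^bsub>Ext C B W2\<^esub>" "push C w1 \<delta> = \<zero>\<^bsub>Ext C Y W1\<^esub>"
    using e(3)[of w2 W2] d(3)[of w1 W1] nonsec[OF r(1) e(2)] nonsec[OF r(2) d(2)] realized_typed[OF r(1)] realized_typed[OF r(2)]
    by blast+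
  then obtain j p j' p' where "biproduct C W2 B V v1 j p u1" "biproduct C W1 Y V v2 j' p' u2"
    using r(3,4) realized_zero_biproduct by metis
  then have ds: "dsum [W2, B] V" "dsum [W1, Y] V"
    using direct_sum_pair direct_sum_iff_dsum by blast+
  have "isomorphic C W2 W" "isomorphic C W1 M" using realized_isomorphic r(1,2) e(1) d(1) by blast+
  moreover have "isomorphic C B B" "isomorphic C Y Y" using isomorphic_refl ext by (auto simp: extn_def)
  ultimately have "dsum [W, B] V" "dsum [M, Y] V"
    using dsum_component_iso[OF _ ds(1), of "[W, B]"] dsum_component_iso[OF _ ds(2), of "[M, Y]"]
    by (simp_all del: dsum.simps)
  then show ?thesis by blast
qed

end

section \<open>Counting by dimensions\<close>

text \<open>Common ground of Hom(-, A), of Hom(F-, FA) and of their subfunctors, for all of which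
  dimensions have to be added along direct sums.\<close>

locale contravariant_functor = linear_category K C
  for K :: "'k ring" and C :: "('k, 'o, 'm, 'x) lincat_scheme" (structure) +
  fixes V :: "'o \<Rightarrow> ('k, 'v) module" and act :: "'m \<Rightarrow> 'v \<Rightarrow> 'v"
  assumes vs: "X \<in> Ob C \<Longrightarrow> vectorspace K (V X)"
    and act_hom: "arr C f X Y \<Longrightarrow> act f \<in> LinearCombinations.module_hom K (V Y) (V X)"
    and act_ident: "X \<in> Ob C \<Longrightarrow> v \<in> carrier (V X) \<Longrightarrow> act (ident C X) v = v"
    and act_cmp: "arr C f X Y \<Longrightarrow> arr C g Y Z \<Longrightarrow> v \<in> carrier (V Z) \<Longrightarrow> act (g \<cdot> f) v = act f (act g v)"
    and act_add: "arr C f X Y \<Longrightarrow> arr C g X Y \<Longrightarrow> v \<in> carrier (V Y) \<Longrightarrow>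
      act (f \<oplus>\<^bsub>Hom C X Y\<^esub> g) v = act f v \<oplus>\<^bsub>V X\<^esub> act g v"
begin

abbreviation fd :: "'o \<Rightarrow> bool" where "fd X \<equiv> vectorspace.fin_dim K (V X)"
abbreviation d :: "'o \<Rightarrow> nat" where "d X \<equiv> vectorspace.dim K (V X)"

lemma linear_act: "arr C f X Y \<Longrightarrow> linear_map K (V Y) (V X) (act f)"
  using act_hom by (intro linear_mapI vs) auto

lemma act_closed: "arr C f X Y \<Longrightarrow> v \<in> carrier (V Y) \<Longrightarrow> act f v \<in> carrier (V X)"
  using module_hom_closed[OF act_hom] by blast

lemma act_zero:
  assumes O: "X \<in> Ob C" "Y \<in> Ob C" and v: "v \<in> carrier (V Y)"
  shows "act \<zero>\<^bsub>Hom C X Y\<^esub> v = \<zero>\<^bsub>V X\<^esub>"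
proof -
  interpret vectorspace K "V X" using vs O by blast
  have z: "arr C \<zero>\<^bsub>Hom C X Y\<^esub> X Y" using O by simp
  have "act \<zero>\<^bsub>Hom C X Y\<^esub> v \<oplus>\<^bsub>V X\<^esub> act \<zero>\<^bsub>Hom C X Y\<^esub> v = act \<zero>\<^bsub>Hom C X Y\<^esub> v"
    using act_add[OF z z v] O by simp
  then show ?thesis using act_closed[OF z v] by (metis M.add.r_cancel_one)
qed

lemma retract_fd:
  assumes i: "arr C i A B" "arr C r B A" "r \<cdot> i = ident C A" and fd: "fd B"
  shows "fd A"
proof -
  have "inj_on (act r) (carrier (V A))"
  proof (rule inj_on_inverseI)
    fix v assume v: "v \<in> carrier (V A)"
    show "act i (act r v) = v" using act_cmp[OF i(1,2) v] act_ident[OF _ v] i by simp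
  qed
  then show ?thesis using linear_map.inj_fin_dim[OF linear_act[OF i(2)]] fd by blast
qed

lemma biproduct_act:
  assumes b: "biproduct C X Y B i j p q"
  shows "v \<in> carrier (V X) \<Longrightarrow> act i (act p v) = v" "v \<in> carrier (V Y) \<Longrightarrow> act j (act q v) = v"
    "v \<in> carrier (V Y) \<Longrightarrow> act i (act q v) = \<zero>\<^bsub>V X\<^esub>"
    "v \<in> carrier (V B) \<Longrightarrow> act p (act i v) \<oplus>\<^bsub>V B\<^esub> act q (act j v) = v"
proof -
  note s = biproduct_simps[OF b]
  have t: "arr C i X B" "arr C j Y B" "arr C p B X" "arr C q B Y" using s by auto
  show "v \<in> carrier (V X) \<Longrightarrow> act i (act p v) = v" using act_cmp[OF t(1,3)] s act_ident by metis
  show "v \<in> carrier (V Y) \<Longrightarrow> act j (act q v) = v" using act_cmp[OF t(2,4)] s act_ident by metis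
  show "v \<in> carrier (V Y) \<Longrightarrow> act i (act q v) = \<zero>\<^bsub>V X\<^esub>"
    using act_cmp[OF t(1,4)] s act_zero[of X Y v] by simp
  show "act p (act i v) \<oplus>\<^bsub>V B\<^esub> act q (act j v) = v" if v: "v \<in> carrier (V B)"
  proof -
    have "act (i \<cdot> p \<oplus>\<^bsub>Hom C B B\<^esub> j \<cdot> q) v = act (i \<cdot> p) v \<oplus>\<^bsub>V B\<^esub> act (j \<cdot> q) v"
      using act_add[of "i \<cdot> p" B B "j \<cdot> q" v] t v by simp
    then show ?thesis using act_cmp[OF t(3,1) v] act_cmp[OF t(4,2) v] s(20) act_ident[OF s(15) v] by simp
  qed
qed

lemma biproduct_fd:
  assumes b: "biproduct C X Y B i j p q" and fd: "fd X" "fd Y"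
  shows "fd B"
proof -
  note s = biproduct_simps[OF b]
  have t: "arr C i X B" "arr C j Y B" "arr C p B X" "arr C q B Y" using s by auto
  show ?thesis
  proof (rule generated_by_two_fin_dim[OF vs[OF s(15)] vs[OF s(13)] vs[OF s(14)] act_hom[OF t(3)] act_hom[OF t(4)] _ fd])
    fix v assume v: "v \<in> carrier (V B)"
    show "\<exists>x \<in> carrier (V X). \<exists>y \<in> carrier (V Y). v = act p x \<oplus>\<^bsub>V B\<^esub> act q y"
      using biproduct_act(4)[OF b v] act_closed[OF t(1) v] act_closed[OF t(2) v] by metis
  qed
qed

lemma biproduct_d:
  assumes b: "biproduct C X Y B i j p q" and fd: "fd B"
  shows "d B = d X + d Y"
proof -
  note s = biproduct_simps[OF b]
  have t: "arr C i X B" "arr C j Y B" "arr C p B X" "arr C q B Y" using s by auto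
  show ?thesis
    by (rule biproduct_dim[OF vs[OF s(15)] vs[OF s(13)] vs[OF s(14)] act_hom[OF t(1)] act_hom[OF t(2)]
      act_hom[OF t(3)] act_hom[OF t(4)]]) (use biproduct_act[OF b] fd in auto)
qed

lemma zero_ob_carrier: "is_zero_object C N \<Longrightarrow> carrier (V N) = {\<zero>\<^bsub>V N\<^esub>}"
proof -
  assume N: "is_zero_object C N"
  then have O: "N \<in> Ob C" "ident C N = \<zero>\<^bsub>Hom C N N\<^esub>" by (auto simp: zero_ob_ident)
  interpret vectorspace K "V N" using vs O(1) .
  show ?thesis using act_ident[OF O(1)] act_zero[OF O(1,1)] O(2) by auto
qed

lemma zero_ob_fd:
  assumes N: "is_zero_object C N"
  shows "fd N" "d N = 0"
proof -
  interpret vectorspace K "V N" using vs zero_ob_Ob N by blast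
  have g: "gen_set {\<zero>\<^bsub>V N\<^esub>}"
    using zero_ob_carrier[OF N] span_is_subset2[of "{\<zero>\<^bsub>V N\<^esub>}"] span_zero[of "{\<zero>\<^bsub>V N\<^esub>}"] by auto
  then show "fd N" unfolding fin_dim_def using zero_ob_carrier[OF N] by (intro exI[of _ "{\<zero>\<^bsub>V N\<^esub>}"]) auto
  show "d N = 0" using dim0I[OF g] .
qed

lemma dsum_fd: "dsum As X \<Longrightarrow> (\<And>A. A \<in> set As \<Longrightarrow> fd A) \<Longrightarrow> fd X"
proof (induction As arbitrary: X)
  case (Cons A As)
  then obtain S i j p q where b: "biproduct C A S X i j p q" "dsum As S" by auto
  show ?case using biproduct_fd[OF b(1)] Cons.IH[OF b(2)] Cons.prems(2) by simp
qed (simp add: zero_ob_fd)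

lemma dsum_d: "dsum As X \<Longrightarrow> fd X \<Longrightarrow> d X = sum_list (map d As)"
proof (induction As arbitrary: X)
  case (Cons A As)
  then obtain S i j p q where b: "biproduct C A S X i j p q" "dsum As S" by auto
  have "fd S" using retract_fd[of j S X q] biproduct_simps[OF b(1)] Cons.prems(2) by simp
  then show ?case using biproduct_d[OF b(1) Cons.prems(2)] Cons.IH[OF b(2)] by simp
qed (simp add: zero_ob_fd)

lemma subfunctor:
  assumes sub: "\<And>X. X \<in> Ob C \<Longrightarrow> VectorSpace.subspace K (W X) (V X)"
    and cl: "\<And>f X Y v. arr C f X Y \<Longrightarrow> v \<in> W Y \<Longrightarrow> act f v \<in> W X"
  shows "contravariant_functor K C (\<lambda>X. V X\<lparr>carrier := W X\<rparr>) act"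
proof (intro contravariant_functor.intro contravariant_functor_axioms.intro)
  have W: "v \<in> carrier (V X)" if "X \<in> Ob C" "v \<in> W X" for X v
    using sub[OF that(1)] that(2) unfolding subspace_def submodule_def by blast
  show "linear_category K C" by (rule linear_category_axioms)
  show "vectorspace K (V X\<lparr>carrier := W X\<rparr>)" if "X \<in> Ob C" for X
    using vectorspace.subspace_is_vs[OF vs[OF that] sub[OF that]] .
  show "act f \<in> LinearCombinations.module_hom K (V Y\<lparr>carrier := W Y\<rparr>) (V X\<lparr>carrier := W X\<rparr>)" if f: "arr C f X Y" for f X Y
  proof -
    have Y: "Y \<in> Ob C" using f by simp
    have "act f \<in> W Y \<rightarrow> W X" using cl[OF f] by blast
    then show ?thesis
      using module_hom_add[OF act_hom[OF f]] module_hom_smult[OF act_hom[OF f]] W[OF Y]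
      by (simp add: module_hom_def)
  qed
  show "act (ident C X) v = v" if "X \<in> Ob C" "v \<in> carrier (V X\<lparr>carrier := W X\<rparr>)" for X v
    using act_ident[OF that(1) W[OF that(1)]] that(2) by simp
  show "act (g \<cdot> f) v = act f (act g v)" if "arr C f X Y" "arr C g Y Z" "v \<in> carrier (V Z\<lparr>carrier := W Z\<rparr>)" for f g X Y Z v
    using act_cmp[OF that(1,2) W] that(2,3) by simp
  show "act (f \<oplus>\<^bsub>Hom C X Y\<^esub> g) v = act f v \<oplus>\<^bsub>V X\<lparr>carrier := W X\<rparr>\<^esub> act g v"
    if "arr C f X Y" "arr C g X Y" "v \<in> carrier (V Y\<lparr>carrier := W Y\<rparr>)" for f g X Y v
    using act_add[OF that(1,2) W] that(2,3) by simp
qed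

text \<open>The dimensions of V and of its subfunctor W are both additive along the components of X,
  and only the copies of A contribute to the difference. With nonretractions as W, this determines
  the multiplicity of A as soon as the codimension at A is positive.\<close>

lemma codimension_counts:
  assumes sub: "\<And>X. X \<in> Ob C \<Longrightarrow> VectorSpace.subspace K (W X) (V X)"
    and cl: "\<And>f X Y v. arr C f X Y \<Longrightarrow> v \<in> W Y \<Longrightarrow> act f v \<in> W X"
    and fdX: "fd X" and As: "dsum As X" and eq: "\<And>B. B \<in> set As \<Longrightarrow> B \<noteq> A \<Longrightarrow> W B = carrier (V B)"
  shows "int (d X) - int (vectorspace.dim K (V X\<lparr>carrier := W X\<rparr>))
    = int (count_list As A) * (int (d A) - int (vectorspace.dim K (V A\<lparr>carrier := W A\<rparr>)))"
proof -
  interpret w: contravariant_functor K C "\<lambda>X. V X\<lparr>carrier := W X\<rparr>" act using subfunctor[OF sub cl] .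
  have O: "X \<in> Ob C" "set As \<subseteq> Ob C" using dsum_Ob[OF As] by auto
  have wfd: "w.fd X" using vectorspace.subspace_fin_dim[OF vs[OF O(1)] fdX sub[OF O(1)]] .
    have "sum_list (map (\<lambda>B. int (d B) - int (w.d B)) Bs) = int (count_list Bs A) * (int (d A) - int (w.d A))"
      if "set Bs \<subseteq> set As" for Bs
      using that
    proof (induction Bs)
      case (Cons B Bs)
      have "w.d B = d B" if "B \<noteq> A" using eq[of B] Cons.prems that by simp
      then show ?case using Cons by (auto simp: algebra_simps)
    qed simp
    from this[of As] have "(\<Sum>B\<leftarrow>As. int (d B) - int (w.d B)) = int (count_list As A) * (int (d A) - int (w.d A))" by simp
    moreover have "(\<Sum>B\<leftarrow>As. int (d B) - int (w.d B)) = int (d X) - int (w.d X)"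
      unfolding dsum_d[OF As fdX] w.dsum_d[OF As wfd] by (induction As) auto
    ultimately show ?thesis by simp
qed

end

context linear_category
begin

section \<open>The radical of Hom(-, A)\<close>

lemma Hom_functor:
  assumes A: "A \<in> Ob C"
  shows "contravariant_functor K C (\<lambda>X. Hom C X A) (\<lambda>f g. g \<cdot> f)"
proof (intro contravariant_functor.intro contravariant_functor_axioms.intro)
  show "(\<lambda>g. g \<cdot> f) \<in> LinearCombinations.module_hom K (Hom C Y A) (Hom C X A)" if "arr C f X Y" for f X Y
    using cmp_left_map[of f A] that A by simp
qed (use A linear_category_axioms Hom_vectorspace in auto)

text \<open>For local A this is the radical of \<open>Hom C X A\<close>; without locality it need
  not be a subspace.\<close>

definition nonretractions :: "'o \<Rightarrow> 'o \<Rightarrow> 'm set" where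
  "nonretractions A X = {f. arr C f X A \<and> \<not> retraction_mor C X A f}"

lemma nonretractions_cmp: "arr C f X Y \<Longrightarrow> g \<in> nonretractions A Y \<Longrightarrow> g \<cdot> f \<in> nonretractions A X"
  unfolding nonretractions_def using retraction_cmp_right arr_cmp by blast

lemma nonretractions_subspace:
  assumes A: "local_ob A" and X: "X \<in> Ob C"
  shows "VectorSpace.subspace K (nonretractions A X) (Hom C X A)"
proof -
  have O: "A \<in> Ob C" and ne: "ident C A \<noteq> \<zero>\<^bsub>Hom C A A\<^esub>" using A by (auto simp: local_ob_def)
  interpret vectorspace K "Hom C X A" using Hom_vectorspace X O .
  show ?thesis
  proof (rule subspaceI)
    show "nonretractions A X \<subseteq> carrier (Hom C X A)" using X O by (auto simp: nonretractions_def)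
    have "\<not> retraction_mor C X A \<zero>\<^bsub>Hom C X A\<^esub>"
      using retraction_mor_iff[of X A "\<zero>\<^bsub>Hom C X A\<^esub>"] X O ne by auto
    then show "\<zero>\<^bsub>Hom C X A\<^esub> \<in> nonretractions A X" using X O by (simp add: nonretractions_def)
    show "f \<oplus>\<^bsub>Hom C X A\<^esub> g \<in> nonretractions A X" if "f \<in> nonretractions A X" "g \<in> nonretractions A X" for f g
      using that local_retraction_add[OF A, of f X g] unfolding nonretractions_def by auto
    show "c \<odot>\<^bsub>Hom C X A\<^esub> f \<in> nonretractions A X" if c: "c \<in> carrier K" and f: "f \<in> nonretractions A X" for c f
    proof -
      have t: "arr C f X A" using f by (simp add: nonretractions_def)
      have "retraction_mor C X A f" if r: "retraction_mor C X A (c \<odot>\<^bsub>Hom C X A\<^esub> f)"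
      proof -
        obtain s where s: "arr C s A X" "(c \<odot>\<^bsub>Hom C X A\<^esub> f) \<cdot> s = ident C A"
          using r retraction_mor_iff X O by blast
        then have "f \<cdot> (c \<odot>\<^bsub>Hom C A X\<^esub> s) = ident C A" "arr C (c \<odot>\<^bsub>Hom C A X\<^esub> s) A X" using t c by auto
        then show ?thesis using retraction_mor_iff t by blast
      qed
      then show ?thesis using f t c by (auto simp: nonretractions_def)
    qed
  qed
qed

text \<open>A retraction between local objects is an isomorphism.\<close>

lemma nonretractions_all:
  assumes A: "local_ob A" and B: "local_ob B" and ni: "\<not> isomorphic C B A"
  shows "nonretractions A B = carrier (Hom C B A)"
  using local_retraction_isomorphic[OF B _ _ local_ob_Ob[OF A]] A ni local_ob_Ob[OF B]
  unfolding nonretractions_def local_ob_def by auto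

lemma ident_not_nonretraction: "A \<in> Ob C \<Longrightarrow> ident C A \<notin> nonretractions A A"
  unfolding nonretractions_def using retraction_mor_iff[of A A "ident C A"] by auto

end

text \<open>The space of all functions on a set, used as an ambient space:
  \<open>F_hom_space\<close> is a subspace of it, so the vector space axioms are verified pointwise
  here.\<close>

definition fun_space :: "'a set \<Rightarrow> ('k, 'v) module \<Rightarrow> ('k, 'a \<Rightarrow> 'v) module" where
  "fun_space S M = \<lparr>carrier = S \<rightarrow>\<^sub>E carrier M, mult = undefined, one = undefined,
     ring.zero = (\<lambda>u \<in> S. \<zero>\<^bsub>M\<^esub>), add = (\<lambda>\<phi> \<psi>. \<lambda>u \<in> S. \<phi> u \<oplus>\<^bsub>M\<^esub> \<psi> u),
     smult = (\<lambda>r \<phi>. \<lambda>u \<in> S. r \<odot>\<^bsub>M\<^esub> \<phi> u)\<rparr>"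

lemma fun_space_vectorspace:
  fixes K :: "'k ring"
  assumes M: "vectorspace K M"
  shows "vectorspace K (fun_space S M)"
proof -
  interpret vectorspace K M by (rule M)
  have ext: "\<phi> = \<psi>" if "\<phi> \<in> S \<rightarrow>\<^sub>E carrier M" "\<psi> \<in> S \<rightarrow>\<^sub>E carrier M" "\<And>u. u \<in> S \<Longrightarrow> \<phi> u = \<psi> u" for \<phi> \<psi>
    using that by (meson PiE_ext)
  have [simp]: "\<phi> u \<in> carrier M" if "\<phi> \<in> S \<rightarrow>\<^sub>E carrier M" "u \<in> S" for \<phi> u using that by auto
  show ?thesis
  proof (rule vs_criteria)
    show "field K" using M unfolding vectorspace_def by blast
    show "\<forall>v \<in> carrier (fun_space S M). \<exists>w \<in> carrier (fun_space S M). v \<oplus>\<^bsub>fun_space S M\<^esub> w = \<zero>\<^bsub>fun_space S M\<^esub>"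
    proof
      fix v assume "v \<in> carrier (fun_space S M)"
      then have v: "v \<in> S \<rightarrow>\<^sub>E carrier M" by (simp add: fun_space_def)
      have w: "(\<lambda>u \<in> S. \<ominus>\<^bsub>M\<^esub> v u) \<in> S \<rightarrow>\<^sub>E carrier M" using v by auto
      show "\<exists>w \<in> carrier (fun_space S M). v \<oplus>\<^bsub>fun_space S M\<^esub> w = \<zero>\<^bsub>fun_space S M\<^esub>"
        by (intro bexI[of _ "\<lambda>u \<in> S. \<ominus>\<^bsub>M\<^esub> v u"]) (use v w in \<open>auto simp: fun_space_def M.r_neg intro!: restrict_ext\<close>)
    qed
  qed (auto simp: fun_space_def M.a_ac smult_l_distr smult_r_distr smult_assoc1
      intro!: restrict_ext ext)
qed

context linear_category
begin

lemma mem_F_hom: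
  assumes "T \<in> Ob C" "X \<in> Ob C" "A \<in> Ob C"
  shows "\<phi> \<in> carrier (F_hom_space C T X A) \<longleftrightarrow> \<phi> \<in> carrier (Hom C T X) \<rightarrow>\<^sub>E carrier (Hom C T A) \<and>
    (\<forall>u v. arr C u T X \<longrightarrow> arr C v T X \<longrightarrow> \<phi> (u \<oplus>\<^bsub>Hom C T X\<^esub> v) = \<phi> u \<oplus>\<^bsub>Hom C T A\<^esub> \<phi> v) \<and>
    (\<forall>u a. arr C u T X \<longrightarrow> arr C a T T \<longrightarrow> \<phi> (u \<cdot> a) = \<phi> u \<cdot> a)"
  unfolding F_hom_space_def End_ring_def arr_def using assms by (auto simp del: mem_Hom_iff)

lemma F_homD:
  assumes "T \<in> Ob C" "X \<in> Ob C" "A \<in> Ob C" and p: "\<phi> \<in> carrier (F_hom_space C T X A)"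
  shows "\<And>u. arr C u T X \<Longrightarrow> arr C (\<phi> u) T A"
    "\<And>u v. arr C u T X \<Longrightarrow> arr C v T X \<Longrightarrow> \<phi> (u \<oplus>\<^bsub>Hom C T X\<^esub> v) = \<phi> u \<oplus>\<^bsub>Hom C T A\<^esub> \<phi> v"
    "\<And>u a. arr C u T X \<Longrightarrow> arr C a T T \<Longrightarrow> \<phi> (u \<cdot> a) = \<phi> u \<cdot> a"
    "\<phi> \<in> extensional (carrier (Hom C T X))"
  using p unfolding mem_F_hom[OF assms(1-3)] arr_def using assms(1-3) by (auto simp del: mem_Hom_iff simp: PiE_def)

lemma F_hom_eqI:
  assumes "T \<in> Ob C" "X \<in> Ob C" "A \<in> Ob C"
    "\<phi> \<in> extensional (carrier (Hom C T X))" "\<psi> \<in> extensional (carrier (Hom C T X))"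
    "\<And>u. arr C u T X \<Longrightarrow> \<phi> u = \<psi> u"
  shows "\<phi> = \<psi>"
  using assms by (intro extensionalityI[of _ "carrier (Hom C T X)"]) auto

lemma F_hom_ops:
  "\<zero>\<^bsub>F_hom_space C T X A\<^esub> = (\<lambda>u \<in> carrier (Hom C T X). \<zero>\<^bsub>Hom C T A\<^esub>)"
  "\<phi> \<oplus>\<^bsub>F_hom_space C T X A\<^esub> \<psi> = (\<lambda>u \<in> carrier (Hom C T X). \<phi> u \<oplus>\<^bsub>Hom C T A\<^esub> \<psi> u)"
  "r \<odot>\<^bsub>F_hom_space C T X A\<^esub> \<phi> = (\<lambda>u \<in> carrier (Hom C T X). r \<odot>\<^bsub>Hom C T A\<^esub> \<phi> u)"
  by (simp_all add: F_hom_space_def)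

lemma F_hom_vectorspace:
  assumes O: "T \<in> Ob C" "X \<in> Ob C" "A \<in> Ob C"
  shows "vectorspace K (F_hom_space C T X A)"
proof -
  let ?S = "carrier (Hom C T X)"
  interpret M: vectorspace K "Hom C T A" using Hom_vectorspace O by blast
  interpret F: vectorspace K "fun_space ?S (Hom C T A)" by (rule fun_space_vectorspace[OF Hom_vectorspace[OF O(1,3)]])
  have "VectorSpace.subspace K (carrier (F_hom_space C T X A)) (fun_space ?S (Hom C T A))"
  proof (rule F.subspaceI)
    show "carrier (F_hom_space C T X A) \<subseteq> carrier (fun_space ?S (Hom C T A))"
      by (auto simp: F_hom_space_def fun_space_def)
    show "\<zero>\<^bsub>fun_space ?S (Hom C T A)\<^esub> \<in> carrier (F_hom_space C T X A)"
      unfolding mem_F_hom[OF O] using O by (auto simp: fun_space_def)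
    show "\<phi> \<oplus>\<^bsub>fun_space ?S (Hom C T A)\<^esub> \<psi> \<in> carrier (F_hom_space C T X A)"
      if p: "\<phi> \<in> carrier (F_hom_space C T X A)" "\<psi> \<in> carrier (F_hom_space C T X A)" for \<phi> \<psi>
    proof -
      note d = F_homD[OF O p(1)] and e = F_homD[OF O p(2)]
      have "(\<phi> u \<oplus>\<^bsub>Hom C T A\<^esub> \<phi> v) \<oplus>\<^bsub>Hom C T A\<^esub> (\<psi> u \<oplus>\<^bsub>Hom C T A\<^esub> \<psi> v)
        = (\<phi> u \<oplus>\<^bsub>Hom C T A\<^esub> \<psi> u) \<oplus>\<^bsub>Hom C T A\<^esub> (\<phi> v \<oplus>\<^bsub>Hom C T A\<^esub> \<psi> v)" if "arr C u T X" "arr C v T X" for u v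
        using d(1)[OF that(1)] d(1)[OF that(2)] e(1)[OF that(1)] e(1)[OF that(2)] O
        by (simp add: M.module.M.a_ac)
      then show ?thesis unfolding mem_F_hom[OF O] using O d e by (auto simp: fun_space_def)
    qed
    show "c \<odot>\<^bsub>fun_space ?S (Hom C T A)\<^esub> \<phi> \<in> carrier (F_hom_space C T X A)"
      if c: "c \<in> carrier K" and p: "\<phi> \<in> carrier (F_hom_space C T X A)" for c \<phi>
    proof -
      note d = F_homD[OF O p]
      have "c \<odot>\<^bsub>Hom C T A\<^esub> (\<phi> u \<oplus>\<^bsub>Hom C T A\<^esub> \<phi> v) = c \<odot>\<^bsub>Hom C T A\<^esub> \<phi> u \<oplus>\<^bsub>Hom C T A\<^esub> c \<odot>\<^bsub>Hom C T A\<^esub> \<phi> v"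
        if "arr C u T X" "arr C v T X" for u v
        using M.smult_r_distr[OF c, of "\<phi> u" "\<phi> v"] d(1)[OF that(1)] d(1)[OF that(2)] O by simp
      then show ?thesis unfolding mem_F_hom[OF O] using O c d by (auto simp: fun_space_def)
    qed
  qed
  from F.subspace_is_vs[OF this] show ?thesis by (simp add: F_hom_space_def fun_space_def)
qed

text \<open>Precomposition with Ff, which makes Hom(F-, FA) a contravariant functor. The source is
  read off from \<open>f\<close>, so that the result is extensional on the right domain.\<close>

definition F_act :: "'o \<Rightarrow> 'm \<Rightarrow> ('m \<Rightarrow> 'm) \<Rightarrow> ('m \<Rightarrow> 'm)" where
  "F_act T f \<phi> = (\<lambda>u \<in> carrier (Hom C T (dm f)). \<phi> (f \<cdot> u))"

lemma F_act_mem: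
  assumes T: "T \<in> Ob C" and A: "A \<in> Ob C" and f: "arr C f X Y" and p: "\<phi> \<in> carrier (F_hom_space C T Y A)"
  shows "F_act T f \<phi> \<in> carrier (F_hom_space C T X A)"
proof -
  have O: "X \<in> Ob C" "Y \<in> Ob C" "dm f = X" using f by auto
  note d = F_homD[OF T O(2) A p]
  have "\<phi> (f \<cdot> (u \<cdot> a)) = \<phi> (f \<cdot> u) \<cdot> a" if "arr C u T X" "arr C a T T" for u a
    using d(3)[of "f \<cdot> u" a] that f by simp
  then show ?thesis unfolding mem_F_hom[OF T O(1) A] F_act_def O(3)
    using T A O f d(1,2) by auto
qed

lemma F_hom_functor:
  assumes T: "T \<in> Ob C" and A: "A \<in> Ob C"
  shows "contravariant_functor K C (\<lambda>X. F_hom_space C T X A) (F_act T)"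
proof (intro contravariant_functor.intro contravariant_functor_axioms.intro)
  show "linear_category K C" by (rule linear_category_axioms)
  show "vectorspace K (F_hom_space C T X A)" if "X \<in> Ob C" for X using F_hom_vectorspace T A that by blast
  show "F_act T f \<in> LinearCombinations.module_hom K (F_hom_space C T Y A) (F_hom_space C T X A)" if f: "arr C f X Y" for f X Y
  proof -
    have O: "X \<in> Ob C" "Y \<in> Ob C" "dm f = X" using f by auto
    have "F_act T f \<in> carrier (F_hom_space C T Y A) \<rightarrow> carrier (F_hom_space C T X A)"
      using F_act_mem[OF T A f] by blast
    then show ?thesis unfolding module_hom_def
      using T A f O by (auto simp: F_hom_ops F_act_def intro!: restrict_ext)
  qed
  show "F_act T (ident C X) \<phi> = \<phi>" if X: "X \<in> Ob C" and p: "\<phi> \<in> carrier (F_hom_space C T X A)" for X \<phi>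
    by (rule F_hom_eqI[OF T X A]) (use F_homD[OF T X A p] X T in \<open>auto simp: F_act_def\<close>)
  show "F_act T (g \<cdot> f) \<phi> = F_act T f (F_act T g \<phi>)" if f: "arr C f X Y" and g: "arr C g Y Z"
    and p: "\<phi> \<in> carrier (F_hom_space C T Z A)" for f g X Y Z \<phi>
    using f g T by (auto simp: F_act_def intro!: restrict_ext)
  show "F_act T (f \<oplus>\<^bsub>Hom C X Y\<^esub> g) \<phi> = F_act T f \<phi> \<oplus>\<^bsub>F_hom_space C T X A\<^esub> F_act T g \<phi>"
    if f: "arr C f X Y" and g: "arr C g X Y" and p: "\<phi> \<in> carrier (F_hom_space C T Y A)" for f g X Y \<phi>
  proof -
    have Y: "Y \<in> Ob C" using f by simp
    show ?thesis using f g T F_homD(2)[OF T Y A p] by (auto simp: F_act_def F_hom_ops intro!: restrict_ext)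
  qed
qed

definition F_map :: "'o \<Rightarrow> 'm \<Rightarrow> ('m \<Rightarrow> 'm)" where
  "F_map T f = (\<lambda>u \<in> carrier (Hom C T (dm f)). f \<cdot> u)"

lemma F_map_mem:
  assumes T: "T \<in> Ob C" and f: "arr C f X A"
  shows "F_map T f \<in> carrier (F_hom_space C T X A)"
proof -
  have O: "X \<in> Ob C" "A \<in> Ob C" "dm f = X" using f by auto
  show ?thesis unfolding mem_F_hom[OF T O(1,2)] F_map_def O(3) using T f by auto
qed

lemma F_map_linear:
  assumes T: "T \<in> Ob C" and O: "X \<in> Ob C" "A \<in> Ob C"
  shows "F_map T \<in> LinearCombinations.module_hom K (Hom C X A) (F_hom_space C T X A)"
proof -
  have "F_map T \<in> carrier (Hom C X A) \<rightarrow> carrier (F_hom_space C T X A)"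
    using F_map_mem[OF T, of _ X A] O by auto
  then show ?thesis unfolding module_hom_def
    using T O by (auto simp: F_hom_ops F_map_def intro!: restrict_ext)
qed

lemma F_act_F_map: "T \<in> Ob C \<Longrightarrow> arr C f X Y \<Longrightarrow> arr C g Y A \<Longrightarrow> F_act T f (F_map T g) = F_map T (g \<cdot> f)"
  by (auto simp: F_act_def F_map_def intro!: restrict_ext)

lemma F_nonretractions_subspace:
  assumes T: "T \<in> Ob C" and A: "local_ob A" and X: "X \<in> Ob C"
  shows "VectorSpace.subspace K (F_map T ` nonretractions A X) (F_hom_space C T X A)"
proof -
  have O: "A \<in> Ob C" using A by (rule local_ob_Ob)
  interpret linear_map K "Hom C X A" "F_hom_space C T X A" "F_map T"
    by (intro linear_mapI Hom_vectorspace F_hom_vectorspace F_map_linear T X O)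
  note sub = V.is_module[OF nonretractions_subspace[OF A X]]
  have "m \<in> carrier (Hom C X A)" if "m \<in> nonretractions A X" for m
    using submodule.subset[OF sub] that by blast
  then have "F_map T \<in> LinearCombinations.module_hom K (V.vs (nonretractions A X)) (F_hom_space C T X A)"
    unfolding module_hom_def by auto
  then interpret N: linear_map K "V.vs (nonretractions A X)" "F_hom_space C T X A" "F_map T"
    by (intro linear_mapI V.subspace_is_vs nonretractions_subspace A X W.vectorspace_axioms)
  show ?thesis using N.imT_is_subspace by (simp add: N.im_def)
qed

end

section \<open>Objects with zero cone\<close>

context extriangulated_category
begin

text \<open>The difference of the two morphisms kills \<open>\<delta>\<close>, so it extends along
  an inflation into the zero object and vanishes. Thus Hom(U, W) embeds in E(S, W).\<close>

lemma cone_zero_push_inj: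
  assumes r: "realized_by C \<delta> U n M m S" and M: "is_zero_object C M"
    and f: "arr C f U W" "arr C g U W" and eq: "push C f \<delta> = push C g \<delta>"
  shows "f = g"
proof -
  note t = realized_typed[OF r]
  let ?d = "f \<oplus>\<^bsub>Hom C U W\<^esub> \<ominus>\<^bsub>Hom C U W\<^esub> g"
  have d: "arr C ?d U W" using f by simp
  obtain h where h: "arr C h M W" "h \<cdot> n = ?d"
    using extend_along_inflation[OF r d push_diff_zero[OF t(3) f eq]] by blast
  have "h = \<zero>\<^bsub>Hom C M W\<^esub>" using arr_from_zero_ob[OF M h(1)] .
  then have "?d = \<zero>\<^bsub>Hom C U W\<^esub>" using h t f by auto
  then show ?thesis using diff_zero_eq[of f U W g] f by simp
qed

lemmas cone_zero_pull_inj = extriangulated_category.cone_zero_push_inj[OF opposite_extriangulated, unfolded opposite_unfold]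

text \<open>S is a suspension of U. The zero object in the middle is not fixed, so that sums and
  summands of such conflations have the same shape.\<close>

definition cone_zero :: "'o \<Rightarrow> 'o \<Rightarrow> bool" where
  "cone_zero U S \<longleftrightarrow> (\<exists>\<delta> n M m. is_zero_object C M \<and> realized_by C \<delta> U n M m S)"

lemma cone_zeroE:
  assumes "cone_zero U S"
  obtains \<delta> n M m where "is_zero_object C M" "realized_by C \<delta> U n M m S"
  using assms unfolding cone_zero_def by blast

text \<open>The identity of U extends by (ET3) to morphisms between the cones in both directions.
  Their composites fix the extensions under restriction, and restriction is injective here.\<close>

lemma cone_zero_unique:
  assumes "cone_zero U S" "cone_zero U S'"
  shows "isomorphic C S S'"
proof -
  obtain \<delta> n M m where M: "is_zero_object C M" and r: "realized_by C \<delta> U n M m S" using assms(1) by (rule cone_zeroE)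
  obtain \<delta>' n' M' m' where M': "is_zero_object C M'" and r': "realized_by C \<delta>' U n' M' m' S'"
    using assms(2) by (rule cone_zeroE)
  note t = realized_typed[OF r] and t' = realized_typed[OF r']
  have O: "U \<in> Ob C" "M \<in> Ob C" "M' \<in> Ob C" "S \<in> Ob C" "S' \<in> Ob C" using t t' by auto
  have "\<zero>\<^bsub>Hom C M M'\<^esub> \<cdot> n = n' \<cdot> ident C U"
    using arr_to_zero_ob[OF M' t'(1)] t t' O by simp
  then obtain h where h: "arr C h S S'" "push C (ident C U) \<delta> = pull C h \<delta>'"
    using ET3_obtain[OF r r', of "ident C U" "\<zero>\<^bsub>Hom C M M'\<^esub>"] O by auto
  have "\<zero>\<^bsub>Hom C M' M\<^esub> \<cdot> n' = n \<cdot> ident C U"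
    using arr_to_zero_ob[OF M t(1)] t t' O by simp
  then obtain k where k: "arr C k S' S" "push C (ident C U) \<delta>' = pull C k \<delta>"
    using ET3_obtain[OF r' r, of "ident C U" "\<zero>\<^bsub>Hom C M' M\<^esub>"] O by auto
  have "pull C (k \<cdot> h) \<delta> = pull C (ident C S) \<delta>"
    using pull_comp[OF t(3) k(1) h(1)] h(2) k(2) push_id[OF t(3)] push_id[OF t'(3)] pull_id[OF t(3)] by simp
  then have 1: "k \<cdot> h = ident C S" using cone_zero_pull_inj[OF r M, of "k \<cdot> h" S "ident C S"] h k O by simp
  have "pull C (h \<cdot> k) \<delta>' = pull C (ident C S') \<delta>'"
    using pull_comp[OF t'(3) h(1) k(1)] h(2) k(2) push_id[OF t(3)] push_id[OF t'(3)] pull_id[OF t'(3)] by simp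
  then have 2: "h \<cdot> k = ident C S'" using cone_zero_pull_inj[OF r' M', of "h \<cdot> k" S' "ident C S'"] h k O by simp
  show ?thesis unfolding isomorphic_iff using h(1) k(1) 1 2 by blast
qed

lemma zero_ob_biproduct:
  assumes b: "biproduct C M M' B i j p q" and z: "is_zero_object C M" "is_zero_object C M'"
  shows "is_zero_object C B"
proof -
  note s = biproduct_simps[OF b]
  have "p = \<zero>\<^bsub>Hom C B M\<^esub>" "q = \<zero>\<^bsub>Hom C B M'\<^esub>"
    using arr_to_zero_ob[OF z(1), of p B] arr_to_zero_ob[OF z(2), of q B] s by auto
  then have "ident C B = \<zero>\<^bsub>Hom C B B\<^esub>" using s(1-15) s(20)[symmetric] by simp
  then show ?thesis using zero_obI s by simp
qed

lemma cone_zero_sum: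
  assumes c: "cone_zero U S" "cone_zero U' S'" and b: "biproduct C U U' A i j p q" "biproduct C S S' D i' j' p' q'"
  shows "cone_zero A D"
proof -
  obtain \<delta> n M m where M: "is_zero_object C M" and r: "realized_by C \<delta> U n M m S" using c(1) by (rule cone_zeroE)
  obtain \<delta>' n' M' m' where M': "is_zero_object C M'" and r': "realized_by C \<delta>' U' n' M' m' S'" using c(2) by (rule cone_zeroE)
  obtain B k l u v where b': "biproduct C M M' B k l u v" using ex_biproduct M M' zero_ob_Ob by blast
  show ?thesis unfolding cone_zero_def
    using realiz_sum[OF r r' b(1) b' b(2)] zero_ob_biproduct[OF b' M M'] by blast
qed

lemma cone_zero_zero: "is_zero_object C U \<Longrightarrow> is_zero_object C S \<Longrightarrow> cone_zero U S"
proof -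
  assume z: "is_zero_object C U" "is_zero_object C S"
  obtain B i j p q where b: "biproduct C U S B i j p q" using ex_biproduct z zero_ob_Ob by blast
  show ?thesis unfolding cone_zero_def using realiz_zero[OF b] zero_ob_biproduct[OF b z] by blast
qed

lemma cone_zero_powers:
  "cone_zero T S \<Longrightarrow> dsum (replicate n T) U \<Longrightarrow> dsum (replicate n S) V \<Longrightarrow> cone_zero U V"
proof (induction n arbitrary: U V)
  case (Suc n)
  then obtain U' i j p q V' i' j' p' q' where b: "biproduct C T U' U i j p q" "dsum (replicate n T) U'"
      "biproduct C S V' V i' j' p' q'" "dsum (replicate n S) V'" by auto
  show ?case using cone_zero_sum[OF Suc.prems(1) Suc.IH[OF Suc.prems(1) b(2,4)] b(1,3)] .
qed (simp add: cone_zero_zero)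

lemma ET4_obtain:
  assumes "realized_by C \<delta> X f Y f' Z'" "realized_by C \<delta>' Y g Z g' X'"
  obtains Y' h' d e \<delta>'' where "realized_by C \<delta>'' X (g \<cdot> f) Z h' Y'" "realized_by C (push C f' \<delta>') Z' d Y' e X'"
  using ET4 assms unfolding ET4_def by metis

text \<open>By (ET4), the inclusion of a summand followed by the inflation of U into a zero object
  is again an inflation.\<close>

lemma cone_zero_summand:
  assumes c: "cone_zero U S" and b: "biproduct C T1 T2 U i j p q"
  shows "\<exists>S1. cone_zero T1 S1"
proof -
  obtain \<delta> n M m where M: "is_zero_object C M" and r: "realized_by C \<delta> U n M m S" using c by (rule cone_zeroE)
  obtain Y' h' d e \<delta>'' where "realized_by C \<delta>'' T1 (n \<cdot> i) M h' Y'"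
    by (rule ET4_obtain[OF realiz_zero[OF b] r])
  then show ?thesis using M unfolding cone_zero_def by blast
qed

section \<open>Additive closures\<close>

lemma add_closure_iff:
  "X \<in> add_closure C T \<longleftrightarrow> (\<exists>Y S n i j p q. biproduct C X Y S i j p q \<and> dsum (replicate n T) S)"
  by (simp only: add_closure_def mem_Collect_eq direct_sum_pair direct_sum_iff_dsum[of "replicate n T" S for n S]) blast

lemma add_closure_summand:
  assumes b: "biproduct C X Y S i j p q" and S: "S \<in> add_closure C T"
  shows "X \<in> add_closure C T"
proof -
  obtain Y' U n i' j' p' q' where b': "biproduct C S Y' U i' j' p' q'" "dsum (replicate n T) U"
    using S unfolding add_closure_iff by blast
  obtain W k l m n' where w: "biproduct C Y Y' W k l m n'"
    using ex_biproduct biproduct_simps(14)[OF b] biproduct_simps(14)[OF b'(1)] by blast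
  show ?thesis unfolding add_closure_iff using biproduct_assoc[OF b b'(1) w] b'(2) by blast
qed

lemma add_closureE:
  assumes "X \<in> add_closure C T"
  obtains S n i r where "dsum (replicate n T) S" "arr C i X S" "arr C r S X" "r \<cdot> i = ident C X"
proof -
  obtain Y S n i j p q where b: "biproduct C X Y S i j p q" "dsum (replicate n T) S"
    using assms unfolding add_closure_iff by blast
  show ?thesis using that[OF b(2), of i p] biproduct_simps[OF b(1)] by simp
qed

lemma cone_zero_add_closure:
  assumes c: "cone_zero T S" and T1: "T1 \<in> add_closure C T"
  shows "\<exists>S1. cone_zero T1 S1" "cone_zero T1 S1 \<Longrightarrow> S1 \<in> add_closure C S"
proof -
  obtain T2 U n i j p q where b: "biproduct C T1 T2 U i j p q" "dsum (replicate n T) U"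
    using T1 unfolding add_closure_iff by blast
  have "S \<in> Ob C" using c realized_typed unfolding cone_zero_def by fastforce
  then obtain V where V: "dsum (replicate n S) V"
    using ex_dsum[of "replicate n S"] by (metis in_set_replicate subsetI)
  have UV: "cone_zero U V" using cone_zero_powers[OF c b(2) V] .
  show "\<exists>S1. cone_zero T1 S1" using cone_zero_summand[OF UV b(1)] .
  show "S1 \<in> add_closure C S" if S1: "cone_zero T1 S1"
  proof -
    obtain S2 where S2: "cone_zero T2 S2" using cone_zero_summand[OF UV biproduct_swap[OF b(1)]] by blast
    have "S1 \<in> Ob C" "S2 \<in> Ob C" using S1 S2 realized_typed unfolding cone_zero_def by fastforce+
    then obtain D i' j' p' q' where d: "biproduct C S1 S2 D i' j' p' q'" using ex_biproduct by blast
    \<comment> \<open>\<open>D\<close> is the sum of cones of \<open>T1\<close> and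
      \<open>T2\<close>, hence a cone of \<open>U\<close>, and cones are unique up to
      isomorphism.\<close>
    have "isomorphic C D V" using cone_zero_unique[OF cone_zero_sum[OF S1 S2 b(1) d] UV] .
    then obtain f g where f: "arr C f D V" "arr C g V D" "g \<cdot> f = ident C D" "f \<cdot> g = ident C V"
      unfolding isomorphic_iff by blast
    show ?thesis unfolding add_closure_iff using biproduct_iso[OF d f] V by blast
  qed
qed

lemma from_dsum_zero:
  "dsum As X \<Longrightarrow> (\<And>A u. A \<in> set As \<Longrightarrow> arr C u A X \<Longrightarrow> f \<cdot> u = \<zero>\<^bsub>Hom C A Y\<^esub>) \<Longrightarrow> arr C f X Y \<Longrightarrow> f = \<zero>\<^bsub>Hom C X Y\<^esub>"
proof (induction As arbitrary: X f)
  case (Cons A As)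
  then obtain S i j p q where b: "biproduct C A S X i j p q" "dsum As S" by auto
  note s = biproduct_simps[OF b(1)]
  have "f \<cdot> i = \<zero>\<^bsub>Hom C A Y\<^esub>" using Cons.prems(2)[of A i] s by simp
  moreover have "f \<cdot> j = \<zero>\<^bsub>Hom C S Y\<^esub>"
  proof (rule Cons.IH[OF b(2)])
    show "arr C (f \<cdot> j) S Y" using Cons.prems(3) s by simp
    fix A' u assume u: "A' \<in> set As" "arr C u A' S"
    show "(f \<cdot> j) \<cdot> u = \<zero>\<^bsub>Hom C A' Y\<^esub>" using Cons.prems(2)[of A' "j \<cdot> u"] u s Cons.prems(3) by simp
  qed
  ultimately have "f \<cdot> i \<cdot> p \<oplus>\<^bsub>Hom C X Y\<^esub> f \<cdot> j \<cdot> q = \<zero>\<^bsub>Hom C X Y\<^esub>" using s(1-15) Cons.prems(3) by simp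
  then show ?case using s(26)[of f] Cons.prems(3) s(1-15) by simp
next
  case (Nil X f)
  then show ?case using arr_from_zero_ob[of X f Y] by simp
qed

lemma from_add_closure_zero:
  assumes X: "X \<in> add_closure C T" and z: "\<And>u. arr C u T X \<Longrightarrow> f \<cdot> u = \<zero>\<^bsub>Hom C T Y\<^esub>" and f: "arr C f X Y"
  shows "f = \<zero>\<^bsub>Hom C X Y\<^esub>"
proof -
  obtain S n i r where S: "dsum (replicate n T) S" "arr C i X S" "arr C r S X" "r \<cdot> i = ident C X"
    using X by (rule add_closureE)
  have "f \<cdot> r = \<zero>\<^bsub>Hom C S Y\<^esub>"
  proof (rule from_dsum_zero[OF S(1)])
    show "arr C (f \<cdot> r) S Y" using f S by simp
    fix A u assume "A \<in> set (replicate n T)" "arr C u A S"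
    then show "(f \<cdot> r) \<cdot> u = \<zero>\<^bsub>Hom C A Y\<^esub>" using z[of "r \<cdot> u"] f S by auto
  qed
  then have "(f \<cdot> r) \<cdot> i = \<zero>\<^bsub>Hom C X Y\<^esub>" using S f by simp
  then show ?thesis using S f by simp
qed

text \<open>Biproducts are self-dual, with inclusions and projections exchanged.\<close>

lemma opposite_dsum [simp]: "linear_category.dsum (opposite C) As X \<longleftrightarrow> dsum As X"
proof -
  interpret opp: extriangulated_category K "opposite C" by (rule opposite_extriangulated)
  show ?thesis by (induction As arbitrary: X) (auto, metis+)
qed

lemma opposite_add_closure [simp]: "add_closure (opposite C) T = add_closure C T"
proof -
  interpret opp: extriangulated_category K "opposite C" by (rule opposite_extriangulated)
  show ?thesis unfolding set_eq_iff add_closure_iff opp.add_closure_iff opposite_notions opposite_dsum by blast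
qed

lemma pull_add_closure_zero:
  assumes X: "X \<in> add_closure C T" and z: "\<And>\<eta>. extn C \<eta> T A \<Longrightarrow> \<eta> = \<zero>\<^bsub>Ext C T A\<^esub>" and e: "extn C \<eta> X A"
  shows "\<eta> = \<zero>\<^bsub>Ext C X A\<^esub>"
proof -
  obtain S n i r where S: "dsum (replicate n T) S" "arr C i X S" "arr C r S X" "r \<cdot> i = ident C X"
    using X by (rule add_closureE)
  have A: "A \<in> Ob C" using e by (simp add: extn_def)
  have re: "extn C (pull C r \<eta>) S A" using pull_extn[OF e S(3)] .
  have "pull C r \<eta> = \<zero>\<^bsub>Ext C S A\<^esub>"
  proof (rule pull_dsum_zero[OF S(1) re])
    fix B k assume B: "B \<in> set (replicate n T)" "section_mor C B S k"
    then have "arr C k B S" using dsum_Ob[OF S(1)] by (auto simp: section_mor_def)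
    then show "pull C k (pull C r \<eta>) = \<zero>\<^bsub>Ext C B A\<^esub>" using z pull_extn[OF re] B by auto
  qed
  then show ?thesis using pull_comp[OF e S(3,2)] S(4) pull_id[OF e] pull_zero[OF A S(2)] by simp
qed

lemmas push_add_closure_zero =
  extriangulated_category.pull_add_closure_zero[OF opposite_extriangulated, unfolded opposite_unfold opposite_add_closure]

text \<open>Only extension spaces are known to be finite-dimensional; morphisms into a suspension of
  U embed in extensions by U.\<close>

lemma pull_realized_injective:
  assumes r: "realized_by C \<delta> U n M m S" and M: "is_zero_object C M" and X: "X \<in> Ob C"
    and ef: "ext_finite K C"
  shows "vectorspace.fin_dim K (Hom C X S)"
proof -
  note t = realized_typed[OF r]
  have O: "S \<in> Ob C" "U \<in> Ob C" using t by auto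
  interpret linear_map K "Hom C X S" "Ext C X U" "\<lambda>f. pull C f \<delta>" using linear_pull_mor[OF t(3) X] .
  have "inj_on (\<lambda>f. pull C f \<delta>) (carrier (Hom C X S))"
    using cone_zero_pull_inj[OF r M] X O by (intro inj_onI) auto
  moreover have "W.fin_dim" using ef X O unfolding ext_finite_def by blast
  ultimately show ?thesis using inj_fin_dim by blast
qed

lemma push_realized_injective:
  assumes r: "realized_by C \<delta> U n M m S" and M: "is_zero_object C M" and X: "X \<in> Ob C"
    and ef: "ext_finite K C"
  shows "vectorspace.fin_dim K (Hom C U X)"
proof -
  note t = realized_typed[OF r]
  have O: "S \<in> Ob C" "U \<in> Ob C" using t by auto
  interpret linear_map K "Hom C U X" "Ext C S X" "\<lambda>f. push C f \<delta>" using linear_push_mor[OF t(3) X] .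
  have "inj_on (\<lambda>f. push C f \<delta>) (carrier (Hom C U X))"
    using cone_zero_push_inj[OF r M] X O by (intro inj_onI) auto
  moreover have "W.fin_dim" using ef X O unfolding ext_finite_def by blast
  ultimately show ?thesis using inj_fin_dim by blast
qed

end

text \<open>The setting of a reduced 0-Auslander category: every object has a presentation of length
  one by a projective T, and T has a suspension. \<open>S\<close> stands for \<Sigma>T.\<close>

locale reduced_zero_auslander = extriangulated_category K C
  for K :: "'k ring" and C :: "('k, 'o, 'm, 'e) extricat" (structure) +
  fixes T S :: 'o
  assumes finite_ext: "ext_finite K C"
    and projective_T: "projective C T"
    and presentation: "X \<in> Ob C \<Longrightarrow> \<exists>T1 \<in> add_closure C T. \<exists>T0 \<in> add_closure C T. \<exists>x y. conflation C T1 x T0 y X"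
    and shift: "cone_zero T S"
begin

lemma T_Ob: "T \<in> Ob C"
  using projective_T by (simp add: projective_def)

lemma shiftE: obtains \<delta> n M m where "is_zero_object C M" "realized_by C \<delta> T n M m S"
  using shift by (rule cone_zeroE)

lemma S_Ob: "S \<in> Ob C"
  using shiftE realized_typed by (metis arr_iff)

lemma projective_ext: "extn C \<eta> T A \<Longrightarrow> \<eta> = \<zero>\<^bsub>Ext C T A\<^esub>"
  using projective_T unfolding projective_def extn_def by blast

lemma lift_from_T:
  assumes r: "realized_by C \<delta> X x Y y Z" and u: "arr C u T Z"
  obtains v where "arr C v T Y" "y \<cdot> v = u"
proof -
  have "extn C (pull C u \<delta>) T X" using pull_extn[OF realized_typed(3)[OF r] u] .
  then have "pull C u \<delta> = \<zero>\<^bsub>Ext C T X\<^esub>" by (rule projective_ext)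
  then show ?thesis using lift_of_pull_zero[OF r u] that by blast
qed

text \<open>T is projective, so a morphism to S lifts to the zero object in the middle.\<close>

lemma T_to_shift_zero: "arr C u T S \<Longrightarrow> u = \<zero>\<^bsub>Hom C T S\<^esub>"
proof -
  assume u: "arr C u T S"
  obtain \<delta> n M m where M: "is_zero_object C M" and r: "realized_by C \<delta> T n M m S" by (rule shiftE)
  obtain v where v: "arr C v T M" "m \<cdot> v = u" using lift_from_T[OF r u] by blast
  have "v = \<zero>\<^bsub>Hom C T M\<^esub>" using arr_to_zero_ob[OF M v(1)] .
  then show ?thesis using v realized_typed[OF r] T_Ob by auto
qed

lemma presentationE:
  assumes "X \<in> Ob C"
  obtains T1 T0 \<delta> x p where "T1 \<in> add_closure C T" "T0 \<in> add_closure C T" "realized_by C \<delta> T1 x T0 p X"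
  using presentation[OF assms] unfolding conflation_def by blast

text \<open>The suspension S is injective: along a presentation T1 \<rightarrow> T0 \<rightarrow> Z,
  an extension restricts to zero on T0. It therefore comes from a morphism T1 \<rightarrow> S, and
  that is zero.\<close>

lemma ext_shift_zero: "extn C \<theta> Z S \<Longrightarrow> \<theta> = \<zero>\<^bsub>Ext C Z S\<^esub>"
proof -
  assume th: "extn C \<theta> Z S"
  then have Z: "Z \<in> Ob C" by (simp add: extn_def)
  then obtain T1 T0 \<delta> x p where P: "T1 \<in> add_closure C T" "T0 \<in> add_closure C T" and r: "realized_by C \<delta> T1 x T0 p Z"
    by (rule presentationE)
  note t = realized_typed[OF r]
  have "pull C p \<theta> = \<zero>\<^bsub>Ext C T0 S\<^esub>"
    using pull_add_closure_zero[OF P(2) projective_ext pull_extn[OF th t(2)]] by blast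
  then obtain f where f: "arr C f T1 S" "push C f \<delta> = \<theta>" using push_of_pull_zero[OF r th] by blast
  have "f = \<zero>\<^bsub>Hom C T1 S\<^esub>"
    using from_add_closure_zero[OF P(1) _ f(1)] T_to_shift_zero f(1) by simp
  then show ?thesis using f(2) push_zero_mor[OF t(3) S_Ob] by simp
qed

lemma ext_add_shift_zero: "A \<in> add_closure C S \<Longrightarrow> extn C \<theta> Z A \<Longrightarrow> \<theta> = \<zero>\<^bsub>Ext C Z A\<^esub>"
  using push_add_closure_zero ext_shift_zero by blast

text \<open>Apply (ET4) to a presentation \<open>T1 \<rightarrow> T0 \<rightarrow> X\<close> and to \<open>T0 \<rightarrow> 0\<close>: this gives a conflation from \<open>X\<close> to the
  cone of \<open>T1 \<rightarrow> 0\<close>, whose extension is pushed forward along \<open>T0 \<rightarrow> X\<close>.\<close>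

lemma copresentationE:
  assumes X: "X \<in> Ob C"
  obtains T0 p S0 \<theta> d S1 e where "T0 \<in> add_closure C T" "arr C p T0 X" "extn C \<theta> S0 T0"
    "realized_by C (push C p \<theta>) X d S1 e S0" "S1 \<in> add_closure C S"
proof -
  obtain T1 T0 \<delta> x p where P: "T1 \<in> add_closure C T" "T0 \<in> add_closure C T" and r: "realized_by C \<delta> T1 x T0 p X"
    using X by (rule presentationE)
  obtain S0 where "cone_zero T0 S0" using cone_zero_add_closure(1)[OF shift P(2)] by blast
  then obtain \<theta> n M m where M: "is_zero_object C M" and r0: "realized_by C \<theta> T0 n M m S0" by (rule cone_zeroE)
  obtain S1 h d e \<delta>' where r1: "realized_by C \<delta>' T1 (n \<cdot> x) M h S1" and r2: "realized_by C (push C p \<theta>) X d S1 e S0"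
    by (rule ET4_obtain[OF r r0])
  have "S1 \<in> add_closure C S"
    using cone_zero_add_closure(2)[OF shift P(1)] r1 M unfolding cone_zero_def by blast
  then show ?thesis using that[OF P(2) realized_typed(2)[OF r] realized_typed(3)[OF r0] r2] by blast
qed

lemma split_copresentation:
  assumes "realized_by C \<eta> X d S1 e S0" "\<eta> = \<zero>\<^bsub>Ext C S0 X\<^esub>" "S1 \<in> add_closure C S"
  shows "X \<in> add_closure C S"
  using assms realized_zero_biproduct add_closure_summand by metis

text \<open>The extension in the copresentation of X is a pushforward along a morphism from
  \<open>add(T)\<close>. Here this morphism vanishes, so the copresentation splits.\<close>

lemma no_maps_from_T_add_shift:
  assumes X: "X \<in> Ob C" and z: "\<And>u. arr C u T X \<Longrightarrow> u = \<zero>\<^bsub>Hom C T X\<^esub>"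
  shows "X \<in> add_closure C S"
proof -
  obtain T0 p S0 \<theta> d S1 e where T0: "T0 \<in> add_closure C T" and p: "arr C p T0 X" and th: "extn C \<theta> S0 T0"
    and r: "realized_by C (push C p \<theta>) X d S1 e S0" "S1 \<in> add_closure C S"
    using X by (rule copresentationE)
  have "p = \<zero>\<^bsub>Hom C T0 X\<^esub>" using from_add_closure_zero[OF T0 _ p] z p by simp
  then show ?thesis using split_copresentation[OF r(1) _ r(2)] push_zero_mor[OF th X] by simp
qed

text \<open>For injective X the copresentation splits. Together with
  \<open>ext_add_shift_zero\<close>, this identifies the injectives with
  \<open>add(\<Sigma>T)\<close>.\<close>

lemma injective_add_shift:
  assumes X: "X \<in> Ob C" and z: "\<And>Z \<eta>. extn C \<eta> Z X \<Longrightarrow> \<eta> = \<zero>\<^bsub>Ext C Z X\<^esub>"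
  shows "X \<in> add_closure C S"
proof -
  obtain T0 p S0 \<theta> d S1 e where r: "realized_by C (push C p \<theta>) X d S1 e S0" "S1 \<in> add_closure C S"
    using X by (rule copresentationE)
  show ?thesis using split_copresentation[OF r(1) z[OF realized_typed(3)[OF r(1)]] r(2)] .
qed

text \<open>A is a summand of a power of S, and this power is a cone of a power of T. The lemma
  replaces finiteness of Hom(FX, FA) where FA = 0 carries no information.\<close>

lemma Hom_to_add_shift_fin_dim:
  assumes X: "X \<in> Ob C" and A: "A \<in> add_closure C S"
  shows "vectorspace.fin_dim K (Hom C X A)"
proof -
  obtain V n i r where V: "dsum (replicate n S) V" "arr C i A V" "arr C r V A" "r \<cdot> i = ident C A"
    using A by (rule add_closureE)
  obtain U where U: "dsum (replicate n T) U" using ex_dsum[of "replicate n T"] T_Ob by (metis in_set_replicate subsetI)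
  obtain \<delta> u M m where M: "is_zero_object C M" "realized_by C \<delta> U u M m V"
    using cone_zero_powers[OF shift U V(1)] by (rule cone_zeroE)
  interpret linear_map K "Hom C X A" "Hom C X V" "\<lambda>f. i \<cdot> f" using linear_cmp_right[of i X] V(2) X by simp
  have "inj_on (\<lambda>f. i \<cdot> f) (carrier (Hom C X A))"
    by (rule inj_on_inverseI[of _ "\<lambda>f. r \<cdot> f"]) (use V X in \<open>auto simp: cancel_left\<close>)
  then show ?thesis using inj_fin_dim pull_realized_injective[OF M(2,1) X finite_ext] by blast
qed

lemma Hom_T_fin_dim: "X \<in> Ob C \<Longrightarrow> vectorspace.fin_dim K (Hom C T X)"
  using shiftE push_realized_injective finite_ext by metis

section \<open>Finiteness, fullness and exactness properties of F\<close>

lemma F_hom_zero: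
  assumes "X \<in> Ob C" "A \<in> Ob C" and p: "\<phi> \<in> carrier (F_hom_space C T X A)"
  shows "\<phi> \<zero>\<^bsub>Hom C T X\<^esub> = \<zero>\<^bsub>Hom C T A\<^esub>"
proof -
  note d = F_homD[OF T_Ob assms]
  have z: "arr C \<zero>\<^bsub>Hom C T X\<^esub> T X" using T_Ob assms(1) by simp
  have "\<phi> \<zero>\<^bsub>Hom C T X\<^esub> = \<phi> (\<zero>\<^bsub>Hom C T X\<^esub> \<cdot> \<zero>\<^bsub>Hom C T T\<^esub>)" using T_Ob assms(1) by simp
  also have "\<dots> = \<phi> \<zero>\<^bsub>Hom C T X\<^esub> \<cdot> \<zero>\<^bsub>Hom C T T\<^esub>" using d(3)[OF z, of "\<zero>\<^bsub>Hom C T T\<^esub>"] T_Ob by simp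
  also have "\<dots> = \<zero>\<^bsub>Hom C T A\<^esub>" using d(1)[OF z] T_Ob by simp
  finally show ?thesis .
qed

text \<open>Evaluation at the identity embeds Hom(FT, FA) in Hom(T, A). For general X, the map FT0
  \<rightarrow> FX from a presentation is surjective, so Hom(FX, FA) embeds in Hom(FT0, FA).\<close>

lemma F_hom_fin_dim:
  assumes X: "X \<in> Ob C" and A: "A \<in> Ob C"
  shows "vectorspace.fin_dim K (F_hom_space C T X A)"
proof -
  interpret F: contravariant_functor K C "\<lambda>X. F_hom_space C T X A" "F_act T" by (rule F_hom_functor[OF T_Ob A])
  have "F.fd T"
  proof -
    have hom: "(\<lambda>\<phi>. \<phi> (ident C T)) \<in> LinearCombinations.module_hom K (F_hom_space C T T A) (Hom C T A)"
      using F_homD(1)[OF T_Ob T_Ob A, of _ "ident C T"] T_Ob A unfolding module_hom_def by (auto simp: F_hom_ops)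
    interpret linear_map K "F_hom_space C T T A" "Hom C T A" "\<lambda>\<phi>. \<phi> (ident C T)"
      using linear_mapI[OF F.vs[OF T_Ob] Hom_vectorspace[OF T_Ob A] hom] .
    have "inj_on (\<lambda>\<phi>. \<phi> (ident C T)) (carrier (F_hom_space C T T A))"
    proof (rule inj_onI)
      fix \<phi> \<psi> assume p: "\<phi> \<in> carrier (F_hom_space C T T A)" "\<psi> \<in> carrier (F_hom_space C T T A)"
        and eq: "\<phi> (ident C T) = \<psi> (ident C T)"
      show "\<phi> = \<psi>"
      proof (rule F_hom_eqI[OF T_Ob T_Ob A])
        fix u assume u: "arr C u T T"
        show "\<phi> u = \<psi> u"
          using F_homD(3)[OF T_Ob T_Ob A p(1), of "ident C T" u] F_homD(3)[OF T_Ob T_Ob A p(2), of "ident C T" u]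
            u eq T_Ob by simp
      qed (use F_homD(4)[OF T_Ob T_Ob A] p in auto)
    qed
    then show ?thesis using inj_fin_dim Hom_T_fin_dim[OF A] by blast
  qed
  then have add: "F.fd T0" if T0: "T0 \<in> add_closure C T" for T0
  proof -
    obtain U n i r where U: "dsum (replicate n T) U" "arr C i T0 U" "arr C r U T0" "r \<cdot> i = ident C T0"
      using T0 by (rule add_closureE)
    have "F.fd U" using F.dsum_fd[OF U(1)] \<open>F.fd T\<close> by simp
    then show ?thesis using F.retract_fd[OF U(2-4)] by blast
  qed
  obtain T1 T0 \<delta> x p where P: "T1 \<in> add_closure C T" "T0 \<in> add_closure C T" and r: "realized_by C \<delta> T1 x T0 p X"
    using X by (rule presentationE)
  note t = realized_typed[OF r]
  have T0: "T0 \<in> Ob C" using t by simp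
  have "inj_on (F_act T p) (carrier (F_hom_space C T X A))"
  proof (rule inj_onI)
    fix \<phi> \<psi> assume p: "\<phi> \<in> carrier (F_hom_space C T X A)" "\<psi> \<in> carrier (F_hom_space C T X A)"
      and eq: "F_act T p \<phi> = F_act T p \<psi>"
    show "\<phi> = \<psi>"
    proof (rule F_hom_eqI[OF T_Ob X A])
      fix u assume u: "arr C u T X"
      obtain v where v: "arr C v T T0" "p \<cdot> v = u" using lift_from_T[OF r u] by blast
      have "F_act T p \<phi> v = F_act T p \<psi> v" using eq by simp
      then show "\<phi> u = \<psi> u" using v t T_Ob by (simp add: F_act_def)
    qed (use F_homD(4)[OF T_Ob X A] p in auto)
  qed
  then show ?thesis using linear_map.inj_fin_dim[OF F.linear_act[OF t(2)]] add[OF P(2)] by blast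
qed

text \<open>The Yoneda lemma: on a summand T, the map \<open>\<psi>\<close> is determined by its
  value at the inclusion \<open>i\<close>.\<close>

lemma F_full_dsum:
  "dsum (replicate n T) U \<Longrightarrow> A \<in> Ob C \<Longrightarrow> \<psi> \<in> carrier (F_hom_space C T U A) \<Longrightarrow> \<exists>g. arr C g U A \<and> \<psi> = F_map T g"
proof (induction n arbitrary: U \<psi>)
  case 0
  then have U: "is_zero_object C U" "U \<in> Ob C" using zero_ob_Ob by auto
  have z: "arr C \<zero>\<^bsub>Hom C U A\<^esub> U A" using U 0 by simp
  have "\<psi> = F_map T \<zero>\<^bsub>Hom C U A\<^esub>"
  proof (rule F_hom_eqI[OF T_Ob U(2) 0(2)])
    fix u assume u: "arr C u T U"
    have u0: "u = \<zero>\<^bsub>Hom C T U\<^esub>" using arr_to_zero_ob[OF U(1) u] .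
    show "\<psi> u = F_map T \<zero>\<^bsub>Hom C U A\<^esub> u"
      unfolding u0 F_hom_zero[OF U(2) 0(2,3)] F_hom_zero[OF U(2) 0(2) F_map_mem[OF T_Ob z]] ..
  qed (use F_homD(4)[OF T_Ob U(2) 0(2)] F_map_mem[OF T_Ob z] 0(3) in auto)
  then show ?case using z by blast
next
  case (Suc n)
  then obtain U' i j p q where b: "biproduct C T U' U i j p q" "dsum (replicate n T) U'" by auto
  note s = biproduct_simps[OF b(1)]
  have t: "arr C i T U" "arr C j U' U" "arr C p U T" "arr C q U U'" using s by auto
  note d = F_homD[OF T_Ob s(15) Suc.prems(2,3)]
  obtain g where g: "arr C g U' A" "F_act T j \<psi> = F_map T g"
    using Suc.IH[OF b(2) Suc.prems(2) F_act_mem[OF T_Ob Suc.prems(2) t(2) Suc.prems(3)]] by blast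
  let ?h = "\<psi> i \<cdot> p \<oplus>\<^bsub>Hom C U A\<^esub> g \<cdot> q"
  have h: "arr C ?h U A" using d(1)[OF t(1)] g(1) t by simp
  have "\<psi> = F_map T ?h"
  proof (rule F_hom_eqI[OF T_Ob s(15) Suc.prems(2)])
    fix u assume u: "arr C u T U"
    have pq: "arr C (i \<cdot> (p \<cdot> u)) T U" "arr C (j \<cdot> (q \<cdot> u)) T U" "arr C (p \<cdot> u) T T" "arr C (q \<cdot> u) T U'"
      using u t by auto
    have "\<psi> u = \<psi> (i \<cdot> (p \<cdot> u) \<oplus>\<^bsub>Hom C T U\<^esub> j \<cdot> (q \<cdot> u))" using s(25)[of u] u by simp
    also have "\<dots> = \<psi> i \<cdot> (p \<cdot> u) \<oplus>\<^bsub>Hom C T A\<^esub> \<psi> (j \<cdot> (q \<cdot> u))"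
      using d(2)[OF pq(1,2)] d(3)[OF t(1) pq(3)] by simp
    also have "\<psi> (j \<cdot> (q \<cdot> u)) = g \<cdot> (q \<cdot> u)"
      using fun_cong[OF g(2), of "q \<cdot> u"] pq(4) g(1) t T_Ob by (simp add: F_act_def F_map_def)
    finally show "\<psi> u = F_map T ?h u" using u h t g(1) d(1)[OF t(1)] T_Ob by (simp add: F_map_def)
  qed (use F_homD(4)[OF T_Ob s(15) Suc.prems(2)] F_map_mem[OF T_Ob h] Suc.prems(3) in auto)
  then show ?case using h by blast
qed

text \<open>On the term T0 of a presentation, \<open>\<phi>\<close> is induced by a morphism. This
  morphism vanishes on T1, because maps from T test maps out of \<open>add(T)\<close>, and so it
  descends along the deflation to X.\<close>

theorem F_full:
  assumes X: "X \<in> Ob C" and A: "A \<in> Ob C" and p: "\<phi> \<in> carrier (F_hom_space C T X A)"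
  shows "\<exists>f. arr C f X A \<and> \<phi> = F_map T f"
proof -
  obtain T1 T0 \<delta> x y where P: "T1 \<in> add_closure C T" "T0 \<in> add_closure C T" and r: "realized_by C \<delta> T1 x T0 y X"
    using X by (rule presentationE)
  note t = realized_typed[OF r]
  have O: "T0 \<in> Ob C" "T1 \<in> Ob C" using t by auto
  \<comment> \<open>T0 is only a summand of a power of T, so the morphism is found on
    \<open>U\<close> and then restricted along \<open>i\<close>.\<close>
  obtain U n i q where U: "dsum (replicate n T) U" "arr C i T0 U" "arr C q U T0" "q \<cdot> i = ident C T0"
    using P(2) by (rule add_closureE)
  have yq: "arr C (y \<cdot> q) U X" using t U by simp
  obtain g where g: "arr C g U A" "F_act T (y \<cdot> q) \<phi> = F_map T g"
    using F_full_dsum[OF U(1) A F_act_mem[OF T_Ob A yq p]] by blast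
  have gi: "(g \<cdot> i) \<cdot> v = \<phi> (y \<cdot> v)" if v: "arr C v T T0" for v
  proof -
    have "F_act T (y \<cdot> q) \<phi> (i \<cdot> v) = F_map T g (i \<cdot> v)" using g(2) by simp
    then show ?thesis using v U t g(1) T_Ob by (simp add: F_act_def F_map_def cancel_left[OF U(4)])
  qed
  have git: "arr C (g \<cdot> i) T0 A" using g U by simp
  have "(g \<cdot> i) \<cdot> x = \<zero>\<^bsub>Hom C T1 A\<^esub>"
  proof (rule from_add_closure_zero[OF P(1)])
    show "arr C ((g \<cdot> i) \<cdot> x) T1 A" using git t by simp
    fix v assume v: "arr C v T T1"
    have "((g \<cdot> i) \<cdot> x) \<cdot> v = \<phi> ((y \<cdot> x) \<cdot> v)"
      using gi[of "x \<cdot> v"] v t g U by simp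
    also have "\<dots> = \<zero>\<^bsub>Hom C T A\<^esub>"
      unfolding deflation_inflation[OF r] using v X A F_hom_zero[OF X A p] by simp
    finally show "((g \<cdot> i) \<cdot> x) \<cdot> v = \<zero>\<^bsub>Hom C T A\<^esub>" .
  qed
  then obtain f where f: "arr C f X A" "f \<cdot> y = g \<cdot> i" using factor_through_deflation[OF r git] by blast
  have "\<phi> = F_map T f"
  proof (rule F_hom_eqI[OF T_Ob X A])
    fix u assume u: "arr C u T X"
    obtain v where v: "arr C v T T0" "y \<cdot> v = u" using lift_from_T[OF r u] by blast
    have "\<phi> u = (f \<cdot> y) \<cdot> v" using gi[OF v(1)] v(2) f(2) by simp
    moreover have "(f \<cdot> y) \<cdot> v = f \<cdot> u" using v f(1) t by simp
    ultimately show "\<phi> u = F_map T f u" using u f(1) T_Ob by (simp add: F_map_def)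
  qed (use F_homD(4)[OF T_Ob X A] F_map_mem[OF T_Ob f(1)] p in auto)
  then show ?thesis using f(1) by blast
qed

text \<open>F kills the identity minus \<open>e\<close>. This difference is invertible, so FX =
  0.\<close>

lemma F_map_ident_radical:
  assumes e: "arr C e X X" and i: "iso_mor C X X (ident C X \<oplus>\<^bsub>Hom C X X\<^esub> \<ominus>\<^bsub>Hom C X X\<^esub> e)"
    and eq: "F_map T (ident C X) = F_map T e"
  shows "X \<in> add_closure C S"
proof -
  let ?d = "ident C X \<oplus>\<^bsub>Hom C X X\<^esub> \<ominus>\<^bsub>Hom C X X\<^esub> e"
  have X: "X \<in> Ob C" using e by simp
  obtain w where w: "arr C w X X" "w \<cdot> ?d = ident C X" using iso_morE[OF i X X] by blast
  have "u = \<zero>\<^bsub>Hom C T X\<^esub>" if u: "arr C u T X" for u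
  proof -
    have "u = e \<cdot> u" using fun_cong[OF eq, of u] u e T_Ob by (simp add: F_map_def)
    then have "u \<oplus>\<^bsub>Hom C T X\<^esub> \<ominus>\<^bsub>Hom C T X\<^esub> (e \<cdot> u) = \<zero>\<^bsub>Hom C T X\<^esub>" using u add_neg[of u T X] by simp
    then have "?d \<cdot> u = \<zero>\<^bsub>Hom C T X\<^esub>" using u e by simp
    then have "w \<cdot> (?d \<cdot> u) = \<zero>\<^bsub>Hom C T X\<^esub>" using w(1) T_Ob by simp
    moreover have "w \<cdot> (?d \<cdot> u) = (w \<cdot> ?d) \<cdot> u" using w(1) u e by (simp del: cmp_add_left cmp_add_right)
    ultimately show ?thesis using w(2) u by simp
  qed
  then show ?thesis using no_maps_from_T_add_shift[OF X] by blast
qed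

text \<open>Rank and nullity for the exact sequence 0 \<rightarrow> Hom(FZ, FA) \<rightarrow>
  Hom(FY, FA) \<rightarrow> Hom(FX, FA). It comes from exactness of FX \<rightarrow> FY
  \<rightarrow> FZ and the surjectivity of FY \<rightarrow> FZ.\<close>

lemma realized_F_dim:
  assumes r: "realized_by C \<delta> X x Y y Z" and A: "A \<in> Ob C"
  shows "vectorspace.dim K (F_hom_space C T Y A) =
    vectorspace.dim K (F_hom_space C T X A\<lparr>carrier := F_act T x ` carrier (F_hom_space C T Y A)\<rparr>)
      + vectorspace.dim K (F_hom_space C T Z A)"
proof -
  note t = realized_typed[OF r]
  have O: "X \<in> Ob C" "Y \<in> Ob C" "Z \<in> Ob C" using t by auto
  interpret F: contravariant_functor K C "\<lambda>X. F_hom_space C T X A" "F_act T" by (rule F_hom_functor[OF T_Ob A])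
  interpret x: linear_map K "F_hom_space C T Y A" "F_hom_space C T X A" "F_act T x" using F.linear_act[OF t(1)] .
  interpret y: linear_map K "F_hom_space C T Z A" "F_hom_space C T Y A" "F_act T y" using F.linear_act[OF t(2)] .
  have inj: "inj_on (F_act T y) (carrier (F_hom_space C T Z A))"
  proof (rule inj_onI)
    fix \<phi> \<psi> assume p: "\<phi> \<in> carrier (F_hom_space C T Z A)" "\<psi> \<in> carrier (F_hom_space C T Z A)"
      and eq: "F_act T y \<phi> = F_act T y \<psi>"
    show "\<phi> = \<psi>"
    proof (rule F_hom_eqI[OF T_Ob O(3) A])
      fix u assume u: "arr C u T Z"
      obtain v where v: "arr C v T Y" "y \<cdot> v = u" using lift_from_T[OF r u] by blast
      have "F_act T y \<phi> v = F_act T y \<psi> v" using eq by simp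
      then show "\<phi> u = \<psi> u" using v t T_Ob by (simp add: F_act_def)
    qed (use F_homD(4)[OF T_Ob O(3) A] p in auto)
  qed
  have "x.kerT = y.imT"
  proof
    show "y.imT \<subseteq> x.kerT"
    proof
      fix \<psi> assume "\<psi> \<in> y.imT"
      then obtain \<phi> where p: "\<phi> \<in> carrier (F_hom_space C T Z A)" "\<psi> = F_act T y \<phi>" unfolding y.im_def by blast
      have "F_act T x \<psi> = F_act T (y \<cdot> x) \<phi>" unfolding p(2) using F.act_cmp[OF t(1,2) p(1)] by simp
      also have "\<dots> = \<zero>\<^bsub>F_hom_space C T X A\<^esub>" unfolding deflation_inflation[OF r] using F.act_zero[OF O(1,3) p(1)] .
      finally show "\<psi> \<in> x.kerT" using p F.act_closed[OF t(2)] by (simp add: x.ker_def)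
    qed
    show "x.kerT \<subseteq> y.imT"
    proof
      fix \<psi> assume "\<psi> \<in> x.kerT"
      then have p: "\<psi> \<in> carrier (F_hom_space C T Y A)" and z: "F_act T x \<psi> = \<zero>\<^bsub>F_hom_space C T X A\<^esub>"
        by (auto simp: x.ker_def)
      obtain f where f: "arr C f Y A" "\<psi> = F_map T f" using F_full[OF O(2) A p] by blast
      note d = F_homD[OF T_Ob O(2) A p]
      \<comment> \<open>A map on FY that vanishes on the image of FX is to descend to FZ, so
        preimages under the surjection FY \<rightarrow> FZ are chosen.\<close>
      define lift where "lift u = (SOME v. arr C v T Y \<and> y \<cdot> v = u)" for u
      have lift: "arr C (lift u) T Y" "y \<cdot> lift u = u" if "arr C u T Z" for u
        using lift_from_T[OF r that] someI_ex[of "\<lambda>v. arr C v T Y \<and> y \<cdot> v = u"] unfolding lift_def by metis+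
      \<comment> \<open>Two preimages differ by an element from the image of FX, where
        \<open>\<psi>\<close> vanishes, so the choice does not matter.\<close>
      have wd: "\<psi> v = \<psi> v'" if v: "arr C v T Y" "arr C v' T Y" "y \<cdot> v = y \<cdot> v'" for v v'
      proof -
        let ?d = "v \<oplus>\<^bsub>Hom C T Y\<^esub> \<ominus>\<^bsub>Hom C T Y\<^esub> v'"
        have "arr C ?d T Y" "y \<cdot> ?d = \<zero>\<^bsub>Hom C T Z\<^esub>" using v t by auto
        then obtain w where w: "arr C w T X" "x \<cdot> w = ?d" using factor_through_inflation[OF r] by blast
        have "\<psi> (x \<cdot> w) = \<zero>\<^bsub>Hom C T A\<^esub>"
          using fun_cong[OF z, of w] w(1) t T_Ob by (simp add: F_act_def F_hom_ops)
        then have "f \<cdot> ?d = \<zero>\<^bsub>Hom C T A\<^esub>" using w f v T_Ob by (simp add: F_map_def)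
        then have "f \<cdot> v \<oplus>\<^bsub>Hom C T A\<^esub> \<ominus>\<^bsub>Hom C T A\<^esub> (f \<cdot> v') = \<zero>\<^bsub>Hom C T A\<^esub>" using f v by simp
        then have "f \<cdot> v = f \<cdot> v'" using diff_zero_eq[of "f \<cdot> v" T A "f \<cdot> v'"] f v by simp
        then show ?thesis using f v T_Ob by (simp add: F_map_def)
      qed
      define \<phi> where "\<phi> = (\<lambda>u \<in> carrier (Hom C T Z). \<psi> (lift u))"
      have "\<phi> \<in> carrier (F_hom_space C T Z A)"
        unfolding mem_F_hom[OF T_Ob O(3) A]
      proof (intro conjI allI impI)
        show "\<phi> \<in> carrier (Hom C T Z) \<rightarrow>\<^sub>E carrier (Hom C T A)"
          unfolding \<phi>_def using d(1) lift T_Ob O A by auto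
        fix u assume u: "arr C u T Z"
        show "\<phi> (u \<oplus>\<^bsub>Hom C T Z\<^esub> v) = \<phi> u \<oplus>\<^bsub>Hom C T A\<^esub> \<phi> v" if v: "arr C v T Z" for v
        proof -
          have "\<psi> (lift (u \<oplus>\<^bsub>Hom C T Z\<^esub> v)) = \<psi> (lift u \<oplus>\<^bsub>Hom C T Y\<^esub> lift v)"
            using lift[OF u] lift[OF v] lift[of "u \<oplus>\<^bsub>Hom C T Z\<^esub> v"] u v t by (intro wd) auto
          then show ?thesis using d(2)[OF lift(1)[OF u] lift(1)[OF v]] u v T_Ob O by (simp add: \<phi>_def)
        qed
        show "\<phi> (u \<cdot> a) = \<phi> u \<cdot> a" if a: "arr C a T T" for a
        proof -
          have "y \<cdot> (lift u \<cdot> a) = (y \<cdot> lift u) \<cdot> a" using lift(1)[OF u] a t by simp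
          then have "\<psi> (lift (u \<cdot> a)) = \<psi> (lift u \<cdot> a)"
            using lift[OF u] lift[of "u \<cdot> a"] u a t by (intro wd) auto
          then show ?thesis using d(3)[OF lift(1)[OF u] a] u a T_Ob O by (simp add: \<phi>_def)
        qed
      qed
      moreover have "\<psi> = F_act T y \<phi>"
      proof (rule F_hom_eqI[OF T_Ob O(2) A d(4)])
        show "F_act T y \<phi> \<in> extensional (carrier (Hom C T Y))" using t by (simp add: F_act_def)
        fix v assume v: "arr C v T Y"
        have "\<psi> (lift (y \<cdot> v)) = \<psi> v" using lift[of "y \<cdot> v"] v t by (intro wd) auto
        then show "\<psi> v = F_act T y \<phi> v" using v t T_Ob by (simp add: F_act_def \<phi>_def)
      qed
      ultimately show "\<psi> \<in> y.imT" unfolding y.im_def by blast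
    qed
  qed
  then show ?thesis
    using x.rank_nullity[OF F_hom_fin_dim[OF O(2) A]] y.inj_dim_im[OF inj F_hom_fin_dim[OF O(3) A]]
    by (simp add: x.im_def)
qed

text \<open>The value of the form at \<open>\<ell>\<close> is the codimension of the morphisms \<open>FX \<rightarrow> FA\<close> that factor through
  the middle term.  All do if \<open>X\<close> is not isomorphic to \<open>A\<close>, and the identity does not.\<close>

lemma almost_split_F_dim:
  assumes r: "realized_by C \<epsilon> X x M y B" and as: "almost_split C B X \<epsilon>" and X: "local_ob X" and A: "local_ob A"
  shows "\<not> isomorphic C A X \<Longrightarrow> vectorspace.dim K (F_hom_space C T X A) + vectorspace.dim K (F_hom_space C T B A)
      = vectorspace.dim K (F_hom_space C T M A)"
    and "X \<notin> add_closure C S \<Longrightarrow> vectorspace.dim K (F_hom_space C T X X) + vectorspace.dim K (F_hom_space C T B X)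
      > vectorspace.dim K (F_hom_space C T M X)"
proof -
  note t = realized_typed[OF r]
  have O: "X \<in> Ob C" "M \<in> Ob C" "B \<in> Ob C" "A \<in> Ob C" using t local_ob_Ob[OF A] by auto
  have as': "push C f \<epsilon> = \<zero>\<^bsub>Ext C B Y\<^esub>" if "arr C f X Y" "\<not> section_mor C X Y f" for f Y
    using as that unfolding almost_split_def arr_def by blast
  show "vectorspace.dim K (F_hom_space C T X A) + vectorspace.dim K (F_hom_space C T B A)
      = vectorspace.dim K (F_hom_space C T M A)" if ni: "\<not> isomorphic C A X"
  proof -
    have "F_act T x ` carrier (F_hom_space C T M A) = carrier (F_hom_space C T X A)"
    proof
      show "F_act T x ` carrier (F_hom_space C T M A) \<subseteq> carrier (F_hom_space C T X A)"
        using F_act_mem[OF T_Ob O(4) t(1)] by blast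
      show "carrier (F_hom_space C T X A) \<subseteq> F_act T x ` carrier (F_hom_space C T M A)"
      proof
        fix \<phi> assume "\<phi> \<in> carrier (F_hom_space C T X A)"
        then obtain f where f: "arr C f X A" "\<phi> = F_map T f" using F_full[OF O(1,4)] by blast
        have "\<not> section_mor C X A f"
          using local_section_isomorphic[OF A _ _ O(1)] X ni unfolding local_ob_def by blast
        then obtain g where g: "arr C g M A" "g \<cdot> x = f" using extend_along_inflation[OF r f(1)] as'[OF f(1)] by blast
        have "\<phi> = F_act T x (F_map T g)" using F_act_F_map[OF T_Ob t(1) g(1)] g(2) f(2) by simp
        then show "\<phi> \<in> F_act T x ` carrier (F_hom_space C T M A)" using F_map_mem[OF T_Ob g(1)] by blast
      qed
    qed
    then show ?thesis using realized_F_dim[OF r O(4)] by simp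
  qed
  show "vectorspace.dim K (F_hom_space C T X X) + vectorspace.dim K (F_hom_space C T B X)
      > vectorspace.dim K (F_hom_space C T M X)" if ns: "X \<notin> add_closure C S"
  proof -
    let ?V = "F_hom_space C T X X"
    interpret F: contravariant_functor K C "\<lambda>Y. F_hom_space C T Y X" "F_act T" by (rule F_hom_functor[OF T_Ob O(1)])
    interpret V: vectorspace K ?V using F.vs[OF O(1)] .
    interpret x: linear_map K "F_hom_space C T M X" ?V "F_act T x" using F.linear_act[OF t(1)] .
    have id: "F_map T (ident C X) \<in> carrier ?V" using F_map_mem[OF T_Ob, of "ident C X" X X] O by simp
    \<comment> \<open>Otherwise fullness gives \<open>f\<close> such that \<open>f \<cdot> x\<close>
      and the identity agree under F. As \<open>x\<close> is no section, their difference is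
      invertible, and F would kill X.\<close>
    have "F_map T (ident C X) \<notin> F_act T x ` carrier (F_hom_space C T M X)"
    proof
      assume "F_map T (ident C X) \<in> F_act T x ` carrier (F_hom_space C T M X)"
      then obtain \<phi> where p: "\<phi> \<in> carrier (F_hom_space C T M X)" "F_map T (ident C X) = F_act T x \<phi>" by blast
      obtain f where f: "arr C f M X" "\<phi> = F_map T f" using F_full[OF O(2,1) p(1)] by blast
      have eq: "F_map T (ident C X) = F_map T (f \<cdot> x)" using p(2) f(2) F_act_F_map[OF T_Ob t(1) f(1)] by simp
      have nsec: "\<not> section_mor C X M x"
      proof
        assume "section_mor C X M x"
        then obtain q where q: "arr C q M X" "q \<cdot> x = ident C X" using section_morE O by metis
        have "\<epsilon> = push C q (push C x \<epsilon>)" using push_comp[OF t(3,1) q(1)] q(2) push_id[OF t(3)] by simp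
        then show False using as push_inflation[OF r] push_zero[OF O(3) q(1)] unfolding almost_split_def by simp
      qed
      have "X \<in> add_closure C S"
        using F_map_ident_radical[of "f \<cdot> x" X] local_radical_left[OF X t(1) nsec f(1)] eq f(1) t(1) by simp
      then show False using ns by simp
    qed
    then have ne: "F_act T x ` carrier (F_hom_space C T M X) \<noteq> carrier ?V" using id by blast
    have "VectorSpace.subspace K (F_act T x ` carrier (F_hom_space C T M X)) ?V"
      using x.imT_is_subspace by (simp add: x.im_def)
    from V.subspace_dim(2)[OF F_hom_fin_dim[OF O(1,1)] this ne]
    show ?thesis using realized_F_dim[OF r O(1)] by simp
  qed
qed

end

section \<open>The split Grothendieck group\<close>

lemma lookup_sum_list_frag_of: "Poly_Mapping.lookup (sum_list (map frag_of As)) A = int (count_list As A)"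
  by (induction As) (auto simp: Poly_Mapping.lookup_add)

lemma keys_sum_list_frag_of: "Poly_Mapping.keys (sum_list (map frag_of As)) = set As"
  by (auto simp: in_keys_iff lookup_sum_list_frag_of count_list_0_iff)

lemma generate_free_Abelian_induct:
  assumes x: "x \<in> generate (free_Abelian_group I) L" and L: "\<And>l. l \<in> L \<Longrightarrow> Poly_Mapping.keys l \<subseteq> I"
    and P: "P 0" "\<And>l. l \<in> L \<Longrightarrow> P l" "\<And>x. P x \<Longrightarrow> P (- x)" "\<And>x y. P x \<Longrightarrow> P y \<Longrightarrow> P (x + y)"
  shows "P x"
  using x by (induction rule: generate.induct) (use L P in auto)

lemma generate_free_Abelian_add:
  "x \<in> generate (free_Abelian_group I) L \<Longrightarrow> y \<in> generate (free_Abelian_group I) L \<Longrightarrow>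
    x + y \<in> generate (free_Abelian_group I) L"
  using generate.eng[of x "free_Abelian_group I" L y] by simp

lemma generate_free_Abelian_subset:
  assumes M: "\<And>m. m \<in> M \<Longrightarrow> m \<in> generate (free_Abelian_group I) L" and L: "\<And>l. l \<in> L \<Longrightarrow> Poly_Mapping.keys l \<subseteq> I"
  shows "generate (free_Abelian_group I) M \<subseteq> generate (free_Abelian_group I) L"
proof (rule group.generate_subgroup_incl[OF group_free_Abelian_group])
  show "M \<subseteq> generate (free_Abelian_group I) L" using M by blast
  show "subgroup (generate (free_Abelian_group I) L) (free_Abelian_group I)"
    by (rule group.generate_is_subgroup[OF group_free_Abelian_group]) (use L in auto)
qed

lemma module_frag_cmul: "Modules.module frag_cmul"
  by unfold_locales (auto simp: frag_cmul_distrib frag_cmul_distrib2)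

context extriangulated_category
begin

lemma opposite_local_ob [simp]: "linear_category.local_ob (opposite C) A \<longleftrightarrow> local_ob A"
proof -
  interpret opp: extriangulated_category K "opposite C" by (rule opposite_extriangulated)
  show ?thesis unfolding local_ob_def opp.local_ob_def opposite_notions opposite_sel by blast
qed

lemma opposite_ext_finite [simp]: "ext_finite K (opposite C) \<longleftrightarrow> ext_finite K C"
  unfolding ext_finite_def by auto

lemmas push_dsum_zero = extriangulated_category.pull_dsum_zero[OF opposite_extriangulated, unfolded opposite_unfold opposite_dsum]
lemmas ex_top_quotient = extriangulated_category.ex_socle_element[OF opposite_extriangulated,
  unfolded opposite_unfold opposite_dsum opposite_local_ob opposite_ext_finite]
lemmas opposite_detects = extriangulated_category.detects_def[OF opposite_extriangulated, unfolded opposite_unfold]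

end

text \<open>The set \<open>I\<close> may be infinite here; its finiteness is a hypothesis or a
  conclusion of individual lemmas.\<close>

locale finite_ars_setting = reduced_zero_auslander +
  fixes I :: "'b set"
  assumes ks: "krull_schmidt C" and ars: "ARS_duality K C" and ind: "ind_representatives C I"
begin

lemma I_local: "A \<in> I \<Longrightarrow> local_ob A"
  using ind indecomposable_local[OF ks] unfolding ind_representatives_def by blast

lemma I_Ob: "A \<in> I \<Longrightarrow> A \<in> Ob C"
  using I_local local_ob_Ob by blast

lemma I_distinct: "A \<in> I \<Longrightarrow> B \<in> I \<Longrightarrow> isomorphic C A B \<Longrightarrow> A = B"
  using ind_isomorphic_eq[OF ind] .

section \<open>Multiplicities and classes of objects\<close>

lemma F_nonretractions_proper:
  assumes A: "A \<in> I" "A \<notin> add_closure C S"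
  shows "vectorspace.dim K (F_hom_space C T A A\<lparr>carrier := F_map T ` nonretractions A A\<rparr>)
    < vectorspace.dim K (F_hom_space C T A A)"
proof -
  have O: "A \<in> Ob C" using I_Ob A by blast
  interpret V: vectorspace K "F_hom_space C T A A" using F_hom_vectorspace T_Ob O by blast
  \<comment> \<open>If the identity agreed under F with a nonretraction, then FA would be
    zero.\<close>
  have "F_map T (ident C A) \<notin> F_map T ` nonretractions A A"
  proof
    assume "F_map T (ident C A) \<in> F_map T ` nonretractions A A"
    then obtain f where f: "arr C f A A" "\<not> retraction_mor C A A f" "F_map T (ident C A) = F_map T f"
      unfolding nonretractions_def by blast
    have "iso_mor C A A (ident C A \<oplus>\<^bsub>Hom C A A\<^esub> \<ominus>\<^bsub>Hom C A A\<^esub> (f \<cdot> ident C A))"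
      using local_radical[OF I_local[OF A(1)] f(1,2), of "ident C A"] O by simp
    then show False using F_map_ident_radical[of f A] f A(2) by simp
  qed
  moreover have "F_map T (ident C A) \<in> carrier (F_hom_space C T A A)"
    using F_map_mem[OF T_Ob, of "ident C A" A A] O by simp
  ultimately show ?thesis
    using V.subspace_dim(2)[OF F_hom_fin_dim[OF O O] F_nonretractions_subspace[OF T_Ob I_local[OF A(1)] O]] by blast
qed

lemma Hom_nonretractions_proper:
  assumes A: "A \<in> I" "A \<in> add_closure C S"
  shows "vectorspace.dim K (Hom C A A\<lparr>carrier := nonretractions A A\<rparr>) < vectorspace.dim K (Hom C A A)"
proof -
  have O: "A \<in> Ob C" using I_Ob A by blast
  interpret V: vectorspace K "Hom C A A" using Hom_vectorspace O by blast
  have "ident C A \<in> carrier (Hom C A A)" using O by simp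
  then show ?thesis
    using V.subspace_dim(2)[OF Hom_to_add_shift_fin_dim[OF O A(2)] nonretractions_subspace[OF I_local[OF A(1)] O]]
      ident_not_nonretraction[OF O] by blast
qed

text \<open>The multiplicity of \<open>A\<close> is read off from
  \<open>FX \<rightarrow> FA\<close> modulo nonretractions, or by \<open>X \<rightarrow> A\<close> modulo nonretractions if \<open>FA = 0\<close>.\<close>

lemma count_list_unique:
  assumes As: "dsum As X" "set As \<subseteq> I" and Bs: "dsum Bs X" "set Bs \<subseteq> I" and A: "A \<in> I"
  shows "count_list As A = count_list Bs A"
proof -
  have O: "A \<in> Ob C" and X: "X \<in> Ob C" using I_Ob[OF A] dsum_Ob[OF As(1)] by auto
  have all: "nonretractions A B = carrier (Hom C B A)" if "B \<in> I" "B \<noteq> A" for B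
    using nonretractions_all[OF I_local[OF A] I_local[OF that(1)]] I_distinct[OF that(1) A] that(2) by blast
  show ?thesis
  proof (cases "A \<in> add_closure C S")
    case False
    interpret F: contravariant_functor K C "\<lambda>X. F_hom_space C T X A" "F_act T" by (rule F_hom_functor[OF T_Ob O])
    let ?W = "\<lambda>X. F_map T ` nonretractions A X"
    have cl: "F_act T f v \<in> ?W Z" if f: "arr C f Z Y" and v: "v \<in> ?W Y" for f Z Y v
    proof -
      obtain g where g: "g \<in> nonretractions A Y" "v = F_map T g" using v by blast
      then have "F_act T f v = F_map T (g \<cdot> f)" using F_act_F_map[OF T_Ob f] by (simp add: nonretractions_def)
      then show ?thesis using nonretractions_cmp[OF f g(1)] by blast
    qed
    have eq: "?W B = carrier (F_hom_space C T B A)" if B: "B \<in> I" "B \<noteq> A" for B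
    proof
      show "?W B \<subseteq> carrier (F_hom_space C T B A)" using F_map_mem[OF T_Ob] unfolding nonretractions_def by blast
      show "carrier (F_hom_space C T B A) \<subseteq> ?W B"
      proof
        fix \<phi> assume "\<phi> \<in> carrier (F_hom_space C T B A)"
        then obtain f where f: "arr C f B A" "\<phi> = F_map T f" using F_full[OF I_Ob[OF B(1)] O] by blast
        then have "f \<in> nonretractions A B" unfolding all[OF B] arr_def by blast
        then show "\<phi> \<in> ?W B" using f(2) by blast
      qed
    qed
    have c: "int (F.d X) - int (vectorspace.dim K (F_hom_space C T X A\<lparr>carrier := ?W X\<rparr>))
      = int (count_list Cs A) * (int (F.d A) - int (vectorspace.dim K (F_hom_space C T A A\<lparr>carrier := ?W A\<rparr>)))"
      if "dsum Cs X" "set Cs \<subseteq> I" for Cs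
      by (rule F.codimension_counts[OF F_nonretractions_subspace[OF T_Ob I_local[OF A]] cl F_hom_fin_dim[OF X O] that(1)])
        (use eq that(2) in blast)+
    show ?thesis using c[OF As] c[OF Bs] F_nonretractions_proper[OF A False] by simp
  next
    case True
    interpret F: contravariant_functor K C "\<lambda>X. Hom C X A" "\<lambda>f g. g \<cdot> f" by (rule Hom_functor[OF O])
    have c: "int (F.d X) - int (vectorspace.dim K (Hom C X A\<lparr>carrier := nonretractions A X\<rparr>))
      = int (count_list Cs A) * (int (F.d A) - int (vectorspace.dim K (Hom C A A\<lparr>carrier := nonretractions A A\<rparr>)))"
      if "dsum Cs X" "set Cs \<subseteq> I" for Cs
      by (rule F.codimension_counts[OF nonretractions_subspace[OF I_local[OF A]] nonretractions_cmp
        Hom_to_add_shift_fin_dim[OF X True] that(1)]) (use all that(2) in blast)+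
    show ?thesis using c[OF As] c[OF Bs] Hom_nonretractions_proper[OF A True] by simp
  qed
qed

text \<open>Uniqueness of the multiplicities makes the definite description in
  \<open>obj_class\<close> well defined.\<close>

lemma obj_class_eq:
  assumes As: "dsum As X" "set As \<subseteq> I"
  shows "obj_class C I X = sum_list (map frag_of As)"
proof -
  have "sum_list (map frag_of Bs) = sum_list (map frag_of As)" if Bs: "dsum Bs X" "set Bs \<subseteq> I" for Bs
  proof (rule poly_mapping_eqI)
    fix A
    have "count_list Bs A = count_list As A"
    proof (cases "A \<in> I")
      case False
      then have "A \<notin> set Bs" "A \<notin> set As" using As Bs by auto
      then show ?thesis by (simp add: count_list_0_iff)
    qed (use count_list_unique[OF Bs As] in blast)
    then show "Poly_Mapping.lookup (sum_list (map frag_of Bs)) A = Poly_Mapping.lookup (sum_list (map frag_of As)) A"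
      by (simp add: lookup_sum_list_frag_of)
  qed
  then show ?thesis
    unfolding obj_class_def direct_sum_iff_dsum using As by (intro the_equality) blast+
qed

lemma ex_I_dsum: assumes "X \<in> Ob C" obtains As where "dsum As X" "set As \<subseteq> I"
  using ind_dsum[OF ks ind assms] by blast

lemma obj_class_biproduct:
  assumes b: "biproduct C X Y B i j p q"
  shows "obj_class C I B = obj_class C I X + obj_class C I Y"
proof -
  obtain As where As: "dsum As X" "set As \<subseteq> I" using ex_I_dsum biproduct_simps(13)[OF b] by blast
  obtain Bs where Bs: "dsum Bs Y" "set Bs \<subseteq> I" using ex_I_dsum biproduct_simps(14)[OF b] by blast
  show ?thesis
    using obj_class_eq[OF dsum_append[OF As(1) Bs(1) b]] obj_class_eq[OF As] obj_class_eq[OF Bs] As Bs by simp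
qed

lemma obj_class_iso: "isomorphic C X Y \<Longrightarrow> obj_class C I X = obj_class C I Y"
proof -
  assume i: "isomorphic C X Y"
  then obtain As where As: "dsum As X" "set As \<subseteq> I" using ex_I_dsum[of X] by (auto simp: isomorphic_def)
  show ?thesis using obj_class_eq[OF As] obj_class_eq[OF dsum_iso[OF As(1) i] As(2)] by simp
qed

lemma obj_class_zero: "is_zero_object C N \<Longrightarrow> obj_class C I N = 0"
  using obj_class_eq[of "[]" N] by simp

lemma obj_class_I: "A \<in> I \<Longrightarrow> obj_class C I A = frag_of A"
  using obj_class_eq[of "[A]" A] dsum_single isomorphic_refl[OF I_Ob] by simp

lemma obj_class_keys: "X \<in> Ob C \<Longrightarrow> Poly_Mapping.keys (obj_class C I X) \<subseteq> I"
  using ex_I_dsum obj_class_eq keys_sum_list_frag_of by metis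

lemma obj_class_nonneg: "X \<in> Ob C \<Longrightarrow> 0 \<le> Poly_Mapping.lookup (obj_class C I X) A"
  using ex_I_dsum[of X] obj_class_eq lookup_sum_list_frag_of by (metis of_nat_0_le_iff)

lemma obj_class_realized_zero:
  assumes "realized_by C \<eta> X x Y y Z" "\<eta> = \<zero>\<^bsub>Ext C Z X\<^esub>"
  shows "obj_class C I Y = obj_class C I X + obj_class C I Z"
  using assms realized_zero_biproduct obj_class_biproduct by metis

lemma obj_class_pair: "dsum [X, Y] V \<Longrightarrow> obj_class C I V = obj_class C I X + obj_class C I Y"
  using direct_sum_pair direct_sum_iff_dsum[of "[X, Y]"] obj_class_biproduct by blast

section \<open>The bilinear form\<close>

abbreviation form :: "('b \<Rightarrow>\<^sub>0 int) \<Rightarrow> 'b \<Rightarrow> int" where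
  "form x A \<equiv> K0_form K C T x (frag_of A)"

lemma form_eq_sum:
  assumes "finite J" "Poly_Mapping.keys x \<subseteq> J"
  shows "form x A = (\<Sum>B \<in> J. Poly_Mapping.lookup x B * int (vectorspace.dim K (F_hom_space C T B A)))"
proof -
  have "form x A = (\<Sum>B \<in> Poly_Mapping.keys x. Poly_Mapping.lookup x B * int (vectorspace.dim K (F_hom_space C T B A)))"
    unfolding K0_form_def by (simp add: keys_frag_of)
  also have "\<dots> = (\<Sum>B \<in> J. Poly_Mapping.lookup x B * int (vectorspace.dim K (F_hom_space C T B A)))"
    using assms by (intro sum.mono_neutral_left) (auto simp: in_keys_iff)
  finally show ?thesis .
qed

lemma form_add: "form (x + y) A = form x A + form y A"
proof -
  let ?J = "Poly_Mapping.keys x \<union> Poly_Mapping.keys y"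
  have "finite ?J" "Poly_Mapping.keys (x + y) \<subseteq> ?J" using Poly_Mapping.keys_add[of x y] by auto
  then show ?thesis using form_eq_sum[of ?J x A] form_eq_sum[of ?J y A] form_eq_sum[of ?J "x + y" A]
    by (simp add: Poly_Mapping.lookup_add algebra_simps sum.distrib)
qed

lemma form_zero: "form 0 A = 0"
  by (simp add: K0_form_def)

lemma form_uminus: "form (- x) A = - form x A"
  using form_add[of x "- x" A] form_zero by simp

lemma form_diff: "form (x - y) A = form x A - form y A"
  using form_add[of x "- y" A] form_uminus by simp

lemma form_cmul: "form (frag_cmul c x) A = c * form x A"
proof -
  have "Poly_Mapping.keys (frag_cmul c x) \<subseteq> Poly_Mapping.keys x" by (rule keys_cmul)
  then show ?thesis using form_eq_sum[of "Poly_Mapping.keys x" x A] form_eq_sum[of "Poly_Mapping.keys x" "frag_cmul c x" A]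
    by (simp add: sum_distrib_left mult.assoc)
qed

lemma form_sum: "finite J \<Longrightarrow> form (\<Sum>j \<in> J. g j) A = (\<Sum>j \<in> J. form (g j) A)"
  by (induction J rule: finite_induct) (simp_all add: form_zero form_add)

lemma form_obj_class:
  assumes X: "X \<in> Ob C" and A: "A \<in> Ob C"
  shows "form (obj_class C I X) A = int (vectorspace.dim K (F_hom_space C T X A))"
proof -
  interpret F: contravariant_functor K C "\<lambda>X. F_hom_space C T X A" "F_act T" by (rule F_hom_functor[OF T_Ob A])
  obtain As where As: "dsum As X" "set As \<subseteq> I" using ex_I_dsum X by blast
  have "form (sum_list (map frag_of Bs)) A = int (sum_list (map F.d Bs))" for Bs
    by (induction Bs) (simp_all add: form_zero form_add, simp add: K0_form_def)
  then show ?thesis unfolding obj_class_eq[OF As] F.dsum_d[OF As(1) F_hom_fin_dim[OF X A]] .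
qed

section \<open>Almost split relations\<close>

lemma almost_splitD:
  assumes "almost_split C B A \<epsilon>"
  shows "\<epsilon> \<noteq> \<zero>\<^bsub>Ext C B A\<^esub>" "\<And>X f. arr C f A X \<Longrightarrow> \<not> section_mor C A X f \<Longrightarrow> push C f \<epsilon> = \<zero>\<^bsub>Ext C B X\<^esub>"
  using assms unfolding almost_split_def arr_def by blast+

text \<open>One object decomposes both as W + B and as M + Y. Vanishing on nonsections is a
  condition on one side only; it also holds for the pushforwards in the induction below, which may
  fail to be almost split. The same equation makes \<open>ell\<close> well defined.\<close>

lemma socle_obj_class:
  assumes "realized_by C \<epsilon> A m M n B" "\<epsilon> \<noteq> \<zero>\<^bsub>Ext C B A\<^esub>"
      "\<And>X f. arr C f A X \<Longrightarrow> \<not> section_mor C A X f \<Longrightarrow> push C f \<epsilon> = \<zero>\<^bsub>Ext C B X\<^esub>"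
    and "realized_by C \<delta> A a W w Y" "\<delta> \<noteq> \<zero>\<^bsub>Ext C Y A\<^esub>"
      "\<And>X f. arr C f A X \<Longrightarrow> \<not> section_mor C A X f \<Longrightarrow> push C f \<delta> = \<zero>\<^bsub>Ext C Y X\<^esub>"
  shows "obj_class C I A + obj_class C I Y - obj_class C I W = obj_class C I A + obj_class C I B - obj_class C I M"
proof -
  obtain V where "dsum [W, B] V" "dsum [M, Y] V" using socle_middle_terms[OF assms] by blast
  then have "obj_class C I W + obj_class C I B = obj_class C I M + obj_class C I Y" using obj_class_pair by metis
  then show ?thesis by (simp add: algebra_simps)
qed

lemma ell_eq:
  assumes as: "almost_split C B A \<epsilon>" and r: "realized_by C \<epsilon> A m M n B"
  shows "ell C I A = obj_class C I A + obj_class C I B - obj_class C I M"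
  unfolding ell_def
proof (rule the_equality)
  show "\<exists>\<delta> x E y Y. almost_split C Y A \<delta> \<and> realized_by C \<delta> A x E y Y \<and>
      obj_class C I A + obj_class C I B - obj_class C I M = obj_class C I A + obj_class C I Y - obj_class C I E"
    using as r by blast
  fix c assume "\<exists>\<delta> x E y Y. almost_split C Y A \<delta> \<and> realized_by C \<delta> A x E y Y \<and>
      c = obj_class C I A + obj_class C I Y - obj_class C I E"
  then obtain \<delta> x E y Y where d: "almost_split C Y A \<delta>" "realized_by C \<delta> A x E y Y"
      "c = obj_class C I A + obj_class C I Y - obj_class C I E" by blast
  show "c = obj_class C I A + obj_class C I B - obj_class C I M"
    unfolding d(3) by (rule socle_obj_class[OF r almost_splitD[OF as] d(2) almost_splitD[OF d(1)]])
qed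

text \<open>Outside \<open>add(\<Sigma>T)\<close> an object is not injective, so there is a nonzero
  extension from which to start.\<close>

lemma ex_almost_split_realization:
  assumes A: "A \<in> I - add_closure C S"
  obtains \<epsilon> m M n B where "almost_split C B A \<epsilon>" "realized_by C \<epsilon> A m M n B"
proof -
  have "\<exists>Z \<eta>. extn C \<eta> Z A \<and> \<eta> \<noteq> \<zero>\<^bsub>Ext C Z A\<^esub>" using injective_add_shift[of A] A I_Ob by blast
  then obtain B \<epsilon> where B: "almost_split C B A \<epsilon>" "B \<in> Ob C"
    using ex_almost_split[OF ars finite_ext ks I_local] A by blast
  then have "extn C \<epsilon> B A" using A I_Ob unfolding almost_split_def extn_def by blast
  then show ?thesis using ex_realization that B(1) by blast
qed

abbreviation L :: "('b \<Rightarrow>\<^sub>0 int) set" where "L \<equiv> ell C I ` (I - add_closure C S)"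

lemma form_ell:
  assumes A: "A \<in> I - add_closure C S"
  shows "B \<in> I \<Longrightarrow> A \<noteq> B \<Longrightarrow> form (ell C I A) B = 0" "form (ell C I A) A > 0"
proof -
  obtain \<epsilon> m M n Y where as: "almost_split C Y A \<epsilon>" and r: "realized_by C \<epsilon> A m M n Y"
    using A by (rule ex_almost_split_realization)
  have O: "A \<in> Ob C" "M \<in> Ob C" "Y \<in> Ob C" using realized_typed[OF r] by auto
  have f: "form (ell C I A) D = int (vectorspace.dim K (F_hom_space C T A D)) + int (vectorspace.dim K (F_hom_space C T Y D))
      - int (vectorspace.dim K (F_hom_space C T M D))" if "D \<in> Ob C" for D
    unfolding ell_eq[OF as r] form_diff form_add using form_obj_class O that by simp
  have lA: "local_ob A" using A I_local by blast
  show "form (ell C I A) B = 0" if B: "B \<in> I" "A \<noteq> B"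
  proof -
    have "\<not> isomorphic C B A" using I_distinct[OF B(1), of A] A B(2) by blast
    then show ?thesis using f[OF I_Ob[OF B(1)]] almost_split_F_dim(1)[OF r as lA I_local[OF B(1)]] by simp
  qed
  show "form (ell C I A) A > 0" using f[OF O(1)] almost_split_F_dim(2)[OF r as lA lA] A by simp
qed

lemma ell_keys: "A \<in> I - add_closure C S \<Longrightarrow> Poly_Mapping.keys (ell C I A) \<subseteq> I"
proof -
  assume "A \<in> I - add_closure C S"
  then obtain \<epsilon> m M n B where as: "almost_split C B A \<epsilon>" and r: "realized_by C \<epsilon> A m M n B"
    by (rule ex_almost_split_realization)
  have "A \<in> Ob C" "M \<in> Ob C" "B \<in> Ob C" using realized_typed[OF r] by auto
  then show ?thesis unfolding ell_eq[OF as r]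
    using obj_class_keys keys_diff[of "obj_class C I A + obj_class C I B" "obj_class C I M"]
      Poly_Mapping.keys_add[of "obj_class C I A" "obj_class C I B"] by blast
qed

lemma L_keys: "l \<in> L \<Longrightarrow> Poly_Mapping.keys l \<subseteq> I"
  using ell_keys by blast

lemma relation_keys:
  assumes "conflation C X x Y y Z"
  shows "Poly_Mapping.keys (obj_class C I X - obj_class C I Y + obj_class C I Z) \<subseteq> I"
proof -
  obtain \<delta> where r: "realized_by C \<delta> X x Y y Z" using assms unfolding conflation_def by blast
  then have "X \<in> Ob C" "Y \<in> Ob C" "Z \<in> Ob C" using realized_typed[OF r] by auto
  then show ?thesis
    using obj_class_keys keys_diff[of "obj_class C I X" "obj_class C I Y"]
      Poly_Mapping.keys_add[of "obj_class C I X - obj_class C I Y" "obj_class C I Z"] by blast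
qed

section \<open>The kernel of the projection to the Grothendieck group\<close>

lemma kernel_eq: "kernel (K0_split I) (K0 C I) (K0_proj C I) = conflation_relations C I"
proof -
  let ?G = "free_Abelian_group I" and ?N = "conflation_relations C I"
  interpret group ?G by simp
  have sub: "subgroup ?N ?G"
    unfolding conflation_relations_def K0_split_def
    by (rule generate_is_subgroup) (use relation_keys in auto)
  have "x \<in> carrier ?G \<and> ?N #>\<^bsub>?G\<^esub> x = ?N \<longleftrightarrow> x \<in> ?N" for x
    using coset_join1[OF _ _ sub] coset_join2[OF _ sub] subgroup.mem_carrier[OF sub] subgroup.subset[OF sub] by metis
  then show ?thesis unfolding kernel_def K0_def K0_proj_def FactGroup_def K0_split_def by auto
qed

lemma ell_relation: "l \<in> L \<Longrightarrow> l \<in> conflation_relations C I"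
proof -
  assume "l \<in> L"
  then obtain A where A: "A \<in> I - add_closure C S" "l = ell C I A" by blast
  obtain \<epsilon> m M n B where as: "almost_split C B A \<epsilon>" and r: "realized_by C \<epsilon> A m M n B"
    using A(1) by (rule ex_almost_split_realization)
  have "l = obj_class C I A - obj_class C I M + obj_class C I B" unfolding A(2) ell_eq[OF as r] by simp
  then show ?thesis using r unfolding conflation_relations_def conflation_def by (intro generate.incl) blast
qed

lemma generate_L_subset: "generate (K0_split I) L \<subseteq> conflation_relations C I"
  unfolding conflation_relations_def K0_split_def
proof (rule generate_free_Abelian_subset)
  fix m assume "m \<in> L"
  then show "m \<in> generate (free_Abelian_group I)
      {obj_class C I X - obj_class C I Y + obj_class C I Z |X Y Z. \<exists>x y. conflation C X x Y y Z}"
    using ell_relation unfolding conflation_relations_def K0_split_def by blast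
qed (use relation_keys in blast)

section \<open>Generation by the almost split relations\<close>

lemma sum_object_detects:
  assumes Q: "dsum Is Q" "set Is = I" and th: "extn C \<theta> Y X" "\<theta> \<noteq> \<zero>\<^bsub>Ext C Y X\<^esub>"
  shows "\<exists>v. arr C v X Q \<and> push C v \<theta> \<noteq> \<zero>\<^bsub>Ext C Y Q\<^esub>"
proof -
  have O: "X \<in> Ob C" "Y \<in> Ob C" using th by (auto simp: extn_def)
  obtain As where As: "dsum As X" "set As \<subseteq> I" using ex_I_dsum O by blast
  \<comment> \<open>Some component \<open>A\<close> of \<open>X\<close> sees
    \<open>\<theta>\<close>, and \<open>A\<close> is also a summand of \<open>Q\<close>, the sum of
    all indecomposables.\<close>
  obtain A r where A: "A \<in> set As" "retraction_mor C X A r" "push C r \<theta> \<noteq> \<zero>\<^bsub>Ext C Y A\<^esub>"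
    using push_dsum_zero[OF As(1) th(1)] th(2) by blast
  have AO: "A \<in> Ob C" using dsum_Ob[OF As(1)] A by blast
  have r: "arr C r X A" using retraction_morE[OF A(2) O(1) AO] by blast
  obtain S' i j p q where b: "biproduct C A S' Q i j p q" using dsum_summand[OF Q(1)] A(1) As(2) Q(2) by blast
  have ip: "arr C i A Q" "arr C p Q A" "p \<cdot> i = ident C A" using biproduct_simps[OF b] by auto
  have re: "extn C (push C r \<theta>) Y A" using push_extn[OF th(1) r] .
  have "push C p (push C i (push C r \<theta>)) = push C r \<theta>" using push_comp[OF re ip(1,2)] ip(3) push_id[OF re] by simp
  then have "push C i (push C r \<theta>) \<noteq> \<zero>\<^bsub>Ext C Y Q\<^esub>" using push_zero[OF O(2) ip(2)] A(3) by auto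
  then show ?thesis using push_comp[OF th(1) r ip(1)] r ip(1) by (intro exI[of _ "i \<cdot> r"]) simp
qed

text \<open>The value at Q of the subfunctor of E(Y, -) generated by \<open>\<delta>\<close>. Its
  dimension is the measure for the induction below.\<close>

definition orbit :: "'b \<Rightarrow> 'd \<Rightarrow> 'b \<Rightarrow> 'd set" where
  "orbit Q \<delta> X = {push C v \<delta> | v. arr C v X Q}"

lemma orbit_subspace:
  assumes d: "extn C \<delta> Y X" and Q: "Q \<in> Ob C"
  shows "VectorSpace.subspace K (orbit Q \<delta> X) (Ext C Y Q)"
proof -
  interpret linear_map K "Hom C X Q" "Ext C Y Q" "\<lambda>f. push C f \<delta>" using linear_push_mor[OF d Q] .
  have "imT = orbit Q \<delta> X" using d Q unfolding im_def orbit_def arr_def extn_def by blast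
  then show ?thesis using imT_is_subspace by simp
qed

text \<open>The restriction along \<open>w\<close> maps the orbit of \<open>\<delta>\<close> onto that of its restriction and kills
  a nonzero element.\<close>

lemma orbit_pull_less:
  assumes d: "extn C \<delta> Y X" and Q: "Q \<in> Ob C" and w: "arr C w W Y"
    and v: "arr C v X Q" "push C v \<delta> \<noteq> \<zero>\<^bsub>Ext C Y Q\<^esub>" "pull C w (push C v \<delta>) = \<zero>\<^bsub>Ext C W Q\<^esub>"
  shows "vectorspace.dim K (Ext C W Q\<lparr>carrier := orbit Q (pull C w \<delta>) X\<rparr>)
    < vectorspace.dim K (Ext C Y Q\<lparr>carrier := orbit Q \<delta> X\<rparr>)"
proof -
  have O: "Y \<in> Ob C" "X \<in> Ob C" "W \<in> Ob C" using d w by (auto simp: extn_def)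
  interpret E: vectorspace K "Ext C Y Q" using Ext_vectorspace O Q by blast
  interpret p: linear_map K "Ext C Y Q" "Ext C W Q" "pull C w" using linear_pull[OF Q w] .
  note sub = orbit_subspace[OF d Q]
  have m: "x \<in> carrier (Ext C Y Q)" if "x \<in> orbit Q \<delta> X" for x
    using submodule.subset[OF E.is_module[OF sub]] that by blast
  then have hom: "pull C w \<in> LinearCombinations.module_hom K (E.vs (orbit Q \<delta> X)) (Ext C W Q)"
    unfolding module_hom_def by auto
  interpret o: linear_map K "E.vs (orbit Q \<delta> X)" "Ext C W Q" "pull C w"
    using linear_mapI[OF E.subspace_is_vs[OF sub] p.W.vectorspace_axioms hom] .
  have fdE: "E.fin_dim" using finite_ext O Q by (simp add: ext_finite_def)
  have fdo: "o.V.fin_dim" using E.subspace_fin_dim[OF fdE sub] .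
  have im: "o.imT = orbit Q (pull C w \<delta>) X"
  proof -
    have "o.imT = {pull C w (push C u \<delta>) | u. arr C u X Q}" unfolding o.im_def by (auto simp: orbit_def)
    also have "\<dots> = orbit Q (pull C w \<delta>) X"
      unfolding orbit_def using push_pull_comm[OF d _ w] by metis
    finally show ?thesis .
  qed
  have ker: "push C v \<delta> \<in> o.kerT" unfolding o.ker_def using v by (auto simp: orbit_def)
  interpret k: vectorspace K "o.V.vs o.kerT" using o.V.subspace_is_vs[OF o.kerT_is_subspace] .
  have "VectorSpace.subspace K {\<zero>\<^bsub>Ext C Y Q\<^esub>} (o.V.vs o.kerT)"
    using k.subspaceI[of "{\<zero>\<^bsub>Ext C Y Q\<^esub>}"] o.V.module.M.zero_closed by (simp add: o.ker_def)
  then have "0 < vectorspace.dim K (o.V.vs o.kerT)"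
    using k.subspace_dim(2)[OF o.V.subspace_fin_dim[OF fdo o.kerT_is_subspace]] ker v(2) by fastforce
  then show ?thesis using o.rank_nullity[OF fdo] im by simp
qed

text \<open>X and Q stay fixed in the induction. The end term Y is replaced by the middle term of
  the conflation that realizes the chosen pushforward of \<open>\<delta>\<close>, where this
  pushforward becomes zero.\<close>

lemma relation_generated:
  assumes Is: "dsum Is Q" "set Is = I" and r: "realized_by C \<delta> X x E y Y"
  shows "obj_class C I X - obj_class C I E + obj_class C I Y \<in> generate (free_Abelian_group I) L"
  using r
proof (induction "vectorspace.dim K (Ext C Y Q\<lparr>carrier := orbit Q \<delta> X\<rparr>)" arbitrary: \<delta> x E y Y rule: less_induct)
  case less
  note r = less.prems and t = realized_typed[OF less.prems]
  have QO: "Q \<in> Ob C" using dsum_Ob[OF Is(1)] by blast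
  show ?case
  proof (cases "\<delta> = \<zero>\<^bsub>Ext C Y X\<^esub>")
    case True
    then have "obj_class C I X - obj_class C I E + obj_class C I Y = 0" using obj_class_realized_zero[OF r] by simp
    then show ?thesis using generate.one[of "free_Abelian_group I" L] by simp
  next
    case False
    have det: "extriangulated_category.detects (opposite C) Q Y"
      unfolding opposite_detects using sum_object_detects[OF Is] QO by blast
    \<comment> \<open>\<open>ex_top_quotient\<close> is the socle lemma in the opposite category; it
      yields a nonzero pushforward of \<open>\<delta>\<close> to a component of \<open>Q\<close>
      that is killed by all nonsections.\<close>
    obtain A f where A: "A \<in> I" and f: "arr C f X A" and ne: "push C f \<delta> \<noteq> \<zero>\<^bsub>Ext C Y A\<^esub>"
      and soc: "\<And>W g. arr C g A W \<Longrightarrow> \<not> section_mor C A W g \<Longrightarrow> push C g (push C f \<delta>) = \<zero>\<^bsub>Ext C Y W\<^esub>"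
      using ex_top_quotient[OF finite_ext det Is(1) _ t(3) False] I_local Is(2) by blast
    let ?\<theta> = "push C f \<delta>"
    have th: "extn C ?\<theta> Y A" using push_extn[OF t(3) f] .
    have AS: "A \<in> I - add_closure C S" using A ext_add_shift_zero[OF _ th] ne by blast
    \<comment> \<open>One object \<open>V\<close> is the middle term of two conflations: that of
      \<open>\<delta>\<close> restricted along the deflation of \<open>?\<theta>\<close>, and that
      of \<open>?\<theta>\<close> restricted along the deflation of \<open>\<delta>\<close>.\<close>
    obtain V x1 W1 w1 x2 W2 w2 u1 v1 u2 v2 where
      P: "realized_by C \<delta> X x1 W1 w1 Y" "realized_by C ?\<theta> A x2 W2 w2 Y"
      "realized_by C (pull C w2 \<delta>) X u1 V v1 W2" "realized_by C (pull C w1 ?\<theta>) A u2 V v2 W1"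
      by (rule pullback_pair[OF t(3) th])
    have w: "arr C w1 W1 Y" "arr C w2 W2 Y" using realized_typed P(1,2) by blast+
    \<comment> \<open>\<open>\<delta>\<close> becomes zero along its own deflation, hence so does
      its pushforward. The second conflation therefore splits, which expresses the class of
      \<open>V\<close>.\<close>
    have "pull C w1 ?\<theta> = \<zero>\<^bsub>Ext C W1 A\<^esub>"
      using push_pull_comm[OF t(3) f w(1)] pull_deflation[OF P(1)] push_zero[of W1 f X A] f w(1) by auto
    then have V: "obj_class C I V = obj_class C I A + obj_class C I W1" using obj_class_realized_zero[OF P(4)] by simp
    have W1: "obj_class C I W1 = obj_class C I E" using obj_class_iso realized_isomorphic[OF P(1) r] by blast
    obtain v where v: "arr C v A Q" "push C v ?\<theta> \<noteq> \<zero>\<^bsub>Ext C Y Q\<^esub>" using sum_object_detects[OF Is th ne] by blast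
    have vf: "arr C (v \<cdot> f) X Q" "push C (v \<cdot> f) \<delta> = push C v ?\<theta>" using v f push_comp[OF t(3) f v(1)] by auto
    have "pull C w2 (push C v ?\<theta>) = \<zero>\<^bsub>Ext C W2 Q\<^esub>"
      using push_pull_comm[OF th v(1) w(2)] pull_deflation[OF P(2)] push_zero[of W2 v A Q] v(1) w(2) by simp
    then have "vectorspace.dim K (Ext C W2 Q\<lparr>carrier := orbit Q (pull C w2 \<delta>) X\<rparr>)
        < vectorspace.dim K (Ext C Y Q\<lparr>carrier := orbit Q \<delta> X\<rparr>)"
      using orbit_pull_less[OF t(3) QO w(2) vf(1)] vf(2) v(2) by simp
    from less.hyps[OF this P(3)]
    have 1: "obj_class C I X - obj_class C I V + obj_class C I W2 \<in> generate (free_Abelian_group I) L" .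
    obtain \<epsilon> m M n B where as: "almost_split C B A \<epsilon>" and ra: "realized_by C \<epsilon> A m M n B"
      using AS by (rule ex_almost_split_realization)
    \<comment> \<open>The relation of \<open>?\<theta>\<close> equals that of an almost split
      extension of the same object \<open>A\<close>, although the two end terms may differ.\<close>
    have "ell C I A = obj_class C I A + obj_class C I Y - obj_class C I W2"
      unfolding ell_eq[OF as ra] using socle_obj_class[OF ra almost_splitD[OF as] P(2) ne soc] by simp
    moreover have "ell C I A \<in> generate (free_Abelian_group I) L" using AS by (intro generate.incl) blast
    ultimately have "(obj_class C I X - obj_class C I V + obj_class C I W2) + (obj_class C I A + obj_class C I Y - obj_class C I W2)
        \<in> generate (free_Abelian_group I) L" using generate_free_Abelian_add[OF 1] by metis
    then show ?thesis unfolding V W1 by (simp add: algebra_simps)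
  qed
qed

lemma generate_L_finite:
  assumes "finite I"
  shows "generate (K0_split I) L = conflation_relations C I"
proof
  obtain Is where Is: "set Is = I" using finite_list[OF assms] by blast
  have "set Is \<subseteq> Ob C" using I_Ob Is by blast
  then obtain Q where Q: "dsum Is Q" using ex_dsum by blast
  show "conflation_relations C I \<subseteq> generate (K0_split I) L"
    unfolding conflation_relations_def K0_split_def
  proof (rule generate_free_Abelian_subset[OF _ L_keys])
    fix m assume "m \<in> {obj_class C I X - obj_class C I Y + obj_class C I Z |X Y Z. \<exists>x y. conflation C X x Y y Z}"
    then show "m \<in> generate (free_Abelian_group I) L"
      using relation_generated[OF Q Is] unfolding conflation_def by blast
  qed
qed (rule generate_L_subset)

section \<open>Finiteness from generation\<close>

lemma finite_ind_add_shift: "finite (I \<inter> add_closure C S)"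
proof (rule finite_subset)
  show "I \<inter> add_closure C S \<subseteq> Poly_Mapping.keys (obj_class C I S)"
  proof
    fix A assume A: "A \<in> I \<inter> add_closure C S"
    then obtain Y V n i j p q where b: "biproduct C A Y V i j p q" and V: "dsum (replicate n S) V"
      unfolding add_closure_iff Int_iff by (elim conjE exE)
    \<comment> \<open>Multiplicities are additive, so an indecomposable that occurs in a power of
      \<open>S\<close> occurs in \<open>S\<close>, and the support of the class of \<open>S\<close>
      is finite.\<close>
    have "dsum (replicate n S) V \<Longrightarrow> Poly_Mapping.lookup (obj_class C I V) A = int n * Poly_Mapping.lookup (obj_class C I S) A" for n V
    proof (induction n arbitrary: V)
      case (Suc n)
      then obtain V' i j p q where b: "biproduct C S V' V i j p q" "dsum (replicate n S) V'" by auto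
      show ?case unfolding obj_class_biproduct[OF b(1)] using Suc.IH[OF b(2)]
        by (simp add: Poly_Mapping.lookup_add algebra_simps)
    qed (simp add: obj_class_zero)
    from this[OF V] have "int n * Poly_Mapping.lookup (obj_class C I S) A
        = Poly_Mapping.lookup (obj_class C I A) A + Poly_Mapping.lookup (obj_class C I Y) A"
      unfolding obj_class_biproduct[OF b] by (simp add: Poly_Mapping.lookup_add)
    also have "\<dots> \<ge> 1" using obj_class_I[of A] A obj_class_nonneg[OF biproduct_simps(14)[OF b]] by simp
    finally have "Poly_Mapping.lookup (obj_class C I S) A \<noteq> 0" by auto
    then show "A \<in> Poly_Mapping.keys (obj_class C I S)" by (simp add: in_keys_iff)
  qed
qed simp

lemma F_T_dim_pos:
  assumes A: "A \<in> I - add_closure C S"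
  shows "0 < vectorspace.dim K (F_hom_space C T T A)"
proof -
  have O: "A \<in> Ob C" using A I_Ob by blast
  interpret V: vectorspace K "F_hom_space C T T A" using F_hom_vectorspace[OF T_Ob T_Ob O] .
  obtain u where u: "arr C u T A" "u \<noteq> \<zero>\<^bsub>Hom C T A\<^esub>" using no_maps_from_T_add_shift[OF O] A by blast
  have "F_map T u \<noteq> \<zero>\<^bsub>F_hom_space C T T A\<^esub>"
  proof
    assume "F_map T u = \<zero>\<^bsub>F_hom_space C T T A\<^esub>"
    from fun_cong[OF this, of "ident C T"] show False using u T_Ob by (simp add: F_map_def F_hom_ops)
  qed
  moreover have "F_map T u \<in> carrier (F_hom_space C T T A)" using F_map_mem[OF T_Ob u(1)] .
  moreover have "VectorSpace.subspace K {\<zero>\<^bsub>F_hom_space C T T A\<^esub>} (F_hom_space C T T A)"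
    by (rule V.subspaceI) auto
  ultimately show ?thesis using V.subspace_dim(2)[OF F_hom_fin_dim[OF T_Ob O]] by fastforce
qed

lemma finite_if_generates:
  assumes gen: "generate (K0_split I) L = conflation_relations C I"
  shows "finite I"
proof -
  obtain \<delta> n M m where M: "is_zero_object C M" and r: "realized_by C \<delta> T n M m S" by (rule shiftE)
  let ?x = "obj_class C I T - obj_class C I M + obj_class C I S"
  have "?x \<in> conflation_relations C I" unfolding conflation_relations_def conflation_def using r by (intro generate.incl) blast
  then have x: "?x \<in> generate (free_Abelian_group I) L" using gen by (simp add: K0_split_def)
  \<comment> \<open>Each generator pairs nontrivially with at most one of these objects, and
    finiteness of the support is preserved by sums and inverses.\<close>
  have "finite {A \<in> I - add_closure C S. form ?x A \<noteq> 0}"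
  proof (rule generate_free_Abelian_induct[OF x L_keys])
    fix l assume "l \<in> L"
    then obtain B where B: "B \<in> I - add_closure C S" "l = ell C I B" by blast
    have "{A \<in> I - add_closure C S. form l A \<noteq> 0} \<subseteq> {B}" using form_ell(1)[OF B(1)] B(2) by blast
    then show "finite {A \<in> I - add_closure C S. form l A \<noteq> 0}" by (rule finite_subset) simp
  next
    fix x y :: "'b \<Rightarrow>\<^sub>0 int"
    assume "finite {A \<in> I - add_closure C S. form x A \<noteq> 0}" "finite {A \<in> I - add_closure C S. form y A \<noteq> 0}"
    then show "finite {A \<in> I - add_closure C S. form (x + y) A \<noteq> 0}"
      by (rule finite_subset[rotated, OF finite_UnI]) (auto simp: form_add)
  qed (simp_all add: form_zero form_uminus)
  moreover have "form ?x A \<noteq> 0" if A: "A \<in> I - add_closure C S" for A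
  proof -
    have O: "A \<in> Ob C" using A I_Ob by blast
    \<comment> \<open>The zero object contributes nothing, the term of \<open>S\<close> is not
      negative, and the term of \<open>T\<close> is positive.\<close>
    have "form ?x A = int (vectorspace.dim K (F_hom_space C T T A)) + int (vectorspace.dim K (F_hom_space C T S A))"
      unfolding obj_class_zero[OF M] using form_add form_obj_class[OF T_Ob O] form_obj_class[OF S_Ob O] by simp
    then show ?thesis using F_T_dim_pos[OF A] by simp
  qed
  then have "I - add_closure C S \<subseteq> {A \<in> I - add_closure C S. form ?x A \<noteq> 0}" by blast
  ultimately have "finite (I - add_closure C S)" by (metis (lifting) finite_subset)
  then have "finite ((I - add_closure C S) \<union> (I \<inter> add_closure C S))" using finite_ind_add_shift by (rule finite_UnI)
  then show ?thesis by (simp add: Un_Diff_Int)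
qed

section \<open>Independence and the expansion formula\<close>

lemma L_independent: "\<not> Modules.module.dependent frag_cmul L"
proof
  assume "Modules.module.dependent frag_cmul L"
  then obtain J u v where J: "finite J" "J \<subseteq> L" "(\<Sum>l \<in> J. frag_cmul (u l) l) = 0" "v \<in> J" "u v \<noteq> 0"
    unfolding Modules.module.dependent_explicit[OF module_frag_cmul] by blast
  obtain A where A: "A \<in> I - add_closure C S" "v = ell C I A" using J by blast
  \<comment> \<open>Elements of \<open>J\<close> other than \<open>v\<close> come from other
    indecomposables, so pairing with \<open>A\<close> isolates the coefficient of
    \<open>v\<close>.\<close>
  have "form l A = 0" if "l \<in> J - {v}" for l
    using that J(2) form_ell(1) A by blast
  then have "(\<Sum>l \<in> J. u l * form l A) = u v * form v A"
    using J(1,4) by (subst sum.remove[of J v]) auto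
  moreover have "(\<Sum>l \<in> J. u l * form l A) = 0"
    using arg_cong[OF J(3), of "\<lambda>x. form x A"] form_sum[OF J(1)] by (simp add: form_zero form_cmul)
  ultimately show False using J(5) form_ell(2)[OF A(1)] A(2) by simp
qed

text \<open>Both sides are additive in \<open>x\<close>, so it suffices to consider generators, and
  there one summand survives by \<open>form_ell\<close>. The identity is stated for each coefficient
  over the rationals, since it is not visible in advance that the quotients are integers.\<close>

lemma expansion:
  assumes fin: "finite I" and x: "x \<in> generate (free_Abelian_group I) L"
  shows "rat_of_int (Poly_Mapping.lookup x B) =
    (\<Sum>A \<in> I - add_closure C S. rat_of_int (form x A) / rat_of_int (form (ell C I A) A)
      * rat_of_int (Poly_Mapping.lookup (ell C I A) B))"
proof (rule generate_free_Abelian_induct[OF x L_keys])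
  fix l assume "l \<in> L"
  then obtain D where D: "D \<in> I - add_closure C S" "l = ell C I D" by blast
  have "(\<Sum>A \<in> I - add_closure C S. rat_of_int (form l A) / rat_of_int (form (ell C I A) A)
      * rat_of_int (Poly_Mapping.lookup (ell C I A) B))
    = (\<Sum>A \<in> I - add_closure C S. if A = D then rat_of_int (Poly_Mapping.lookup (ell C I D) B) else 0)"
    using form_ell[OF D(1)] D(2) by (intro sum.cong) (auto simp: less_le)
  also have "\<dots> = rat_of_int (Poly_Mapping.lookup (ell C I D) B)" using D fin by simp
  finally show "rat_of_int (Poly_Mapping.lookup l B) = (\<Sum>A \<in> I - add_closure C S. rat_of_int (form l A)
      / rat_of_int (form (ell C I A) A) * rat_of_int (Poly_Mapping.lookup (ell C I A) B))" using D(2) by simp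
qed (simp_all add: form_zero form_uminus form_add Poly_Mapping.lookup_add sum_negf add_divide_distrib distrib_right sum.distrib)

lemma finite_iso_classes: "finite (indec_iso_classes C) \<longleftrightarrow> finite I"
proof -
  let ?R = "{(X, Y). isomorphic C X Y}"
  have eq: "?R `` {X} = ?R `` {Y}" if "isomorphic C X Y" for X Y
    using that isomorphic_trans isomorphic_sym by blast
  have "indec_iso_classes C = (\<lambda>A. ?R `` {A}) ` I"
  proof
    show "indec_iso_classes C \<subseteq> (\<lambda>A. ?R `` {A}) ` I"
    proof
      fix c assume "c \<in> indec_iso_classes C"
      then obtain X where X: "indecomposable C X" "c = ?R `` {X}" unfolding indec_iso_classes_def quotient_def by blast
      then obtain A where "A \<in> I" "isomorphic C X A" using ind unfolding ind_representatives_def by blast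
      then show "c \<in> (\<lambda>A. ?R `` {A}) ` I" using eq X(2) by blast
    qed
    show "(\<lambda>A. ?R `` {A}) ` I \<subseteq> indec_iso_classes C"
      using ind unfolding indec_iso_classes_def quotient_def ind_representatives_def by blast
  qed
  moreover have "inj_on (\<lambda>A. ?R `` {A}) I"
  proof (rule inj_onI)
    fix A B assume AB: "A \<in> I" "B \<in> I" "?R `` {A} = ?R `` {B}"
    have "B \<in> ?R `` {B}" using isomorphic_refl[OF I_Ob[OF AB(2)]] by simp
    then show "A = B" using I_distinct AB by blast
  qed
  ultimately show ?thesis by (simp add: finite_image_iff)
qed

end

theorem theorem4p13:
  fixes K :: "'k ring" and C :: "('k, 'o, 'm, 'e) extricat"
    and T N \<Sigma>T :: 'o and t s :: 'm and I :: "'o set"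
  assumes "extriangulated_category K C"
    and "ext_finite K C"
    and "krull_schmidt C"
    and "ARS_duality K C"
    and "projective C T"
    and "\<forall>X \<in> Ob C. \<exists>T\<^sub>1 \<in> add_closure C T. \<exists>T\<^sub>0 \<in> add_closure C T. \<exists>x y. conflation C T\<^sub>1 x T\<^sub>0 y X"
    and "is_zero_object C N"
    and "inflation C T N \<zero>\<^bsub>Hom C T N\<^esub>"
    and "conflation C T t N s \<Sigma>T"
    and "ind_representatives C I"
  defines "L \<equiv> ell C I ` (I - add_closure C \<Sigma>T)"
    and "ker_g \<equiv> kernel (K0_split I) (K0 C I) (K0_proj C I)"
  shows "(finite (indec_iso_classes C) \<longleftrightarrow> generate (K0_split I) L = ker_g) \<and>
    (finite (indec_iso_classes C) \<longrightarrow>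
      (generate (K0_split I) L = ker_g \<and> \<not> Modules.module.dependent frag_cmul L) \<and>
      (\<forall>A \<in> I - add_closure C \<Sigma>T. K0_form K C T (ell C I A) (frag_of A) \<noteq> 0) \<and>
      (\<forall>x \<in> ker_g. \<forall>B.
         rat_of_int (Poly_Mapping.lookup x B) =
           (\<Sum>A \<in> I - add_closure C \<Sigma>T.
              rat_of_int (K0_form K C T x (frag_of A))
                / rat_of_int (K0_form K C T (ell C I A) (frag_of A))
              * rat_of_int (Poly_Mapping.lookup (ell C I A) B))))"
proof -
  interpret extriangulated_category K C by fact
  have "cone_zero T \<Sigma>T" using assms(7,9) unfolding cone_zero_def conflation_def by blast
  then interpret finite_ars_setting K C T \<Sigma>T I
    using assms by unfold_locales auto
  have ker: "ker_g = conflation_relations C I" unfolding ker_g_def by (rule kernel_eq)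
  have gen: "generate (K0_split I) L = ker_g \<longleftrightarrow> finite I"
    unfolding ker L_def using generate_L_finite finite_if_generates by blast
  have "rat_of_int (Poly_Mapping.lookup x B) =
           (\<Sum>A \<in> I - add_closure C \<Sigma>T.
              rat_of_int (K0_form K C T x (frag_of A))
                / rat_of_int (K0_form K C T (ell C I A) (frag_of A))
              * rat_of_int (Poly_Mapping.lookup (ell C I A) B))" if "finite I" "x \<in> ker_g" for x B
    using expansion[OF that(1), of x B] that gen by (simp add: L_def K0_split_def)
  moreover have "K0_form K C T (ell C I A) (frag_of A) \<noteq> 0" if "A \<in> I - add_closure C \<Sigma>T" for A
    using form_ell(2)[OF that] by simp
  ultimately show ?thesis using gen finite_iso_classes L_independent unfolding L_def by blast
qed

end
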